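(* Let $n\in\mathbb{N}$, $p>1$ and $s>0$. If $f\in L^p(\mathbb{R}^n)$, then its (classical) Poisson extension $u=Pf$ satisfies $$t^{s/p}u(x,t)\in L^{p,\infty}\big(\mathbb{R}^{n+1}_+,\,t^{-(s+1)}dx\,dt\big).\qquad( * )$$ Conversely, if a harmonic function $u$ on $\mathbb{R}^{n+1}_+$ satisfies $( * )$, then $u=Pf$ for some $f\in L^p(\mathbb{R}^n)$.
   Context: $\mathbb{R}^{n+1}_+=\{(x,t):x\in\mathbb{R}^n,\ t>0\}$. The Poisson kernel is $P_t(x)=c_n\,t\,(t^2+|x|^2)^{-(n+1)/2}$ for $x\in\mathbb{R}^n$, $t>0$, with $c_n=\Gamma((n+1)/2)/\pi^{(n+1)/2}$, and the Poisson extension of $f\in L^p(\mathbb{R}^n)$ is $(Pf)(x,t)=(P_t*f)(x)$. Functions are real-valued. For a measure $\mu$ on a set $A$ and $p\ge1$, $L^{p,\infty}(A,\mu)$ is the space of measurable $g\colon A\to\mathbb{R}$ for which there is $C\ge0$ with $\mu(\{a\in A:|g(a)|>\lambda\})\le C^p/\lambda^p$ for all $\lambda>0$. The notation $t^{s/p}u(x,t)$ stands for the function $(x,t)\mapsto t^{s/p}u(x,t)$ on $\mathbb{R}^{n+1}_+$. *)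

theory Defs
  imports "HOL-Analysis.Analysis"
begin

text \<open>Both spaces are sets of measurable functions; there is no passage to classes modulo equality
  almost everywhere.\<close>

definition Lp :: "real \<Rightarrow> 'a measure \<Rightarrow> ('a \<Rightarrow> real) set" where
  "Lp p M = {f \<in> borel_measurable M. integrable M (\<lambda>x. \<bar>f x\<bar> powr p)}"

definition weak_Lp :: "real \<Rightarrow> 'a measure \<Rightarrow> ('a \<Rightarrow> real) set" where
  "weak_Lp p M = {g \<in> borel_measurable M. \<exists>C\<ge>0. \<forall>l>0.
     emeasure M {a \<in> space M. \<bar>g a\<bar> > l} \<le> ennreal (C powr p / l powr p)}"

definition upper_half_space :: "((real ^ 'n) \<times> real) set" where
  "upper_half_space = {(x, t). t > 0}"

definition half_space_measure :: "real \<Rightarrow> ((real ^ 'n) \<times> real) measure" where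
  "half_space_measure s =
     density (lebesgue_on upper_half_space) (\<lambda>(x, t). ennreal (t powr (-(s + 1))))"

definition poisson_kernel :: "real \<Rightarrow> real ^ 'n \<Rightarrow> real" where
  "poisson_kernel t x =
     (let m = (real CARD('n) + 1) / 2
      in Gamma m / pi powr m * t * (t\<^sup>2 + (norm x)\<^sup>2) powr (- m))"

definition poisson_extension :: "(real ^ 'n \<Rightarrow> real) \<Rightarrow> (real ^ 'n) \<times> real \<Rightarrow> real" where
  "poisson_extension f = (\<lambda>(x, t). LINT y|lebesgue. poisson_kernel t (x - y) * f y)"

text \<open>Harmonic: of class \<open>C\<^sup>2\<close> with vanishing Laplacian, the Laplacian being the trace of the second
  Frechet derivative \<open>u''\<close>.\<close>

definition harmonic_on :: "'a::euclidean_space set \<Rightarrow> ('a \<Rightarrow> real) \<Rightarrow> bool" where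
  "harmonic_on S u \<longleftrightarrow> open S \<and>
     (\<exists>(u' :: 'a \<Rightarrow> 'a \<Rightarrow>\<^sub>L real) (u'' :: 'a \<Rightarrow> 'a \<Rightarrow>\<^sub>L ('a \<Rightarrow>\<^sub>L real)).
        (\<forall>z\<in>S. (u has_derivative blinfun_apply (u' z)) (at z)) \<and>
        (\<forall>z\<in>S. (u' has_derivative blinfun_apply (u'' z)) (at z)) \<and>
        continuous_on S u'' \<and>
        (\<forall>z\<in>S. (\<Sum>b\<in>Basis. blinfun_apply (blinfun_apply (u'' z) b) b) = 0))"

end

theory Submission
  imports Defs "HOL-Probability.Distributions"
begin

text \<open>The exponents are chosen so that both directions sit on a logarithm. If every slice \<open>u(\<cdot>, t)\<close> has
  \<open>L\<^sup>p\<close> norm at most \<open>N\<close>, then Chebyshev's inequality bounds the measure of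
  \<open>{x. t\<^bsup>s/p\<^esup> \<bar>u(x, t)\<bar> > l}\<close> by \<open>t\<^sup>s N\<^sup>p / l\<^sup>p\<close>, and integrating this against
  \<open>t\<^bsup>-(s+1)\<^esup> dt\<close> gives the divergent integral of \<open>dt / t\<close>.

  For \<open>u = Pf\<close> a truncation removes the divergence (\<open>poisson_extension_weak_bound\<close>). At height \<open>t\<close>
  the relevant level is \<open>h = l t\<^bsup>-s/p\<^esup>\<close>. The part of \<open>f\<close> below \<open>h/2\<close> extends to a function below
  \<open>h/2\<close>, so \<open>\<bar>Pf\<bar> > h\<close> forces the extension of the part of \<open>\<bar>f\<bar>\<close> above \<open>h/2\<close> to exceed \<open>h/2\<close>;
  Markov's inequality and Tonelli's theorem then leave, for each \<open>y\<close>, the integral of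
  \<open>t\<^bsup>s/p - s - 1\<^esup>\<close> over the heights with \<open>\<bar>f y\<bar> > h/2\<close>. Since \<open>p > 1\<close> it converges, to a multiple
  of \<open>\<bar>f y\<bar>\<^bsup>p - 1\<^esup>\<close>.

  Conversely, let \<open>u\<close> be harmonic and of weak type. Averaging over the ball of radius \<open>t/2\<close> around
  \<open>(x, t)\<close> gives \<open>\<bar>u(x, t)\<bar> \<le> K (1 + t\<^bsup>-n\<^esup>)\<close> (\<open>weak_Lp_harmonic_growth\<close>). Hence \<open>u\<close> is bounded on
  each half space \<open>t \<ge> \<epsilon>\<close>, and the maximum principle identifies it there with the Poisson extension of
  its slice at height \<open>\<epsilon>\<close> (\<open>poisson_semigroup_representation\<close>). By Jensen's inequality the \<open>L\<^sup>p\<close> norms of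
  the slices, and also their truncated versions, decrease with the height.

  Now the logarithm becomes an advantage (\<open>weak_Lp_harmonic_slice_bound\<close>). Let \<open>J(t)\<close> be the integral
  of \<open>max 0 (\<bar>u(\<cdot>, t)\<bar>\<^sup>p - h\<^sup>p)\<close>. Between the heights \<open>r\<close> and \<open>\<tau>\<close> the values of
  \<open>t\<^bsup>s/p\<^esup> \<bar>u\<bar>\<close> that matter lie between \<open>r\<^bsup>s/p\<^esup> h\<close> and the bound given by the growth estimate.
  These are at most a multiple of \<open>log (1/r)\<close> dyadic scales, up to an additive constant, if \<open>h\<close> is
  proportional to \<open>r\<close>, and each scale costs a constant by the weak-type condition. So \<open>J(\<tau>) log (\<tau>/r)\<close>,
  which is at most the integral of \<open>J(t) dt / t\<close> over \<open>r \<le> t \<le> \<tau>\<close>, is bounded by a multiple of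
  \<open>log (1/r)\<close> plus a constant, where only the additive constant depends on \<open>\<tau>\<close>. With \<open>r\<close> tending to
  \<open>0\<close> this bounds all slices of height at most \<open>1\<close> in \<open>L\<^sup>p\<close> by one constant.

  Finally the slices converge in \<open>L\<^sup>p\<close> as the height tends to \<open>0\<close> (\<open>poisson_slices_Lp_close\<close>). Their norms
  increase to a finite limit. The midpoint of two low slices, extended by a further height \<open>r\<close>, is close
  to the slice at height \<open>r\<close>, so the norm of the midpoint tends to the same limit, and uniform
  convexity of \<open>\<bar>\<cdot>\<bar>\<^sup>p\<close> makes the slices a Cauchy family. The limit \<open>f\<close> satisfies \<open>u = Pf\<close>, because
  the Poisson extension at a fixed point is continuous on \<open>L\<^sup>p\<close>.\<close>

section \<open>The Poisson kernel\<close>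

lemma nn_integral_lborel_affine:
  fixes f :: "'a::euclidean_space \<Rightarrow> ennreal"
  assumes [measurable]: "f \<in> borel_measurable borel" and c: "c \<noteq> 0"
  shows "(\<integral>\<^sup>+x. f x \<partial>lborel) = ennreal (\<bar>c\<bar> ^ DIM('a)) * (\<integral>\<^sup>+x. f (t + c *\<^sub>R x) \<partial>lborel)"
  by (subst lborel_affine[OF c, of t])
     (simp add: nn_integral_density nn_integral_distr nn_integral_cmult)

lemma lborel_integral_affine:
  fixes f :: "'a::euclidean_space \<Rightarrow> real"
  assumes [measurable]: "f \<in> borel_measurable borel" and c: "c \<noteq> 0"
  shows "(\<integral>x. f x \<partial>lborel) = \<bar>c\<bar> ^ DIM('a) * (\<integral>x. f (t + c *\<^sub>R x) \<partial>lborel)"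
  by (subst lborel_affine[OF c, of t]) (simp add: integral_density integral_distr)

lemma nn_integral_gaussian_real:
  assumes r: "r > (0::real)"
  shows "(\<integral>\<^sup>+x. ennreal (exp (- r * x\<^sup>2)) \<partial>lborel) = ennreal (sqrt (pi / r))"
proof -
  define \<sigma> where "\<sigma> = sqrt (1 / (2 * r))"
  have s: "\<sigma> > 0" "\<sigma>\<^sup>2 = 1 / (2 * r)" using r by (auto simp: \<sigma>_def)
  have eq: "exp (- r * x\<^sup>2) = sqrt (pi / r) * normal_density 0 \<sigma> x" for x
    unfolding normal_density_def s using r
    by (simp add: field_simps real_sqrt_divide)
  have "(\<integral>\<^sup>+x. ennreal (exp (- r * x\<^sup>2)) \<partial>lborel)
      = (\<integral>\<^sup>+x. ennreal (sqrt (pi / r)) * ennreal (normal_density 0 \<sigma> x) \<partial>lborel)"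
    unfolding eq using r by (intro nn_integral_cong ennreal_mult) auto
  also have "\<dots> = ennreal (sqrt (pi / r)) * (\<integral>\<^sup>+x. ennreal (normal_density 0 \<sigma> x) \<partial>lborel)"
    by (rule nn_integral_cmult) auto
  also have "(\<integral>\<^sup>+x. ennreal (normal_density 0 \<sigma> x) \<partial>lborel) = 1"
    using s by (subst nn_integral_eq_integral) (auto simp: integrable_normal_density integral_normal_density)
  finally show ?thesis by simp
qed

lemma nn_integral_gaussian:
  assumes r: "r > (0::real)"
  shows "(\<integral>\<^sup>+x. ennreal (exp (- r * (norm (x::'a::euclidean_space))\<^sup>2)) \<partial>lborel)
    = ennreal ((pi / r) powr (DIM('a) / 2))"
proof -
  have "ennreal (exp (- r * (norm (x::'a))\<^sup>2)) = (\<Prod>b\<in>Basis. ennreal (exp (- r * (x \<bullet> b)\<^sup>2)))" for x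
    by (simp add: prod_ennreal exp_sum[symmetric] sum_distrib_left[symmetric] sum_negf
        power2_norm_eq_inner euclidean_inner[of x x] power2_eq_square[of "x \<bullet> _"])
  then have "(\<integral>\<^sup>+x. ennreal (exp (- r * (norm (x::'a))\<^sup>2)) \<partial>lborel)
    = (\<integral>\<^sup>+x. (\<Prod>b\<in>Basis. ennreal (exp (- r * (x \<bullet> b)\<^sup>2))) \<partial>(lborel :: 'a measure))"
    by simp
  also have "\<dots> = (\<Prod>b\<in>(Basis::'a set). \<integral>\<^sup>+x. ennreal (exp (- r * x\<^sup>2)) \<partial>lborel)"
    by (rule nn_integral_lborel_prod[where f="\<lambda>b x. ennreal (exp (- r * x\<^sup>2))"]) auto
  also have "\<dots> = ennreal (sqrt (pi / r) ^ DIM('a))"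
    using r by (simp add: nn_integral_gaussian_real[OF r, simplified] ennreal_power)
  also have "sqrt (pi / r) ^ DIM('a) = (pi / r) powr (DIM('a) / 2)"
    using r by (simp add: powr_half_sqrt[symmetric] powr_powr flip: powr_realpow)
  finally show ?thesis .
qed

text \<open>Euler's integral after the substitution \<open>t = q r\<close>. It writes a negative power of \<open>q\<close> as a
  superposition of exponentials, which turns powers of \<open>t\<^sup>2 + \<bar>x\<bar>\<^sup>2\<close> into Gaussians.\<close>

lemma nn_integral_Gamma_scaled:
  assumes m: "m > 0" and q: "q > (0::real)"
  shows "(\<integral>\<^sup>+r. ennreal (r powr (m - 1) * exp (- r * q)) * indicator {0<..} r \<partial>lborel)
    = ennreal (Gamma m * q powr (- m))"
proof -
  have "ennreal (Gamma m) = (\<integral>\<^sup>+t. ennreal (indicator {0..} t * t powr (m - 1) / exp t) \<partial>lborel)"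
    using Gamma_conv_nn_integral_real[OF m] by simp
  also have "\<dots> = \<bar>q\<bar> * (\<integral>\<^sup>+t. ennreal (indicator {0..} (0 + q * t) * (0 + q * t) powr (m - 1) / exp (0 + q * t)) \<partial>lborel)"
    using q by (intro nn_integral_real_affine) auto
  also have "(\<integral>\<^sup>+t. ennreal (indicator {0..} (0 + q * t) * (0 + q * t) powr (m - 1) / exp (0 + q * t)) \<partial>lborel)
     = (\<integral>\<^sup>+t. ennreal (q powr (m - 1)) * (ennreal (t powr (m - 1) * exp (- t * q)) * indicator {0<..} t) \<partial>lborel)"
    using q by (intro nn_integral_cong)
      (auto simp: indicator_def zero_le_mult_iff powr_mult exp_minus field_simps simp flip: ennreal_mult)
  also have "\<dots> = ennreal (q powr (m - 1)) * (\<integral>\<^sup>+t. (ennreal (t powr (m - 1) * exp (- t * q)) * indicator {0<..} t) \<partial>lborel)"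
    by (rule nn_integral_cmult) auto
  finally have *: "ennreal (Gamma m) = ennreal (q powr m) *
      (\<integral>\<^sup>+t. (ennreal (t powr (m - 1) * exp (- t * q)) * indicator {0<..} t) \<partial>lborel)"
    using q by (simp add: mult.assoc[symmetric] powr_diff flip: ennreal_mult)
  have "ennreal (Gamma m * q powr (- m)) = ennreal (q powr (-m)) * ennreal (Gamma m)"
    using m by (simp add: ennreal_mult' mult.commute)
  also have "\<dots> = (\<integral>\<^sup>+t. (ennreal (t powr (m - 1) * exp (- t * q)) * indicator {0<..} t) \<partial>lborel)"
    unfolding * using q by (simp add: mult.assoc[symmetric] powr_minus field_simps flip: ennreal_mult)
  finally show ?thesis by simp
qed

definition poisson_const :: "'n::finite itself \<Rightarrow> real" where
  "poisson_const _ = Gamma ((real CARD('n) + 1) / 2) / pi powr ((real CARD('n) + 1) / 2)"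

lemma poisson_const_pos: "poisson_const TYPE('n::finite) > 0"
  unfolding poisson_const_def by (intro divide_pos_pos Gamma_real_pos) auto

lemma poisson_kernel_eq:
  "poisson_kernel t (x :: real ^ 'n) =
     poisson_const TYPE('n) * t * (t\<^sup>2 + (norm x)\<^sup>2) powr (- ((real CARD('n) + 1) / 2))"
  by (simp add: poisson_kernel_def poisson_const_def Let_def)

lemma poisson_kernel_nonneg: "t \<ge> 0 \<Longrightarrow> poisson_kernel t x \<ge> 0"
  by (simp add: poisson_kernel_eq poisson_const_pos less_imp_le)

lemma poisson_kernel_measurable [measurable]:
  assumes "f \<in> borel_measurable M" "g \<in> borel_measurable M"
  shows "(\<lambda>z. poisson_kernel (f z) (g z :: real ^ 'n)) \<in> borel_measurable M"
  unfolding poisson_kernel_eq using assms by measurable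

lemma poisson_kernel_minus: "poisson_kernel t (x - y) = poisson_kernel t (y - x)"
  by (simp add: poisson_kernel_eq norm_minus_commute)

lemma power2_powr: "t > 0 \<Longrightarrow> (t\<^sup>2) powr a = t powr (2 * a)" for t :: real
  by (metis powr_numeral powr_powr less_imp_le)

lemma poisson_kernel_le:
  assumes t: "t > 0"
  shows "poisson_kernel t (x :: real ^ 'n) \<le> poisson_const TYPE('n) * t powr (- real CARD('n))"
proof -
  let ?m = "(real CARD('n) + 1) / 2"
  have "(t\<^sup>2 + (norm x)\<^sup>2) powr (- ?m) \<le> (t\<^sup>2) powr (- ?m)"
    using t by (intro powr_mono2') auto
  also have "(t\<^sup>2) powr (- ?m) = t powr (- real CARD('n) - 1)"
    using t by (simp add: powr_powr power2_powr add_divide_distrib)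
  finally have "t * (t\<^sup>2 + (norm x)\<^sup>2) powr (- ?m) \<le> t * t powr (- real CARD('n) - 1)"
    using t by simp
  also have "\<dots> = t powr (- real CARD('n))"
    using t by (simp add: powr_diff)
  finally show ?thesis
    unfolding poisson_kernel_eq mult.assoc by (intro mult_left_mono) (auto simp: poisson_const_pos less_imp_le)
qed

text \<open>Homogeneity: the substitution \<open>y = x - t y'\<close> carries all heights to height \<open>1\<close>.\<close>

lemma poisson_kernel_scale:
  assumes t: "t > 0"
  shows "t ^ CARD('n) * poisson_kernel t (t *\<^sub>R (x :: real ^ 'n)) = poisson_kernel 1 x"
proof -
  let ?m = "(real CARD('n) + 1) / 2"
  have "(t\<^sup>2 + (norm (t *\<^sub>R x))\<^sup>2) = t\<^sup>2 * (1 + (norm x)\<^sup>2)"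
    by (simp add: power_mult_distrib algebra_simps)
  then have "(t\<^sup>2 + (norm (t *\<^sub>R x))\<^sup>2) powr (- ?m) = (t\<^sup>2) powr (- ?m) * (1 + (norm x)\<^sup>2) powr (- ?m)"
    using t by (simp add: powr_mult)
  also have "(t\<^sup>2) powr (- ?m) = t powr (- real CARD('n) - 1)"
    using t by (simp add: powr_powr power2_powr add_divide_distrib)
  finally have "poisson_kernel t (t *\<^sub>R x)
      = t * t powr (- real CARD('n) - 1) * poisson_kernel 1 x"
    unfolding poisson_kernel_eq by simp
  also have "t * t powr (- real CARD('n) - 1) = t powr (- real CARD('n))"
    using t by (simp add: powr_diff)
  finally show ?thesis using t by (simp add: powr_minus powr_realpow)
qed

text \<open>The kernel is a superposition of Gaussians, each of which factors over the coordinates. After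
  integration in \<open>x\<close> the exponent of \<open>r\<close> is \<open>-1/2\<close> in every dimension, and the remaining integral is
  \<open>Gamma (1/2) / t = sqrt pi / t\<close>.\<close>

lemma nn_integral_poisson_kernel:
  assumes t: "t > 0"
  shows "(\<integral>\<^sup>+x. ennreal (poisson_kernel t (x :: real ^ 'n)) \<partial>lborel) = 1"
proof -
  let ?m = "(real CARD('n) + 1) / 2" and ?n = "real CARD('n)"
  let ?c = "poisson_const TYPE('n)"
  have G: "Gamma ?m > 0" by (intro Gamma_real_pos) auto
  then have G0: "Gamma ?m \<noteq> 0" by linarith
  \<comment> \<open>Subordination of the Poisson kernel to the Gaussian kernels.\<close>
  have P: "ennreal (poisson_kernel t x) = (\<integral>\<^sup>+r. ennreal (?c * t / Gamma ?m) *
      (ennreal (r powr (?m - 1) * exp (- r * (t\<^sup>2 + (norm x)\<^sup>2))) * indicator {0<..} r) \<partial>lborel)" for x :: "real ^ 'n"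
  proof -
    have pos: "t\<^sup>2 + (norm x)\<^sup>2 > 0" using t by (simp add: add_pos_nonneg)
    have "ennreal (poisson_kernel t x) = ennreal (?c * t / Gamma ?m) * ennreal (Gamma ?m * (t\<^sup>2 + (norm x)\<^sup>2) powr (- ?m))"
      using t G G0 poisson_const_pos[where 'n='n] by (simp add: poisson_kernel_eq flip: ennreal_mult)
    also have "ennreal (Gamma ?m * (t\<^sup>2 + (norm x)\<^sup>2) powr (- ?m)) =
        (\<integral>\<^sup>+r. ennreal (r powr (?m - 1) * exp (- r * (t\<^sup>2 + (norm x)\<^sup>2))) * indicator {0<..} r \<partial>lborel)"
      by (rule nn_integral_Gamma_scaled[OF _ pos, symmetric]) simp
    also have "ennreal (?c * t / Gamma ?m) * \<dots> = (\<integral>\<^sup>+r. ennreal (?c * t / Gamma ?m) *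
      (ennreal (r powr (?m - 1) * exp (- r * (t\<^sup>2 + (norm x)\<^sup>2))) * indicator {0<..} r) \<partial>lborel)"
      by (rule nn_integral_cmult[symmetric]) simp
    finally show ?thesis .
  qed
  have "(\<integral>\<^sup>+x. ennreal (poisson_kernel t (x :: real ^ 'n)) \<partial>lborel) =
     (\<integral>\<^sup>+r. (\<integral>\<^sup>+(x :: real ^ 'n). ennreal (?c * t / Gamma ?m) *
      (ennreal (r powr (?m - 1) * exp (- r * (t\<^sup>2 + (norm x)\<^sup>2))) * indicator {0<..} r) \<partial>lborel) \<partial>lborel)"
    unfolding P by (rule lborel_pair.Fubini') simp
  also have "\<dots> = (\<integral>\<^sup>+r. ennreal (?c * t / Gamma ?m) * ennreal (pi powr (?n / 2)) *
      (ennreal (r powr (1/2 - 1) * exp (- r * t\<^sup>2)) * indicator {0<..} r) \<partial>lborel)"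
  proof (rule nn_integral_cong)
    fix r :: real
    have "(\<integral>\<^sup>+(x :: real ^ 'n). ennreal (?c * t / Gamma ?m) *
      (ennreal (r powr (?m - 1) * exp (- r * (t\<^sup>2 + (norm x)\<^sup>2))) * indicator {0<..} r) \<partial>lborel)
      = (\<integral>\<^sup>+(x :: real ^ 'n). (ennreal (?c * t / Gamma ?m) * (ennreal (r powr (?m - 1) * exp (- r * t\<^sup>2)) * indicator {0<..} r))
         * ennreal (exp (- r * (norm x)\<^sup>2)) \<partial>lborel)"
    proof (rule nn_integral_cong)
      fix x :: "real ^ 'n"
      have "ennreal (r powr (?m - 1) * exp (- r * (t\<^sup>2 + (norm x)\<^sup>2)))
          = ennreal (r powr (?m - 1) * exp (- r * t\<^sup>2)) * ennreal (exp (- r * (norm x)\<^sup>2))"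
        by (simp add: distrib_left mult.assoc flip: ennreal_mult exp_add)
      then show "ennreal (?c * t / Gamma ?m) *
          (ennreal (r powr (?m - 1) * exp (- r * (t\<^sup>2 + (norm x)\<^sup>2))) * indicator {0<..} r)
        = ennreal (?c * t / Gamma ?m) * (ennreal (r powr (?m - 1) * exp (- r * t\<^sup>2)) * indicator {0<..} r)
            * ennreal (exp (- r * (norm x)\<^sup>2))"
        by (simp only: ac_simps)
    qed
    also have "\<dots> = (ennreal (?c * t / Gamma ?m) * (ennreal (r powr (?m - 1) * exp (- r * t\<^sup>2)) * indicator {0<..} r))
         * (\<integral>\<^sup>+(x :: real ^ 'n). ennreal (exp (- r * (norm x)\<^sup>2)) \<partial>lborel)"
      by (rule nn_integral_cmult) auto
    also have "\<dots> = ennreal (?c * t / Gamma ?m) * ennreal (pi powr (?n / 2)) *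
      (ennreal (r powr (1/2 - 1) * exp (- r * t\<^sup>2)) * indicator {0<..} r)"
    proof (cases "r > 0")
      case True
      have e: "r powr (?m - 1) * (pi / r) powr (?n / 2) = pi powr (?n / 2) * r powr (1/2 - 1)"
      proof -
        have "r powr (?m - 1) = r powr (?n / 2) * r powr (1/2 - 1)"
          by (simp flip: powr_add add: field_simps)
        then show ?thesis using True by (simp add: powr_divide)
      qed
      have "ennreal (r powr (?m - 1) * exp (- r * t\<^sup>2)) * ennreal ((pi / r) powr (?n / 2))
          = ennreal (pi powr (?n / 2)) * ennreal (r powr (1/2 - 1) * exp (- r * t\<^sup>2))"
        using arg_cong[OF e, of "\<lambda>z. z * exp (- r * t\<^sup>2)"] by (simp add: ac_simps flip: ennreal_mult)
      then show ?thesis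
        using True by (simp only: nn_integral_gaussian[OF True] DIM_cart DIM_real mult_1_right
          mult.assoc indicator_simps greaterThan_iff)
    qed simp
    finally show "(\<integral>\<^sup>+(x :: real ^ 'n). ennreal (?c * t / Gamma ?m) *
      (ennreal (r powr (?m - 1) * exp (- r * (t\<^sup>2 + (norm x)\<^sup>2))) * indicator {0<..} r) \<partial>lborel)
      = ennreal (?c * t / Gamma ?m) * ennreal (pi powr (?n / 2)) *
      (ennreal (r powr (1/2 - 1) * exp (- r * t\<^sup>2)) * indicator {0<..} r)" .
  qed
  also have "\<dots> = ennreal (?c * t / Gamma ?m) * ennreal (pi powr (?n / 2)) *
      (\<integral>\<^sup>+r. (ennreal (r powr (1/2 - 1) * exp (- r * t\<^sup>2)) * indicator {0<..} r) \<partial>lborel)"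
    by (rule nn_integral_cmult) auto
  also have "\<dots> = ennreal (?c * t / Gamma ?m) * ennreal (pi powr (?n / 2)) *
      ennreal (Gamma (1/2) * (t\<^sup>2) powr (- (1/2)))"
    using t by (subst nn_integral_Gamma_scaled) auto
  also have "\<dots> = ennreal (?c * t / Gamma ?m * pi powr (?n / 2) * (Gamma (1/2) * (t\<^sup>2) powr (- (1/2))))"
    using t G G0 poisson_const_pos[where 'n='n] by (simp flip: ennreal_mult)
  also have "?c * t / Gamma ?m * pi powr (?n / 2) * (Gamma (1/2) * (t\<^sup>2) powr (- (1/2))) = 1"
  proof -
    have "(t\<^sup>2) powr (- (1/2)) = 1 / t"
      using t by (simp add: powr_minus powr_half_sqrt field_simps)
    moreover have "pi powr ?m = pi powr (?n / 2) * sqrt pi"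
      by (simp add: powr_half_sqrt[symmetric] add_divide_distrib flip: powr_add)
    ultimately show ?thesis
      using t G0 by (simp add: poisson_const_def Gamma_one_half_real)
  qed
  finally show ?thesis by simp
qed

lemma has_bochner_integral_poisson_kernel:
  assumes "t > 0"
  shows "has_bochner_integral lborel (poisson_kernel t :: real ^ 'n \<Rightarrow> real) 1"
  by (rule has_bochner_integral_nn_integral)
     (use assms in \<open>auto simp: nn_integral_poisson_kernel poisson_kernel_nonneg\<close>)

lemma nn_integral_poisson_kernel_diff:
  assumes t: "t > 0"
  shows "(\<integral>\<^sup>+y. ennreal (poisson_kernel t (x - y :: real ^ 'n)) \<partial>lborel) = 1"
    and "(\<integral>\<^sup>+y. ennreal (poisson_kernel t (y - x :: real ^ 'n)) \<partial>lborel) = 1"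
proof -
  show *: "(\<integral>\<^sup>+y. ennreal (poisson_kernel t (y - x :: real ^ 'n)) \<partial>lborel) = 1"
    using nn_integral_lborel_affine[of "\<lambda>y. ennreal (poisson_kernel t y)" 1 "-x"]
      nn_integral_poisson_kernel[OF t, where 'n='n] by simp
  then show "(\<integral>\<^sup>+y. ennreal (poisson_kernel t (x - y :: real ^ 'n)) \<partial>lborel) = 1"
    by (simp add: poisson_kernel_minus[of t x])
qed

lemma has_bochner_integral_poisson_kernel_diff:
  assumes t: "t > 0"
  shows "has_bochner_integral lborel (\<lambda>y. poisson_kernel t (x - y :: real ^ 'n)) 1"
  by (rule has_bochner_integral_nn_integral)
     (use t in \<open>auto simp: nn_integral_poisson_kernel_diff poisson_kernel_nonneg\<close>)

section \<open>The mean value property of harmonic functions\<close>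

text \<open>Differentiation under the integral sign: by the mean value theorem the difference quotients are
  dominated by the same function as the derivatives.\<close>

lemma has_real_derivative_integral:
  fixes f f' :: "real \<Rightarrow> 'a \<Rightarrow> real"
  assumes ab: "a < s0" "s0 < b"
    and int: "\<And>s. a < s \<Longrightarrow> s < b \<Longrightarrow> integrable M (f s)"
    and der: "\<And>s x. a < s \<Longrightarrow> s < b \<Longrightarrow> ((\<lambda>s. f s x) has_real_derivative f' s x) (at s)"
    and bd: "\<And>s x. a < s \<Longrightarrow> s < b \<Longrightarrow> \<bar>f' s x\<bar> \<le> w x"
    and w: "integrable M w"
    and meas: "f' s0 \<in> borel_measurable M"
  shows "((\<lambda>s. \<integral>x. f s x \<partial>M) has_real_derivative (\<integral>x. f' s0 x \<partial>M)) (at s0)"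
  unfolding DERIV_def tendsto_at_iff_sequentially
proof (intro allI impI)
  fix X :: "nat \<Rightarrow> real"
  assume X0: "\<forall>i. X i \<in> UNIV - {0}" and X: "X \<longlonglongrightarrow> 0"
  have "(\<lambda>i. s0 + X i) \<longlonglongrightarrow> s0 + 0" by (intro tendsto_intros X)
  then have "eventually (\<lambda>i. s0 + X i \<in> {a<..<b}) sequentially"
    using ab by (intro topological_tendstoD) auto
  then obtain N where N: "\<And>i. i \<ge> N \<Longrightarrow> s0 + X i \<in> {a<..<b}"
    by (auto simp: eventually_sequentially)
  have "(\<lambda>i. \<integral>x. (f (s0 + X (i + N)) x - f s0 x) / X (i + N) \<partial>M) \<longlonglongrightarrow> (\<integral>x. f' s0 x \<partial>M)"
  proof (rule integral_dominated_convergence[where w=w])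
    show "AE x in M. (\<lambda>i. (f (s0 + X (i + N)) x - f s0 x) / X (i + N)) \<longlonglongrightarrow> f' s0 x"
    proof (rule AE_I2)
      fix x
      have "(\<lambda>h. (f (s0 + h) x - f s0 x) / h) \<midarrow>0\<rightarrow> f' s0 x"
        using der[OF ab] by (simp add: DERIV_def)
      then have "(\<lambda>i. (f (s0 + X i) x - f s0 x) / X i) \<longlonglongrightarrow> f' s0 x"
        unfolding tendsto_at_iff_sequentially using X0 X by (auto simp: o_def)
      then show "(\<lambda>i. (f (s0 + X (i + N)) x - f s0 x) / X (i + N)) \<longlonglongrightarrow> f' s0 x"
        by (rule LIMSEQ_ignore_initial_segment)
    qed
    show "AE x in M. norm ((f (s0 + X (i + N)) x - f s0 x) / X (i + N)) \<le> w x" for i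
    proof (rule AE_I2)
      fix x
      have "norm (f (s0 + X (i + N)) x - f s0 x) \<le> w x * norm (s0 + X (i + N) - s0)"
      proof (rule field_differentiable_bound[where f="\<lambda>s. f s x" and f'="\<lambda>s. f' s x" and S="{a<..<b}"])
        show "((\<lambda>s. f s x) has_field_derivative f' s x) (at s within {a<..<b})" if "s \<in> {a<..<b}" for s
          using that by (intro has_field_derivative_at_within[OF der]) auto
        show "s0 + X (i + N) \<in> {a<..<b}" by (rule N) simp
        show "norm (f' s x) \<le> w x" if "s \<in> {a<..<b}" for s
          using bd[of s x] that by simp
        show "s0 \<in> {a<..<b}" using ab by simp
      qed (rule convex_real_interval)
      then show "norm ((f (s0 + X (i + N)) x - f s0 x) / X (i + N)) \<le> w x"
        using X0 by (simp add: divide_le_eq)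
    qed
    show "(\<lambda>x. (f (s0 + X (i + N)) x - f s0 x) / X (i + N)) \<in> borel_measurable M" for i
      using N[of "i + N"] int[of "s0 + X (i + N)"] int[OF ab] by (auto intro!: borel_measurable_integrable)
  qed (use w meas in auto)
  also have "(\<lambda>i. \<integral>x. (f (s0 + X (i + N)) x - f s0 x) / X (i + N) \<partial>M)
     = (\<lambda>i. ((\<integral>x. f (s0 + X (i + N)) x \<partial>M) - (\<integral>x. f s0 x \<partial>M)) / X (i + N))"
    using N int int[OF ab] by (auto simp: fun_eq_iff)
  finally show "((\<lambda>h. ((\<integral>x. f (s0 + h) x \<partial>M) - (\<integral>x. f s0 x \<partial>M)) / h) \<circ> X) \<longlonglongrightarrow> (\<integral>x. f' s0 x \<partial>M)"
    unfolding o_def by (rule LIMSEQ_offset)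
qed

lemma integrable_compact_support:
  fixes F :: "'a::euclidean_space \<Rightarrow> real"
  assumes "continuous_on UNIV F" "compact K" "\<And>y. y \<notin> K \<Longrightarrow> F y = 0"
  shows "integrable lborel F"
proof -
  have "integrable lborel (\<lambda>y. indicator K y *\<^sub>R F y)"
    using assms by (intro borel_integrable_compact) (auto intro: continuous_on_subset)
  moreover have "(\<lambda>y. indicator K y *\<^sub>R F y) = F"
    using assms(3) by (force simp: indicator_def)
  ultimately show ?thesis by simp
qed

text \<open>A function given only near the unit ball becomes globally continuous after multiplication by
  a cutoff: the neighbourhood \<open>U\<close> and the complement of the ball are open and cover the space, and on the
  latter the product is \<open>0\<close>.\<close>

lemma continuous_on_mult_compact_support:
  fixes g h :: "'a::real_normed_vector \<Rightarrow> real"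
  assumes "open U" "continuous_on U g" "continuous_on UNIV h" "cball 0 1 \<subseteq> U"
    and h0: "\<And>y. y \<notin> cball 0 1 \<Longrightarrow> h y = 0"
  shows "continuous_on UNIV (\<lambda>y. g y * h y)"
proof -
  have "continuous_on (U \<union> - cball 0 1) (\<lambda>y. g y * h y)"
  proof (rule continuous_on_open_Un)
    show "continuous_on U (\<lambda>y. g y * h y)"
      using assms by (auto intro!: continuous_intros intro: continuous_on_subset)
    have "continuous_on (- cball 0 1) (\<lambda>y. 0 :: real)" by simp
    then show "continuous_on (- cball 0 1) (\<lambda>y. g y * h y)"
      by (rule continuous_on_eq) (simp add: h0)
  qed (use assms in \<open>auto intro: open_Compl\<close>)
  moreover have "U \<union> - cball 0 1 = UNIV" using assms by auto
  ultimately show ?thesis by simp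
qed

text \<open>Integration by parts in its simplest form: the integral of \<open>F (y + s b)\<close> over \<open>y\<close> does not depend
  on \<open>s\<close>, so its derivative at \<open>s = 0\<close> vanishes.\<close>

lemma integral_directional_derivative_eq_0:
  fixes F F' :: "'a::euclidean_space \<Rightarrow> real"
  assumes cF: "continuous_on UNIV F" and cF': "continuous_on UNIV F'"
    and der: "\<And>y. ((\<lambda>s. F (y + s *\<^sub>R b)) has_real_derivative F' y) (at 0)"
    and F0: "\<And>y. y \<notin> cball 0 1 \<Longrightarrow> F y = 0" and F'0: "\<And>y. y \<notin> cball 0 1 \<Longrightarrow> F' y = 0"
    and b: "norm b \<le> 1"
  shows "integral\<^sup>L lborel F' = 0"
proof -
  have "compact (F' ` cball 0 1)"
    using cF' by (intro compact_continuous_image) (auto intro: continuous_on_subset)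
  then obtain K where K: "\<And>y. y \<in> cball 0 1 \<Longrightarrow> \<bar>F' y\<bar> \<le> K"
    by (metis compact_imp_bounded bounded_iff imageI real_norm_def)
  have "0 \<le> K" using K[of 0] by simp
  have [measurable]: "F \<in> borel_measurable borel" "F' \<in> borel_measurable borel"
    using cF cF' by (auto intro: borel_measurable_continuous_onI)
  have iF: "integrable lborel F"
    by (rule integrable_compact_support[OF cF compact_cball F0])
  have "((\<lambda>s. \<integral>y. F (y + s *\<^sub>R b) \<partial>lborel) has_real_derivative (\<integral>y. F' (y + 0 *\<^sub>R b) \<partial>lborel)) (at 0)"
  proof (rule has_real_derivative_integral[of "-1" 0 1 _ _ _ "\<lambda>y. K * indicator (cball 0 2) y"])
    fix s :: real assume s: "-1 < s" "s < 1"
    show "integrable lborel (\<lambda>y. F (y + s *\<^sub>R b))"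
    proof (rule integrable_compact_support[OF _ compact_cball])
      show "continuous_on UNIV (\<lambda>y. F (y + s *\<^sub>R b))"
        by (rule continuous_on_compose2[OF cF]) (auto intro!: continuous_intros)
      show "F (y + s *\<^sub>R b) = 0" if "y \<notin> cball 0 2" for y
      proof (rule F0)
        have "norm y \<le> norm (y + s *\<^sub>R b) + norm (s *\<^sub>R b)"
          by (metis add_diff_cancel norm_triangle_ineq4)
        moreover have "norm (s *\<^sub>R b) \<le> 1 * 1"
          unfolding norm_scaleR using s b by (intro mult_mono) auto
        ultimately show "y + s *\<^sub>R b \<notin> cball 0 1" using that by auto
      qed
    qed
    fix y :: 'a
    have "((\<lambda>h. F ((y + s *\<^sub>R b) + h *\<^sub>R b)) has_real_derivative F' (y + s *\<^sub>R b)) (at (s - s))"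
      using der[of "y + s *\<^sub>R b"] by simp
    then have "((\<lambda>t. F ((y + s *\<^sub>R b) + (t - s) *\<^sub>R b)) has_real_derivative F' (y + s *\<^sub>R b) * 1) (at s)"
      by (rule DERIV_chain2[where f="\<lambda>h. F ((y + s *\<^sub>R b) + h *\<^sub>R b)"]) (auto intro!: derivative_eq_intros)
    then show "((\<lambda>s. F (y + s *\<^sub>R b)) has_real_derivative F' (y + s *\<^sub>R b)) (at s)"
      by (simp add: algebra_simps)
    show "\<bar>F' (y + s *\<^sub>R b)\<bar> \<le> K * indicator (cball 0 2) y"
    proof (cases "y + s *\<^sub>R b \<in> cball 0 1")
      case True
      have "norm y \<le> norm (y + s *\<^sub>R b) + norm (s *\<^sub>R b)"
        by (metis add_diff_cancel norm_triangle_ineq4)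
      moreover have "norm (s *\<^sub>R b) \<le> 1 * 1"
        unfolding norm_scaleR using s b by (intro mult_mono) auto
      ultimately have "y \<in> cball 0 2" using True by auto
      then show ?thesis using K[OF True] by simp
    qed (use F'0 \<open>0 \<le> K\<close> in simp)
  next
    show "integrable lborel (\<lambda>y :: 'a. K * indicator (cball 0 2) y)"
      using emeasure_lborel_cball_finite[of "0::'a" 2] by (auto intro!: integrable_mult_right)
  qed auto
  moreover have "(\<lambda>s. \<integral>y. F (y + s *\<^sub>R b) \<partial>lborel) = (\<lambda>s. \<integral>y. F y \<partial>lborel)"
  proof
    fix s show "(\<integral>y. F (y + s *\<^sub>R b) \<partial>lborel) = (\<integral>y. F y \<partial>lborel)"
      by (subst (2) lborel_distr_plus[symmetric, of "s *\<^sub>R b"]) (simp add: integral_distr add.commute)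
  qed
  ultimately have "((\<lambda>s::real. \<integral>y. F y \<partial>lborel) has_real_derivative (\<integral>y. F' y \<partial>lborel)) (at 0)"
    by simp
  then show ?thesis by (metis DERIV_const DERIV_unique)
qed

text \<open>The radial weight that replaces the indicator function of the unit ball in the mean value
  property. It is the derivative, up to a factor, of \<open>(max 0 (1 - q))\<^sup>3\<close> in \<open>q = \<bar>y\<bar>\<^sup>2\<close>, so that
  \<open>bump y *\<^sub>R y\<close> is a gradient with compact support.\<close>

definition bump :: "'a::euclidean_space \<Rightarrow> real" where
  "bump y = (max 0 (1 - y \<bullet> y))\<^sup>2"

lemma bump_nonneg: "bump y \<ge> 0" by (simp add: bump_def)

lemma bump_le_1: "bump y \<le> 1"
  unfolding bump_def by (rule power_le_one) auto

lemma inner_self_ge_1: "y \<notin> cball 0 1 \<Longrightarrow> y \<bullet> y \<ge> (1::real)"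
  by (metis dist_0_norm less_imp_le mem_cball norm_ge_zero not_le one_le_power power2_norm_eq_inner)

lemma bump_eq_0: "y \<notin> cball 0 1 \<Longrightarrow> bump y = 0"
  using inner_self_ge_1[of y] by (simp add: bump_def)

lemma continuous_on_bump: "continuous_on S bump"
  unfolding bump_def by (intro continuous_intros)

lemma borel_measurable_bump [measurable]: "bump \<in> borel_measurable borel"
  by (rule borel_measurable_continuous_onI[OF continuous_on_bump])

lemma integrable_bump: "integrable lborel (bump :: 'a::euclidean_space \<Rightarrow> real)"
  by (rule integrable_compact_support[OF continuous_on_bump compact_cball bump_eq_0])

lemma DERIV_max_0_cube: "((\<lambda>x. (max 0 x)^3) has_real_derivative 3 * (max 0 x)\<^sup>2) (at x)" for x :: real
proof -
  consider "x > 0" | "x < 0" | "x = 0" by linarith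
  then show ?thesis
  proof cases
    case 1
    have "((\<lambda>x. x^3) has_real_derivative 3 * (max 0 x)\<^sup>2) (at x)"
      using 1 by (auto intro!: derivative_eq_intros)
    then show ?thesis
      by (rule has_field_derivative_transform_within_open[of _ _ _ "{0<..}"]) (use 1 in auto)
  next
    case 2
    have "((\<lambda>x. 0) has_real_derivative 3 * (max 0 x)\<^sup>2) (at x)"
      using 2 by auto
    then show ?thesis
      by (rule has_field_derivative_transform_within_open[of _ _ _ "{..<0}"]) (use 2 in auto)
  next
    case 3
    have "((\<lambda>h. (max 0 h)^3 / h) \<longlongrightarrow> 0) (at (0::real))"
    proof (rule Lim_null_comparison[of _ "\<lambda>h. h\<^sup>2"])
      show "eventually (\<lambda>h::real. norm ((max 0 h)^3 / h) \<le> h\<^sup>2) (at 0)"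
        by (rule always_eventually) (auto simp: max_def power3_eq_cube power2_eq_square)
      have "((\<lambda>h::real. h\<^sup>2) \<longlongrightarrow> 0\<^sup>2) (at 0)" by (intro tendsto_intros)
      then show "((\<lambda>h::real. h\<^sup>2) \<longlongrightarrow> 0) (at 0)" by simp
    qed
    then show ?thesis using 3 by (simp add: DERIV_def)
  qed
qed

text \<open>With \<open>q y = (max 0 (1 - \<bar>y\<bar>\<^sup>2))\<^sup>3\<close> one has \<open>\<nabla>q = -6 bump y y\<close>. The divergence of
  \<open>q y G (z + r y)\<close> integrates to \<open>0\<close>; it is the sum of \<open>r q\<close> times the Laplacian, which vanishes,
  and of \<open>-6 bump y (G (z + r y) \<bullet> y)\<close>.\<close>

lemma integral_bump_gradient_eq_0:
  fixes v :: "'a::euclidean_space \<Rightarrow> real" and G :: "'a \<Rightarrow> 'a" and D :: "'a \<Rightarrow> 'a \<Rightarrow> real"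
  assumes S: "ball z R \<subseteq> S" "open S" and r: "\<bar>r\<bar> < R"
    and dG: "\<And>z b. z \<in> S \<Longrightarrow> b \<in> Basis \<Longrightarrow> ((\<lambda>s. G (z + s *\<^sub>R b) \<bullet> b) has_real_derivative D b z) (at 0)"
    and cG: "continuous_on S G" and cD: "\<And>b. b \<in> Basis \<Longrightarrow> continuous_on S (D b)"
    and lap: "\<And>z. z \<in> S \<Longrightarrow> (\<Sum>b\<in>Basis. D b z) = 0"
  shows "(\<integral>y. bump y * (G (z + r *\<^sub>R y) \<bullet> y) \<partial>lborel) = 0"
proof -
  define U where "U = (\<lambda>y. z + r *\<^sub>R y) -` S"
  have U: "open U"
    unfolding U_def using S(2) by (intro open_vimage continuous_intros)
  have inS: "z + r *\<^sub>R y \<in> S" if "y \<in> cball 0 1" for y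
  proof -
    have "norm (r *\<^sub>R y) \<le> \<bar>r\<bar> * 1" unfolding norm_scaleR using that by (intro mult_left_mono) auto
    then show ?thesis using S r by (auto simp: dist_norm subset_iff)
  qed
  then have cbU: "cball 0 1 \<subseteq> U" by (auto simp: U_def)
  define q where "q y = (max 0 (1 - y \<bullet> y))^3" for y :: 'a
  have q0: "q y = 0" if "y \<notin> cball 0 1" for y
    using inner_self_ge_1[OF that] by (simp add: q_def)
  have cq: "continuous_on UNIV q" unfolding q_def by (intro continuous_intros)
  have cGU: "continuous_on U (\<lambda>y. G (z + r *\<^sub>R y))"
    by (rule continuous_on_compose2[OF cG]) (auto intro!: continuous_intros simp: U_def)
  have cDU: "continuous_on U (\<lambda>y. D b (z + r *\<^sub>R y))" if "b \<in> Basis" for b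
    by (rule continuous_on_compose2[OF cD[OF that]]) (auto intro!: continuous_intros simp: U_def)
  define F where "F b y = (G (z + r *\<^sub>R y) \<bullet> b) * q y" for b y
  define F' where "F' b y = (r * D b (z + r *\<^sub>R y)) * q y + (G (z + r *\<^sub>R y) \<bullet> b * (- 6 * (y \<bullet> b))) * bump y" for b y
  have cF': "continuous_on UNIV (F' b)" if "b \<in> Basis" for b
    unfolding F'_def
    by (intro continuous_on_add continuous_on_mult_compact_support[OF U _ _ cbU] continuous_on_bump cq
         continuous_intros cGU cDU that) (use q0 bump_eq_0 in auto)
  have F'0: "F' b y = 0" if "y \<notin> cball 0 1" for b y
    using that by (simp add: F'_def q0 bump_eq_0)
  have z: "integral\<^sup>L lborel (F' b) = 0" if b: "b \<in> Basis" for b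
  proof (rule integral_directional_derivative_eq_0[of "F b" _ b])
    show "continuous_on UNIV (F b)"
      unfolding F_def
      by (intro continuous_on_mult_compact_support[OF U _ _ cbU] cq continuous_intros cGU) (use q0 in auto)
    show "F b y = 0" if "y \<notin> cball 0 1" for y using that by (simp add: F_def q0)
    show "norm b \<le> 1" using b by simp
    fix y
    show "((\<lambda>s. F b (y + s *\<^sub>R b)) has_real_derivative F' b y) (at 0)"
    proof (cases "y \<in> cball 0 1")
      case False
      have "((\<lambda>s. 0) has_real_derivative 0) (at (0::real))" by simp
      then have "((\<lambda>s. F b (y + s *\<^sub>R b)) has_real_derivative 0) (at 0)"
      proof (rule has_field_derivative_transform_within_open[of _ _ _ "(\<lambda>s. y + s *\<^sub>R b) -` (- cball 0 1)"])
        show "open ((\<lambda>s. y + s *\<^sub>R b) -` (- cball 0 1))"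
          by (intro open_vimage continuous_intros) (auto intro: open_Compl)
      qed (use False q0 in \<open>auto simp: F_def\<close>)
      then show ?thesis using F'0[OF False] by simp
    next
      case True
      have "((\<lambda>s. G ((z + r *\<^sub>R y) + s *\<^sub>R b) \<bullet> b) has_real_derivative D b (z + r *\<^sub>R y)) (at (r * 0))"
        using dG[OF inS[OF True] b] by simp
      then have "((\<lambda>s. G ((z + r *\<^sub>R y) + (r * s) *\<^sub>R b) \<bullet> b) has_real_derivative D b (z + r *\<^sub>R y) * r) (at 0)"
        by (rule DERIV_chain2[where f="\<lambda>s. G ((z + r *\<^sub>R y) + s *\<^sub>R b) \<bullet> b"]) (auto intro!: derivative_eq_intros)
      then have d1: "((\<lambda>s. G (z + r *\<^sub>R (y + s *\<^sub>R b)) \<bullet> b) has_real_derivative D b (z + r *\<^sub>R y) * r) (at 0)"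
        by (simp add: algebra_simps)
      have "((\<lambda>s. 1 - (y + s *\<^sub>R b) \<bullet> (y + s *\<^sub>R b)) has_real_derivative - 2 * (y \<bullet> b)) (at 0)"
        by (simp add: algebra_simps) (auto intro!: derivative_eq_intros simp: inner_commute)
      then have d2: "((\<lambda>s. q (y + s *\<^sub>R b)) has_real_derivative 3 * (max 0 (1 - (y + 0 *\<^sub>R b) \<bullet> (y + 0 *\<^sub>R b)))\<^sup>2 * (- 2 * (y \<bullet> b))) (at 0)"
        unfolding q_def by (rule DERIV_chain2[OF DERIV_max_0_cube])
      show ?thesis
        unfolding F_def F'_def
        by (rule DERIV_cong[OF DERIV_mult[OF d1 d2]]) (simp add: bump_def algebra_simps)
    qed
  qed (use cF'[OF b] F'0 in auto)
  have "0 = (\<Sum>b\<in>Basis. integral\<^sup>L lborel (F' b))" using z by simp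
  also have "\<dots> = (\<integral>y. (\<Sum>b\<in>Basis. F' b y) \<partial>lborel)"
    by (rule Bochner_Integration.integral_sum[symmetric])
       (rule integrable_compact_support[OF cF' compact_cball F'0])
  also have "\<dots> = (\<integral>y. - 6 * (bump y * (G (z + r *\<^sub>R y) \<bullet> y)) \<partial>lborel)"
  proof (rule Bochner_Integration.integral_cong[OF refl])
    fix y :: 'a
    show "(\<Sum>b\<in>Basis. F' b y) = - 6 * (bump y * (G (z + r *\<^sub>R y) \<bullet> y))"
    proof (cases "y \<in> cball 0 1")
      case True
      have "(\<Sum>b\<in>Basis. F' b y) = r * (\<Sum>b\<in>Basis. D b (z + r *\<^sub>R y)) * q y
          + (-6) * bump y * (\<Sum>b\<in>Basis. (G (z + r *\<^sub>R y) \<bullet> b) * (y \<bullet> b))"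
        unfolding F'_def sum.distrib sum_distrib_left sum_distrib_right
        by (intro arg_cong2[where f="(+)"] sum.cong) (auto simp: algebra_simps)
      moreover have "(\<Sum>b\<in>Basis. (G (z + r *\<^sub>R y) \<bullet> b) * (y \<bullet> b)) = G (z + r *\<^sub>R y) \<bullet> y"
        by (rule euclidean_inner[symmetric])
      ultimately show ?thesis using lap[OF inS[OF True]] by simp
    qed (simp add: F'0 bump_eq_0)
  qed
  finally show ?thesis by simp
qed

text \<open>The weighted average over the ball of radius \<open>r\<close> has derivative \<open>0\<close> in \<open>r\<close> by
  \<open>integral_bump_gradient_eq_0\<close>, so it equals its value at \<open>r = 0\<close>. Here \<open>G\<close> is the gradient of \<open>v\<close>
  and \<open>D b\<close> the second derivative in direction \<open>b\<close>.\<close>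

lemma harmonic_mean_value:
  fixes v :: "'a::euclidean_space \<Rightarrow> real" and G :: "'a \<Rightarrow> 'a" and D :: "'a \<Rightarrow> 'a \<Rightarrow> real"
  assumes S: "ball z R \<subseteq> S" "open S" and r: "0 \<le> r" "r < R"
    and dv: "\<And>z. z \<in> S \<Longrightarrow> (v has_derivative (\<lambda>h. G z \<bullet> h)) (at z)"
    and dG: "\<And>z b. z \<in> S \<Longrightarrow> b \<in> Basis \<Longrightarrow> ((\<lambda>s. G (z + s *\<^sub>R b) \<bullet> b) has_real_derivative D b z) (at 0)"
    and cG: "continuous_on S G" and cD: "\<And>b. b \<in> Basis \<Longrightarrow> continuous_on S (D b)"
    and lap: "\<And>z. z \<in> S \<Longrightarrow> (\<Sum>b\<in>Basis. D b z) = 0"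
  shows "(\<integral>y. bump y * v (z + r *\<^sub>R y) \<partial>lborel) = integral\<^sup>L lborel (bump :: 'a \<Rightarrow> real) * v z"
proof -
  have cv: "continuous_on S v"
    using dv by (intro continuous_at_imp_continuous_on) (auto intro: has_derivative_continuous)
  \<comment> \<open>Differentiation takes place on the symmetric interval from \<open>-\<rho>\<close> to \<open>\<rho>\<close>, which contains both \<open>0\<close> and \<open>r\<close> in its interior.\<close>
  define \<rho> where "\<rho> = (r + R) / 2"
  have rho: "r < \<rho>" "\<rho> < R" "0 < \<rho>" using r by (auto simp: \<rho>_def)
  have inS: "z + s *\<^sub>R y \<in> S" "z + s *\<^sub>R y \<in> cball z \<rho>" if "y \<in> cball 0 1" "\<bar>s\<bar> < \<rho>" for s y
  proof -
    have "norm (s *\<^sub>R y) \<le> \<bar>s\<bar> * 1" unfolding norm_scaleR using that by (intro mult_left_mono) auto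
    then show "z + s *\<^sub>R y \<in> S" "z + s *\<^sub>R y \<in> cball z \<rho>" using S rho that by (auto simp: dist_norm subset_iff)
  qed
  have cball: "cball z \<rho> \<subseteq> S" using S rho by auto
  have "compact (G ` cball z \<rho>)"
    using cG cball by (intro compact_continuous_image) (auto intro: continuous_on_subset)
  then obtain K where K: "\<And>y. y \<in> cball z \<rho> \<Longrightarrow> norm (G y) \<le> K"
    by (metis compact_imp_bounded bounded_iff imageI)
  have K0: "0 \<le> K" using K[of z] rho order_trans[OF norm_ge_zero[of "G z"]] by simp
  have cUG: "continuous_on UNIV (\<lambda>y. bump y * g (z + s *\<^sub>R y))"
    if g: "continuous_on S g" and s: "\<bar>s\<bar> < \<rho>" for g :: "'a \<Rightarrow> real" and s
  proof -
    let ?U = "(\<lambda>y. z + s *\<^sub>R y) -` S"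
    have "open ?U" using S(2) by (intro open_vimage continuous_intros)
    moreover have "continuous_on ?U (\<lambda>y. g (z + s *\<^sub>R y))"
      by (rule continuous_on_compose2[OF g]) (auto intro!: continuous_intros)
    ultimately have "continuous_on UNIV (\<lambda>y. g (z + s *\<^sub>R y) * bump y)"
      by (rule continuous_on_mult_compact_support[OF _ _ continuous_on_bump]) (use inS s bump_eq_0 in auto)
    then show ?thesis by (simp add: mult.commute)
  qed
  have "((\<lambda>s. \<integral>y. bump y * v (z + s *\<^sub>R y) \<partial>lborel) has_real_derivative 0) (at s)"
    if s: "-\<rho> < s" "s < \<rho>" for s
  proof -
    have "((\<lambda>s. \<integral>y. bump y * v (z + s *\<^sub>R y) \<partial>lborel) has_real_derivative
        (\<integral>y. bump y * (G (z + s *\<^sub>R y) \<bullet> y) \<partial>lborel)) (at s)"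
    proof (rule has_real_derivative_integral[of "-\<rho>" s \<rho> _ _ _ "\<lambda>y. K * indicator (cball 0 1) y"])
      show "(\<lambda>y. bump y * (G (z + s *\<^sub>R y) \<bullet> y)) \<in> borel_measurable lborel"
      proof -
        have "(\<lambda>y. bump y * (G (z + s *\<^sub>R y) \<bullet> y)) = (\<lambda>y. \<Sum>b\<in>Basis. (bump y * (G (z + s *\<^sub>R y) \<bullet> b)) * (y \<bullet> b))"
          by (subst euclidean_inner) (simp add: sum_distrib_left mult.assoc)
        moreover have "continuous_on UNIV (\<lambda>y. \<Sum>b\<in>Basis. (bump y * (G (z + s *\<^sub>R y) \<bullet> b)) * (y \<bullet> b))"
          using s by (intro continuous_intros cUG cG) auto
        ultimately show ?thesis by (simp add: borel_measurable_continuous_onI)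
      qed
    next
      fix x assume x: "-\<rho> < x" "x < \<rho>"
      show "integrable lborel (\<lambda>y. bump y * v (z + x *\<^sub>R y))"
        by (rule integrable_compact_support[OF cUG[OF cv] compact_cball[of 0 1]]) (use x bump_eq_0 in auto)
      fix y
      show "\<bar>bump y * (G (z + x *\<^sub>R y) \<bullet> y)\<bar> \<le> K * indicator (cball 0 1) y"
      proof (cases "y \<in> cball 0 1")
        case True
        have "\<bar>bump y * (G (z + x *\<^sub>R y) \<bullet> y)\<bar> \<le> 1 * (K * 1)"
          unfolding abs_mult
        proof (rule mult_mono)
          have "\<bar>G (z + x *\<^sub>R y) \<bullet> y\<bar> \<le> norm (G (z + x *\<^sub>R y)) * norm y"
            by (rule Cauchy_Schwarz_ineq2)
          also have "\<dots> \<le> K * 1"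
            using True K0 K inS(2)[OF True, of x] x by (intro mult_mono) auto
          finally show "\<bar>G (z + x *\<^sub>R y) \<bullet> y\<bar> \<le> K * 1" .
        qed (use bump_nonneg[of y] bump_le_1[of y] in auto)
        then show ?thesis using True by simp
      qed (simp add: bump_eq_0)
      show "((\<lambda>s. bump y * v (z + s *\<^sub>R y)) has_real_derivative bump y * (G (z + x *\<^sub>R y) \<bullet> y)) (at x)"
      proof (cases "y \<in> cball 0 1")
        case True
        have "((\<lambda>s. z + s *\<^sub>R y) has_derivative (\<lambda>h. h *\<^sub>R y)) (at x)"
          by (auto intro!: derivative_eq_intros)
        then have "((\<lambda>s. v (z + s *\<^sub>R y)) has_derivative (\<lambda>h. G (z + x *\<^sub>R y) \<bullet> (h *\<^sub>R y))) (at x)"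
          by (rule has_derivative_compose) (use dv[OF inS(1)[OF True]] x in auto)
        then have "((\<lambda>s. v (z + s *\<^sub>R y)) has_real_derivative G (z + x *\<^sub>R y) \<bullet> y) (at x)"
          unfolding has_field_derivative_def by (rule has_derivative_eq_rhs) (simp add: fun_eq_iff)
        then show ?thesis by (rule DERIV_cmult)
      qed (simp add: bump_eq_0)
    next
      show "integrable lborel (\<lambda>y :: 'a. K * indicator (cball 0 1) y)"
        using emeasure_lborel_cball_finite[of "0::'a" 1] by (auto intro!: integrable_mult_right)
    qed (use s in auto)
    also have "(\<integral>y. bump y * (G (z + s *\<^sub>R y) \<bullet> y) \<partial>lborel) = 0"
      by (rule integral_bump_gradient_eq_0[OF S _ dG cG cD lap]) (use s rho in auto)
    finally show ?thesis .
  qed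
  then have "(\<integral>y. bump y * v (z + r *\<^sub>R y) \<partial>lborel) = (\<integral>y. bump y * v (z + 0 *\<^sub>R y) \<partial>lborel)"
    using r rho by (intro DERIV_isconst3[of "-\<rho>" \<rho>]) auto
  then show ?thesis by simp
qed

text \<open>Harmonicity in integrated form. Unlike the condition on second derivatives it passes through
  integrals in a parameter by Fubini's theorem alone, which is how Poisson extensions are treated below.\<close>

definition mean_value_on :: "'a::euclidean_space set \<Rightarrow> ('a \<Rightarrow> real) \<Rightarrow> bool" where
  "mean_value_on S v \<longleftrightarrow> open S \<and> continuous_on S v \<and>
     (\<forall>z R r. ball z R \<subseteq> S \<longrightarrow> 0 \<le> r \<longrightarrow> r < R \<longrightarrow>
        (\<integral>y. bump y * v (z + r *\<^sub>R y) \<partial>lborel) = integral\<^sup>L lborel (bump :: 'a \<Rightarrow> real) * v z)"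

lemma mean_value_onD:
  fixes v :: "'a::euclidean_space \<Rightarrow> real"
  assumes "mean_value_on S v" "ball z R \<subseteq> S" "0 \<le> r" "r < R"
  shows "(\<integral>y. bump y * v (z + r *\<^sub>R y) \<partial>lborel) = integral\<^sup>L lborel (bump :: 'a \<Rightarrow> real) * v z"
  using assms unfolding mean_value_on_def by blast

lemma mean_value_on_continuous: "mean_value_on S v \<Longrightarrow> continuous_on S v"
  by (simp add: mean_value_on_def)

lemma scaled_cball_subset:
  fixes z y :: "'a::real_normed_vector"
  assumes "ball z R \<subseteq> S" "0 \<le> r" "r < R" "y \<in> cball 0 1"
  shows "z + r *\<^sub>R y \<in> S"
proof -
  have "norm (r *\<^sub>R y) \<le> r * 1" unfolding norm_scaleR using assms by (intro mult_mono) auto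
  then show ?thesis using assms by (auto simp: dist_norm subset_iff)
qed

lemma continuous_on_bump_mult:
  fixes z :: "'a::euclidean_space"
  assumes "open S" "continuous_on S v" "ball z R \<subseteq> S" "0 \<le> r" "r < R"
  shows "continuous_on UNIV (\<lambda>y. bump y * v (z + r *\<^sub>R y))"
proof -
  let ?U = "(\<lambda>y. z + r *\<^sub>R y) -` S"
  have "open ?U" using assms by (intro open_vimage continuous_intros)
  moreover have "continuous_on ?U (\<lambda>y. v (z + r *\<^sub>R y))"
    by (rule continuous_on_compose2[OF assms(2)]) (auto intro!: continuous_intros)
  ultimately have "continuous_on UNIV (\<lambda>y. v (z + r *\<^sub>R y) * bump y)"
    by (rule continuous_on_mult_compact_support[OF _ _ continuous_on_bump])
       (use scaled_cball_subset[OF assms(3-5)] bump_eq_0 in auto)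
  then show ?thesis by (simp add: mult.commute)
qed

lemma integrable_bump_mult:
  fixes z :: "'a::euclidean_space"
  assumes "open S" "continuous_on S v" "ball z R \<subseteq> S" "0 \<le> r" "r < R"
  shows "integrable lborel (\<lambda>y. bump y * v (z + r *\<^sub>R y))"
  by (rule integrable_compact_support[OF continuous_on_bump_mult[OF assms] compact_cball[of 0 1]])
     (simp add: bump_eq_0)

lemma mean_value_on_add:
  fixes v w :: "'a::euclidean_space \<Rightarrow> real"
  assumes "mean_value_on S v" "mean_value_on S w"
  shows "mean_value_on S (\<lambda>z. v z + w z)"
  unfolding mean_value_on_def
proof (intro conjI allI impI)
  fix z :: 'a and R r :: real assume *: "ball z R \<subseteq> S" "0 \<le> r" "r < R"
  show "(\<integral>y. bump y * (v (z + r *\<^sub>R y) + w (z + r *\<^sub>R y)) \<partial>lborel) = integral\<^sup>L lborel (bump :: 'a \<Rightarrow> real) * (v z + w z)"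
    using assms * by (simp add: distrib_left integrable_bump_mult[of S _ _ R] mean_value_on_def)
qed (use assms in \<open>auto simp: mean_value_on_def intro!: continuous_intros\<close>)

lemma mean_value_on_cmult:
  fixes v :: "'a::euclidean_space \<Rightarrow> real"
  assumes "mean_value_on S v"
  shows "mean_value_on S (\<lambda>z. c * v z)"
  unfolding mean_value_on_def
proof (intro conjI allI impI)
  fix z :: 'a and R r :: real assume *: "ball z R \<subseteq> S" "0 \<le> r" "r < R"
  show "(\<integral>y. bump y * (c * v (z + r *\<^sub>R y)) \<partial>lborel) = integral\<^sup>L lborel (bump :: 'a \<Rightarrow> real) * (c * v z)"
    using mean_value_onD[OF assms *] by (simp add: mult.left_commute)
qed (use assms in \<open>auto simp: mean_value_on_def intro!: continuous_intros\<close>)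

lemma mean_value_on_diff:
  assumes "mean_value_on S v" "mean_value_on S w"
  shows "mean_value_on S (\<lambda>z. v z - w z)"
  using mean_value_on_add[OF assms(1) mean_value_on_cmult[OF assms(2), of "-1"]] by simp

lemma mean_value_on_cong:
  fixes v w :: "'a::euclidean_space \<Rightarrow> real"
  assumes v: "mean_value_on S v" and eq: "\<And>z. z \<in> S \<Longrightarrow> w z = v z"
  shows "mean_value_on S w"
  unfolding mean_value_on_def
proof (intro conjI allI impI)
  show "open S" using v by (simp add: mean_value_on_def)
  show "continuous_on S w"
    using mean_value_on_continuous[OF v] by (rule continuous_on_eq) (simp add: eq)
  fix z :: 'a and R r :: real assume *: "ball z R \<subseteq> S" "0 \<le> r" "r < R"
  have "(\<integral>y. bump y * w (z + r *\<^sub>R y) \<partial>lborel) = (\<integral>y. bump y * v (z + r *\<^sub>R y) \<partial>lborel)"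
  proof (rule Bochner_Integration.integral_cong[OF refl])
    fix y :: 'a
    show "bump y * w (z + r *\<^sub>R y) = bump y * v (z + r *\<^sub>R y)"
      using eq scaled_cball_subset[OF *] bump_eq_0 by (cases "y \<in> cball 0 1") auto
  qed
  also have "\<dots> = integral\<^sup>L lborel (bump :: 'a \<Rightarrow> real) * v z"
    by (rule mean_value_onD[OF v *])
  also have "v z = w z"
  proof (rule eq[symmetric])
    have "0 < R" using *(2,3) by simp
    then show "z \<in> S" using *(1) centre_in_ball[of z R] by (meson subsetD)
  qed
  finally show "(\<integral>y. bump y * w (z + r *\<^sub>R y) \<partial>lborel) = integral\<^sup>L lborel (bump :: 'a \<Rightarrow> real) * w z" .
qed

lemma mean_value_on_translate:
  fixes v :: "'a::euclidean_space \<Rightarrow> real"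
  assumes v: "mean_value_on S v" and T: "open T" "\<And>z. z \<in> T \<Longrightarrow> z + a \<in> S"
  shows "mean_value_on T (\<lambda>z. v (z + a))"
  unfolding mean_value_on_def
proof (intro conjI allI impI)
  show "continuous_on T (\<lambda>z. v (z + a))"
    by (rule continuous_on_compose2[OF mean_value_on_continuous[OF v]]) (use T in \<open>auto intro!: continuous_intros\<close>)
  fix z :: 'a and R r :: real assume *: "ball z R \<subseteq> T" "0 \<le> r" "r < R"
  have "ball (z + a) R \<subseteq> S"
  proof
    fix x assume "x \<in> ball (z + a) R"
    then have "x - a \<in> ball z R" by (simp add: dist_norm algebra_simps)
    then show "x \<in> S" using *(1) T(2)[of "x - a"] by auto
  qed
  from mean_value_onD[OF v this *(2,3)]
  show "(\<integral>y. bump y * v (z + r *\<^sub>R y + a) \<partial>lborel) = integral\<^sup>L lborel (bump :: 'a \<Rightarrow> real) * v (z + a)"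
    by (simp add: algebra_simps)
qed fact

lemma mean_value_onI:
  fixes v :: "'a::euclidean_space \<Rightarrow> real" and G :: "'a \<Rightarrow> 'a" and D :: "'a \<Rightarrow> 'a \<Rightarrow> real"
  assumes "open S"
    and "\<And>z. z \<in> S \<Longrightarrow> (v has_derivative (\<lambda>h. G z \<bullet> h)) (at z)"
    and "\<And>z b. z \<in> S \<Longrightarrow> b \<in> Basis \<Longrightarrow> ((\<lambda>s. G (z + s *\<^sub>R b) \<bullet> b) has_real_derivative D b z) (at 0)"
    and "continuous_on S G" and "\<And>b. b \<in> Basis \<Longrightarrow> continuous_on S (D b)"
    and "\<And>z. z \<in> S \<Longrightarrow> (\<Sum>b\<in>Basis. D b z) = 0"
  shows "mean_value_on S v"
  unfolding mean_value_on_def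
  using assms harmonic_mean_value[OF _ assms(1) _ _ assms(2-6)]
  by (auto intro!: continuous_at_imp_continuous_on has_derivative_continuous)

lemma mean_value_on_harmonic:
  fixes u :: "'a::euclidean_space \<Rightarrow> real"
  assumes "harmonic_on S u"
  shows "mean_value_on S u"
proof -
  obtain u' :: "'a \<Rightarrow> 'a \<Rightarrow>\<^sub>L real" and u'' :: "'a \<Rightarrow> 'a \<Rightarrow>\<^sub>L ('a \<Rightarrow>\<^sub>L real)" where S: "open S"
    and d1: "\<And>z. z\<in>S \<Longrightarrow> (u has_derivative blinfun_apply (u' z)) (at z)"
    and d2: "\<And>z. z\<in>S \<Longrightarrow> (u' has_derivative blinfun_apply (u'' z)) (at z)"
    and c: "continuous_on S u''"
    and l: "\<And>z. z\<in>S \<Longrightarrow> (\<Sum>b\<in>Basis. blinfun_apply (blinfun_apply (u'' z) b) b) = 0"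
    using assms unfolding harmonic_on_def by blast
  define G where "G z = (\<Sum>b\<in>Basis. blinfun_apply (u' z) b *\<^sub>R b)" for z
  have Gb: "G z \<bullet> b = blinfun_apply (u' z) b" if "b \<in> Basis" for z b
    using that by (simp add: G_def inner_sum_left inner_Basis if_distrib cong: if_cong)
  have Gh: "(\<lambda>h. G z \<bullet> h) = blinfun_apply (u' z)" for z
  proof
    fix h
    have "blinfun_apply (u' z) h = blinfun_apply (u' z) (\<Sum>b\<in>Basis. (h \<bullet> b) *\<^sub>R b)"
      by (simp add: euclidean_representation)
    also have "\<dots> = (\<Sum>b\<in>Basis. (h \<bullet> b) * blinfun_apply (u' z) b)"
      by (simp add: blinfun.sum_right blinfun.scaleR_right)
    finally show "G z \<bullet> h = blinfun_apply (u' z) h"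
      by (simp add: G_def inner_sum_left inner_commute[of h] mult.commute)
  qed
  have cu': "continuous_on S u'"
    using d2 by (intro continuous_at_imp_continuous_on) (auto intro: has_derivative_continuous)
  show ?thesis
  proof (rule mean_value_onI[of S u G "\<lambda>b z. blinfun_apply (blinfun_apply (u'' z) b) b"])
    show "(u has_derivative (\<lambda>h. G z \<bullet> h)) (at z)" if "z \<in> S" for z
      unfolding Gh by (rule d1[OF that])
    show "continuous_on S G"
      unfolding G_def by (intro continuous_on_sum continuous_on_scaleR continuous_on_const blinfun.continuous_on cu')
    show "continuous_on S (\<lambda>z. blinfun_apply (blinfun_apply (u'' z) b) b)" for b
      by (intro continuous_on_const blinfun.continuous_on c)
    fix z b :: 'a assume z: "z \<in> S" and b: "b \<in> Basis"
    have "((\<lambda>s. z + s *\<^sub>R b) has_derivative (\<lambda>h. h *\<^sub>R b)) (at 0)"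
      by (auto intro!: derivative_eq_intros)
    then have "((\<lambda>s. u' (z + s *\<^sub>R b)) has_derivative (\<lambda>h. blinfun_apply (u'' z) (h *\<^sub>R b))) (at 0)"
      by (rule has_derivative_compose) (simp add: d2[OF z])
    then have "((\<lambda>s. blinfun_apply (u' (z + s *\<^sub>R b)) b) has_derivative
        (\<lambda>h. blinfun_apply (blinfun_apply (u'' z) (h *\<^sub>R b)) b)) (at 0)"
      by (rule bounded_linear.has_derivative[OF blinfun.bounded_linear_left])
    then show "((\<lambda>s. G (z + s *\<^sub>R b) \<bullet> b) has_real_derivative blinfun_apply (blinfun_apply (u'' z) b) b) (at 0)"
      unfolding has_field_derivative_def Gb[OF b]
      by (rule has_derivative_eq_rhs) (simp add: fun_eq_iff blinfun.scaleR_right blinfun.scaleR_left)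
  qed (use S l in auto)
qed

section \<open>Harmonic functions on the half space\<close>

lemma open_upper_half_space: "open (upper_half_space :: ((real ^ 'n) \<times> real) set)"
proof -
  have "upper_half_space = (snd :: (real ^ 'n) \<times> real \<Rightarrow> real) -` {0<..}"
    by (auto simp: upper_half_space_def)
  then show ?thesis by (metis open_vimage_snd open_greaterThan)
qed

lemma ball_subset_upper_half_space: "ball (x, t) t \<subseteq> upper_half_space"
proof
  fix z assume z: "z \<in> ball (x, t) t"
  have "\<bar>t - snd z\<bar> \<le> dist (x, t) z"
    using dist_snd_le[of "(x, t)" z] by (simp add: dist_real_def)
  then show "z \<in> upper_half_space"
    using z by (cases z) (auto simp: upper_half_space_def)
qed

text \<open>In dimension \<open>d\<close> the function \<open>(z \<bullet> e) \<bar>z\<bar>\<^bsup>-d\<^esup>\<close> is, up to a constant, a derivative of the fundamental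
  solution of the Laplacian. With \<open>e\<close> the vertical unit vector and \<open>d = n + 1\<close> it is the Poisson kernel up to a
  constant.\<close>

lemma mean_value_on_inner_mult_norm_powr:
  fixes e :: "'a::euclidean_space"
  assumes e: "e \<in> Basis"
  defines "m \<equiv> real DIM('a) / 2"
  shows "mean_value_on {z. z \<bullet> e > 0} (\<lambda>z. (z \<bullet> e) * (z \<bullet> z) powr (- m))"
proof (rule mean_value_onI[of _ _
      "\<lambda>z. (z \<bullet> z) powr (- m) *\<^sub>R e - (2 * m * (z \<bullet> e) * (z \<bullet> z) powr (- m - 1)) *\<^sub>R z"
      "\<lambda>b z. (e \<bullet> b) * (- m * (z \<bullet> z) powr (- m - 1) * (2 * (z \<bullet> b)))
          - 2 * m * ((e \<bullet> b) * (z \<bullet> z) powr (- m - 1) * (z \<bullet> b)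
             + (z \<bullet> e) * ((- m - 1) * (z \<bullet> z) powr (- m - 2) * (2 * (z \<bullet> b))) * (z \<bullet> b)
             + (z \<bullet> e) * (z \<bullet> z) powr (- m - 1))"])
  have pos: "z \<bullet> z > 0" if "z \<in> {z. z \<bullet> e > 0}" for z using that by auto
  show "open {z. z \<bullet> e > 0}" by (intro open_Collect_less continuous_intros)
  show "((\<lambda>z. (z \<bullet> e) * (z \<bullet> z) powr (- m)) has_derivative
      (\<lambda>h. ((z \<bullet> z) powr (- m) *\<^sub>R e - (2 * m * (z \<bullet> e) * (z \<bullet> z) powr (- m - 1)) *\<^sub>R z) \<bullet> h)) (at z)"
    if "z \<in> {z. z \<bullet> e > 0}" for z
  proof -
    have d: "((\<lambda>z. (z \<bullet> z) powr (- m)) has_derivative (\<lambda>h. (- m * (z \<bullet> z) powr (- m - 1)) * (2 * (z \<bullet> h)))) (at z)"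
    proof -
      have "((\<lambda>x. x powr (- m)) has_real_derivative - m * (z \<bullet> z) powr (- m - 1)) (at (z \<bullet> z))"
        by (rule has_real_derivative_powr) (use pos[OF that] in simp)
      then have p: "((\<lambda>x. x powr (- m)) has_derivative (\<lambda>h. (- m * (z \<bullet> z) powr (- m - 1)) * h)) (at (z \<bullet> z))"
        by (rule has_field_derivative_imp_has_derivative)
      have "((\<lambda>z. z \<bullet> z) has_derivative (\<lambda>h. 2 * (z \<bullet> h))) (at z)"
        by (auto intro!: derivative_eq_intros simp: inner_commute)
      from has_derivative_compose[OF this p] show ?thesis .
    qed
    show ?thesis
      by (rule derivative_eq_intros d refl)+ (simp add: fun_eq_iff inner_diff_left inner_commute algebra_simps)
  qed
  show "continuous_on {z. z \<bullet> e > 0} (\<lambda>z. (z \<bullet> z) powr (- m) *\<^sub>R e - (2 * m * (z \<bullet> e) * (z \<bullet> z) powr (- m - 1)) *\<^sub>R z)"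
    by (intro continuous_intros) (use pos in auto)
  show "continuous_on {z. z \<bullet> e > 0} (\<lambda>z. (e \<bullet> b) * (- m * (z \<bullet> z) powr (- m - 1) * (2 * (z \<bullet> b)))
          - 2 * m * ((e \<bullet> b) * (z \<bullet> z) powr (- m - 1) * (z \<bullet> b)
             + (z \<bullet> e) * ((- m - 1) * (z \<bullet> z) powr (- m - 2) * (2 * (z \<bullet> b))) * (z \<bullet> b)
             + (z \<bullet> e) * (z \<bullet> z) powr (- m - 1)))" for b
    by (intro continuous_intros) (use pos in auto)
  fix z assume z: "z \<in> {z. z \<bullet> e > 0}"
  note pz = pos[OF z]
  {
    fix b :: 'a assume b: "b \<in> Basis"
    have bb: "b \<bullet> b = 1" using b by simp
    have q: "((\<lambda>s. (z + s *\<^sub>R b) \<bullet> (z + s *\<^sub>R b)) has_real_derivative 2 * (z \<bullet> b)) (at 0)"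
    proof -
      have "(z + s *\<^sub>R b) \<bullet> (z + s *\<^sub>R b) = z \<bullet> z + 2 * (z \<bullet> b) * s + s\<^sup>2" for s
        using bb by (simp add: inner_add_left inner_add_right inner_commute power2_eq_square)
      then show ?thesis by (auto intro!: derivative_eq_intros)
    qed
    have d: "((\<lambda>s. ((z + s *\<^sub>R b) \<bullet> (z + s *\<^sub>R b)) powr a) has_real_derivative a * (z \<bullet> z) powr (a - 1) * (2 * (z \<bullet> b))) (at 0)" for a
    proof -
      have "((\<lambda>x. x powr a) has_real_derivative a * ((z + 0 *\<^sub>R b) \<bullet> (z + 0 *\<^sub>R b)) powr (a - 1)) (at ((z + 0 *\<^sub>R b) \<bullet> (z + 0 *\<^sub>R b)))"
        by (rule has_real_derivative_powr) (use pz in simp)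
      from DERIV_chain2[OF this q] show ?thesis by simp
    qed
    have lin: "((\<lambda>s. (z + s *\<^sub>R b) \<bullet> c) has_real_derivative (c \<bullet> b)) (at 0)" for c
    proof -
      have "(z + s *\<^sub>R b) \<bullet> c = z \<bullet> c + (c \<bullet> b) * s" for s by (simp add: inner_add_left inner_commute[of b c])
      then show ?thesis by (auto intro!: derivative_eq_intros)
    qed
    have "((\<lambda>s. ((z + s *\<^sub>R b) \<bullet> (z + s *\<^sub>R b)) powr (- m) * (e \<bullet> b)
        - 2 * m * ((z + s *\<^sub>R b) \<bullet> e * ((z + s *\<^sub>R b) \<bullet> (z + s *\<^sub>R b)) powr (- m - 1) * ((z + s *\<^sub>R b) \<bullet> b)))
        has_real_derivative
         (e \<bullet> b) * (- m * (z \<bullet> z) powr (- m - 1) * (2 * (z \<bullet> b)))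
          - 2 * m * ((e \<bullet> b) * (z \<bullet> z) powr (- m - 1) * (z \<bullet> b)
             + (z \<bullet> e) * ((- m - 1) * (z \<bullet> z) powr (- m - 2) * (2 * (z \<bullet> b))) * (z \<bullet> b)
             + (z \<bullet> e) * (z \<bullet> z) powr (- m - 1))) (at 0)"
      by (rule DERIV_cong[OF DERIV_diff[OF DERIV_cmult_right[OF d] DERIV_cmult[OF DERIV_mult[OF DERIV_mult[OF lin d] lin]]]])
         (simp add: bb algebra_simps)
    then show "((\<lambda>s. (((z + s *\<^sub>R b) \<bullet> (z + s *\<^sub>R b)) powr (- m) *\<^sub>R e
          - (2 * m * ((z + s *\<^sub>R b) \<bullet> e) * ((z + s *\<^sub>R b) \<bullet> (z + s *\<^sub>R b)) powr (- m - 1)) *\<^sub>R (z + s *\<^sub>R b)) \<bullet> b)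
        has_real_derivative
         (e \<bullet> b) * (- m * (z \<bullet> z) powr (- m - 1) * (2 * (z \<bullet> b)))
          - 2 * m * ((e \<bullet> b) * (z \<bullet> z) powr (- m - 1) * (z \<bullet> b)
             + (z \<bullet> e) * ((- m - 1) * (z \<bullet> z) powr (- m - 2) * (2 * (z \<bullet> b))) * (z \<bullet> b)
             + (z \<bullet> e) * (z \<bullet> z) powr (- m - 1))) (at 0)"
      by (simp only: inner_diff_left inner_scaleR_left mult.assoc)
  }
  let ?N = "(z \<bullet> z) powr (- m - 1)" and ?N2 = "(z \<bullet> z) powr (- m - 2)"
  have N: "?N2 * (z \<bullet> z) = ?N"
  proof -
    have "- m - 1 = (- m - 2) + 1" by simp
    then show ?thesis using pz by (simp only: powr_add powr_one less_imp_le)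
  qed
  have s1: "(\<Sum>b\<in>Basis. (e \<bullet> b) * (z \<bullet> b)) = z \<bullet> e"
    by (subst inner_commute) (rule euclidean_inner[symmetric])
  have s2: "(\<Sum>b\<in>Basis. (z \<bullet> b) * (z \<bullet> b)) = z \<bullet> z"
    by (rule euclidean_inner[symmetric])
  have "(\<Sum>b\<in>Basis. (e \<bullet> b) * (- m * ?N * (2 * (z \<bullet> b)))
          - 2 * m * ((e \<bullet> b) * ?N * (z \<bullet> b)
             + (z \<bullet> e) * ((- m - 1) * ?N2 * (2 * (z \<bullet> b))) * (z \<bullet> b)
             + (z \<bullet> e) * ?N))
     = (\<Sum>b\<in>Basis. (- 4 * m * ?N) * ((e \<bullet> b) * (z \<bullet> b))
          + (4 * m * (m + 1) * (z \<bullet> e) * ?N2) * ((z \<bullet> b) * (z \<bullet> b))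
             + (- 2 * m * (z \<bullet> e) * ?N))"
    by (rule sum.cong) (auto simp: algebra_simps)
  also have "\<dots> = (- 4 * m * ?N) * (z \<bullet> e) + (4 * m * (m + 1) * (z \<bullet> e)) * (?N2 * (z \<bullet> z))
             + real DIM('a) * (- 2 * m * (z \<bullet> e) * ?N)"
    unfolding sum.distrib sum_distrib_left[symmetric] s1 s2 by simp
  also have "\<dots> = 0"
    unfolding N by (simp add: m_def field_simps)
  finally show "(\<Sum>b\<in>Basis. (e \<bullet> b) * (- m * ?N * (2 * (z \<bullet> b)))
          - 2 * m * ((e \<bullet> b) * ?N * (z \<bullet> b)
             + (z \<bullet> e) * ((- m - 1) * ?N2 * (2 * (z \<bullet> b))) * (z \<bullet> b)
             + (z \<bullet> e) * ?N)) = 0" .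
qed

lemma mean_value_on_poisson_kernel:
  "mean_value_on upper_half_space (\<lambda>z. poisson_kernel (snd z) (fst z - y :: real ^ 'n))"
proof -
  have e: "(0 :: real ^ 'n, 1 :: real) \<in> Basis" by (simp add: Basis_prod_def)
  have H: "{z. z \<bullet> (0 :: real ^ 'n, 1 :: real) > 0} = upper_half_space"
    by (auto simp: upper_half_space_def)
  have "mean_value_on upper_half_space (\<lambda>z. poisson_const TYPE('n) *
      ((z \<bullet> (0 :: real ^ 'n, 1 :: real)) * (z \<bullet> z) powr (- (real DIM((real ^ 'n) \<times> real) / 2))))"
    using mean_value_on_cmult[OF mean_value_on_inner_mult_norm_powr[OF e]] unfolding H .
  then have "mean_value_on upper_half_space (\<lambda>z. (poisson_const TYPE('n) *
      (((z + (- y, 0)) \<bullet> (0 :: real ^ 'n, 1 :: real)) * ((z + (- y, 0)) \<bullet> (z + (- y, 0))) powr (- (real DIM((real ^ 'n) \<times> real) / 2)))))"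
    by (rule mean_value_on_translate) (auto simp: open_upper_half_space, auto simp: upper_half_space_def)
  also have "(\<lambda>z. (poisson_const TYPE('n) *
      (((z + (- y, 0)) \<bullet> (0 :: real ^ 'n, 1 :: real)) * ((z + (- y, 0)) \<bullet> (z + (- y, 0))) powr (- (real DIM((real ^ 'n) \<times> real) / 2)))))
     = (\<lambda>z. poisson_kernel (snd z) (fst z - y))"
    by (auto simp: fun_eq_iff poisson_kernel_eq dot_square_norm norm_Pair add.commute simp flip: power2_eq_square)
  finally show ?thesis .
qed

lemma mean_value_on_snd: "mean_value_on upper_half_space (snd :: (real ^ 'n) \<times> real \<Rightarrow> real)"
proof (rule mean_value_onI[of _ _ "\<lambda>_. (0, 1)" "\<lambda>_ _. 0"])
  show "(snd has_derivative (\<lambda>h. (0, 1) \<bullet> h)) (at z)" for z :: "(real ^ 'n) \<times> real"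
    by (rule has_derivative_eq_rhs[OF bounded_linear_imp_has_derivative[OF bounded_linear_snd]]) auto
qed (auto simp: open_upper_half_space)

text \<open>The harmonic part of the barrier in the maximum principle.\<close>

lemma mean_value_on_barrier:
  "mean_value_on upper_half_space (\<lambda>z :: (real ^ 'n) \<times> real. fst z \<bullet> fst z - real CARD('n) * (snd z)\<^sup>2)"
  (is "mean_value_on _ ?q")
proof (rule mean_value_onI[of _ _ "\<lambda>z. (2 *\<^sub>R fst z, - 2 * real CARD('n) * snd z)"
      "\<lambda>b _. 2 * (fst b \<bullet> fst b) - 2 * real CARD('n) * (snd b * snd b)"])
  show "(?q has_derivative (\<lambda>h. (2 *\<^sub>R fst z, - 2 * real CARD('n) * snd z) \<bullet> h)) (at z)" for z
    by (auto intro!: derivative_eq_intros simp: inner_prod_def inner_commute algebra_simps)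
  fix z b :: "(real ^ 'n) \<times> real"
  have "(2 *\<^sub>R fst (z + s *\<^sub>R b), - 2 * real CARD('n) * snd (z + s *\<^sub>R b)) \<bullet> b
     = (2 *\<^sub>R fst z, - 2 * real CARD('n) * snd z) \<bullet> b + s * (2 * (fst b \<bullet> fst b) - 2 * real CARD('n) * (snd b * snd b))" for s
    by (simp add: inner_prod_def algebra_simps)
  then show "((\<lambda>s. (2 *\<^sub>R fst (z + s *\<^sub>R b), - 2 * real CARD('n) * snd (z + s *\<^sub>R b)) \<bullet> b)
     has_real_derivative 2 * (fst b \<bullet> fst b) - 2 * real CARD('n) * (snd b * snd b)) (at 0)"
    by (auto intro!: derivative_eq_intros)
next
  show "(\<Sum>b\<in>(Basis :: ((real ^ 'n) \<times> real) set). 2 * (fst b \<bullet> fst b) - 2 * real CARD('n) * (snd b * snd b)) = 0"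
    unfolding Basis_prod_def by (subst sum.union_disjoint) (auto simp: Basis_prod_def sum.reindex inj_on_def)
qed (auto simp: open_upper_half_space intro!: continuous_intros)

section \<open>A maximum principle on the half space\<close>

lemma integral_pos_of_continuous:
  fixes f :: "'a::euclidean_space \<Rightarrow> real"
  assumes c: "continuous_on UNIV f" and nn: "\<And>x. f x \<ge> 0" and pos: "f a > 0" and int: "integrable lborel f"
  shows "integral\<^sup>L lborel f > 0"
proof -
  have "isCont f a" using c by (simp add: continuous_on_eq_continuous_at)
  then have "\<exists>d>0. \<forall>x. dist x a < d \<longrightarrow> dist (f x) (f a) < f a / 2"
    using pos unfolding continuous_at_eps_delta by (metis half_gt_zero)
  then obtain d where d: "d > 0" "\<And>x. dist x a < d \<Longrightarrow> dist (f x) (f a) < f a / 2" by blast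
  have le: "f a / 2 * indicator (ball a d) x \<le> f x" for x
  proof (cases "dist x a < d")
    case True
    from d(2)[OF this] have "f a / 2 \<le> f x" unfolding dist_real_def by linarith
    then show ?thesis using nn[of x] by (simp add: indicator_def)
  qed (use nn[of x] in \<open>simp add: dist_commute\<close>)
  have "0 < f a / 2 * measure lborel (ball a d)"
    using pos content_ball_pos[OF d(1), of a] by (simp add: measure_completion)
  also have "\<dots> = (\<integral>x. f a / 2 * indicator (ball a d) x \<partial>lborel)"
    by simp
  also have "\<dots> \<le> integral\<^sup>L lborel f"
    using emeasure_lborel_ball_finite[of a d] by (intro integral_mono le int) (auto intro!: integrable_mult_right)
  finally show ?thesis .
qed

lemma integral_bump_pos: "integral\<^sup>L lborel (bump :: 'a::euclidean_space \<Rightarrow> real) > 0"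
  by (rule integral_pos_of_continuous[of _ 0, OF continuous_on_bump bump_nonneg _ integrable_bump])
     (simp add: bump_def)

text \<open>A Phragmen-Lindelof argument. On the strip \<open>0 \<le> t \<le> T\<close> compare \<open>v\<close> with \<open>M t / T + \<delta> h\<close>, where
  \<open>h = \<bar>x\<bar>\<^sup>2 + (n + 1) (T\<^sup>2 - t\<^sup>2)\<close>. The linear term dominates \<open>v\<close> at the top, the quadratic one far
  away in \<open>x\<close>, so a positive value of \<open>w = v - M t / T - \<delta> h\<close> would be attained as an interior
  maximum. But \<open>w\<close> is a function with the mean value property plus \<open>\<delta> t\<^sup>2\<close>, hence its averages strictly
  exceed its values. Large \<open>T\<close> and then small \<open>\<delta>\<close> make \<open>w\<close> positive wherever \<open>v\<close> is.\<close>

lemma half_space_maximum_principle: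
  fixes v :: "(real ^ 'n) \<times> real \<Rightarrow> real"
  assumes mv: "mean_value_on upper_half_space v"
    and cont: "continuous_on {z. snd z \<ge> 0} v"
    and bdd: "\<And>z. snd z \<ge> 0 \<Longrightarrow> v z \<le> M"
    and zero: "\<And>x. v (x, 0) \<le> 0"
    and t: "t > 0"
  shows "v (x, t) \<le> 0"
proof (rule ccontr)
  assume "\<not> v (x, t) \<le> 0"
  then have c: "v (x, t) > 0" by simp
  then have M: "M > 0" using bdd[of "(x, t)"] t by simp
  define n where "n = real CARD('n)"
  \<comment> \<open>The choice of \<open>T\<close> makes the linear term at most a quarter of \<open>v (x, t)\<close>, that of \<open>\<delta>\<close> does the same for the barrier.\<close>
  define T where "T = max (2 * t) (4 * M * t / v (x, t))"
  have T: "T \<ge> 2 * t" "T > 0" "M / T * t \<le> v (x, t) / 4"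
  proof -
    show 1: "T \<ge> 2 * t" "T > 0" using t by (auto simp: T_def)
    have "4 * M * t / v (x, t) \<le> T" by (simp add: T_def)
    then show "M / T * t \<le> v (x, t) / 4" using 1 c by (simp add: field_simps)
  qed
  define h where "h z = fst z \<bullet> fst z - n * (snd z)\<^sup>2 - (snd z)\<^sup>2 + (n + 1) * T\<^sup>2" for z :: "(real ^ 'n) \<times> real"
  have hge: "h z \<ge> fst z \<bullet> fst z" if "0 \<le> snd z" "snd z \<le> T" for z
  proof -
    have "(n + 1) * (snd z)\<^sup>2 \<le> (n + 1) * T\<^sup>2"
      using that by (intro mult_left_mono power_mono) (auto simp: n_def)
    then show ?thesis by (simp add: h_def algebra_simps)
  qed
  then have hnn: "h z \<ge> 0" if "0 \<le> snd z" "snd z \<le> T" for z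
    using that inner_ge_zero[of "fst z"] by (meson order_trans)
  define \<delta> where "\<delta> = v (x, t) / (4 * (h (x, t) + 1))"
  have hx: "h (x, t) \<ge> 0" using t T by (intro hnn) auto
  have d: "\<delta> > 0" using c hx by (auto simp: \<delta>_def)
  have dh: "\<delta> * h (x, t) \<le> v (x, t) / 4"
    using c hx by (simp add: \<delta>_def field_simps)
  define w where "w z = v z - M / T * snd z - \<delta> * h z" for z
  have w0: "w (x, t) > 0"
    using T(3) dh c by (simp add: w_def)
  \<comment> \<open>Where \<open>norm (fst z) = \<rho>\<close> the barrier \<open>\<delta> * h z\<close> is at least the bound \<open>M\<close> of \<open>v\<close>.\<close>
  define \<rho> where "\<rho> = max (norm x) (sqrt (M / \<delta>))"
  have rho: "\<delta> * \<rho>\<^sup>2 \<ge> M"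
  proof -
    have "M / \<delta> = (sqrt (M / \<delta>))\<^sup>2" using M d by simp
    also have "\<dots> \<le> \<rho>\<^sup>2" using M d by (intro power_mono) (auto simp: \<rho>_def)
    finally show ?thesis using d by (simp add: field_simps)
  qed
  define K where "K = cball (0 :: real ^ 'n) \<rho> \<times> {0..T}"
  have K: "compact K" unfolding K_def by (intro compact_Times) auto
  have KH: "K \<subseteq> {z. snd z \<ge> 0}" by (auto simp: K_def)
  have "continuous_on K w"
    unfolding w_def h_def using continuous_on_subset[OF cont KH] T(2) by (auto intro!: continuous_intros)
  moreover have xK: "(x, t) \<in> K" using t T by (auto simp: K_def \<rho>_def)
  ultimately obtain z where z: "z \<in> K" "\<And>y. y \<in> K \<Longrightarrow> w y \<le> w z"
    using continuous_attains_sup[OF K, of w] by blast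
  obtain x1 t1 where z1: "z = (x1, t1)" by (cases z)
  have wz: "w z > 0" using z(2)[OF xK] w0 by linarith
  have tz: "0 \<le> t1" "t1 \<le> T" "norm x1 \<le> \<rho>" using z(1) by (auto simp: K_def z1)
  have "t1 \<noteq> 0"
  proof
    assume "t1 = 0"
    then have "w z \<le> - \<delta> * h z" using zero[of x1] by (simp add: w_def z1)
    moreover have "\<delta> * h z \<ge> 0" using d hnn[of z] tz by (auto simp: z1)
    ultimately show False using wz by simp
  qed
  moreover have "t1 \<noteq> T"
  proof
    assume "t1 = T"
    then have "w z \<le> - \<delta> * h z" using bdd[of z] tz T by (simp add: w_def z1)
    moreover have "\<delta> * h z \<ge> 0" using d hnn[of z] tz by (auto simp: z1)
    ultimately show False using wz by simp
  qed
  moreover have "norm x1 \<noteq> \<rho>"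
  proof
    assume "norm x1 = \<rho>"
    then have "\<delta> * h z \<ge> \<delta> * \<rho>\<^sup>2"
      using hge[of z] tz d by (intro mult_left_mono) (auto simp: z1 power2_norm_eq_inner[symmetric])
    moreover have "v z \<le> M" using bdd[of z] tz by (simp add: z1)
    moreover have "M / T * t1 \<ge> 0" using M T tz by simp
    ultimately show False using wz rho by (simp add: w_def z1)
  qed
  ultimately have "z \<in> ball 0 \<rho> \<times> {0<..<T}" using tz by (auto simp: z1)
  moreover have "open (ball (0 :: real ^ 'n) \<rho> \<times> {0<..<T})" by (intro open_Times) auto
  ultimately obtain R where R: "R > 0" "ball z R \<subseteq> ball 0 \<rho> \<times> {0<..<T}"
    by (meson open_contains_ball)
  have RU: "ball z R \<subseteq> upper_half_space" using R(2) by (force simp: upper_half_space_def)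
  have RK: "ball z R \<subseteq> K" using R(2) by (force simp: K_def)
  define r where "r = R / 2"
  have r: "0 \<le> r" "r < R" "r > 0" using R by (auto simp: r_def)
  let ?W = "integral\<^sup>L lborel (bump :: (real ^ 'n) \<times> real \<Rightarrow> real)"
  define g where "g z = (v z - M / T * snd z) - \<delta> * (fst z \<bullet> fst z - n * (snd z)\<^sup>2)" for z
  have g: "mean_value_on upper_half_space g"
    unfolding g_def n_def
    by (intro mean_value_on_diff mean_value_on_cmult mv mean_value_on_snd mean_value_on_barrier)
  \<comment> \<open>The summand \<open>\<delta> t\<^sup>2\<close> is the only one whose averages differ from its values.\<close>
  have wg: "w z = g z + \<delta> * (snd z)\<^sup>2 - \<delta> * ((n + 1) * T\<^sup>2)" for z
    by (simp add: w_def g_def h_def algebra_simps)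
  note ibm = integrable_bump_mult[OF open_upper_half_space _ RU r(1,2)]
  have cw: "continuous_on upper_half_space w"
    unfolding wg using mean_value_on_continuous[OF g] by (auto intro!: continuous_intros)
  have i1: "integrable lborel (\<lambda>y. bump y * g (z + r *\<^sub>R y))"
    by (rule ibm[OF mean_value_on_continuous[OF g]])
  have i2: "integrable lborel (\<lambda>y :: (real ^ 'n) \<times> real. bump y * snd y)"
    by (rule integrable_compact_support[of _ "cball 0 1"])
       (auto intro!: continuous_intros continuous_on_bump simp: bump_eq_0)
  have c3: "continuous_on UNIV (\<lambda>y :: (real ^ 'n) \<times> real. bump y * (snd y)\<^sup>2)"
    by (intro continuous_intros continuous_on_bump)
  have i3: "integrable lborel (\<lambda>y :: (real ^ 'n) \<times> real. bump y * (snd y)\<^sup>2)"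
    by (rule integrable_compact_support[of _ "cball 0 1", OF c3]) (auto simp: bump_eq_0)
  have s2: "(\<integral>y. bump y * snd (y :: (real ^ 'n) \<times> real) \<partial>lborel) = (0::real)" (is "?I = 0")
  proof -
    have "(\<integral>y. bump y * snd (z + r *\<^sub>R y) \<partial>lborel) = ?W * snd z"
      by (rule mean_value_onD[OF mean_value_on_snd RU r(1,2)])
    also have "(\<integral>y. bump y * snd (z + r *\<^sub>R y) \<partial>lborel) = (\<integral>y. bump y * snd z + r * (bump y * snd (y :: (real ^ 'n) \<times> real)) \<partial>lborel)"
      by (simp add: algebra_simps)
    also have "\<dots> = ?W * snd z + r * ?I"
      using i2 by (simp add: integrable_bump)
    finally show ?thesis using r by simp
  qed
  have s3: "(\<integral>y. bump y * (snd (y :: (real ^ 'n) \<times> real))\<^sup>2 \<partial>lborel) > (0::real)" (is "?J > 0")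
  proof (rule integral_pos_of_continuous[of _ "(0, 1/2)", OF c3 _ _ i3])
    show "0 \<le> bump x * (snd x)\<^sup>2" for x :: "(real ^ 'n) \<times> real" by (simp add: bump_nonneg)
    show "bump (0 :: real ^ 'n, 1/2 :: real) * (snd (0 :: real ^ 'n, 1/2 :: real))\<^sup>2 > 0"
      by (simp add: bump_def)
  qed
  have "?W * w z + \<delta> * r\<^sup>2 * ?J = ?W * g z + (\<delta> * (snd z)\<^sup>2 - \<delta> * ((n + 1) * T\<^sup>2)) * ?W + (2 * \<delta> * r * snd z) * ?I + \<delta> * r\<^sup>2 * ?J"
    unfolding wg s2 by (simp add: algebra_simps)
  also have "\<dots> = (\<integral>y. bump y * g (z + r *\<^sub>R y) + (\<delta> * (snd z)\<^sup>2 - \<delta> * ((n + 1) * T\<^sup>2)) * bump y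
        + (2 * \<delta> * r * snd z) * (bump y * snd y) + \<delta> * r\<^sup>2 * (bump y * (snd y)\<^sup>2) \<partial>lborel)"
    using i1 i2 i3 mean_value_onD[OF g RU r(1,2)] by (simp add: integrable_bump)
  also have "\<dots> = (\<integral>y. bump y * w (z + r *\<^sub>R y) \<partial>lborel)"
    by (rule Bochner_Integration.integral_cong) (auto simp: wg power2_eq_square algebra_simps)
  also have "\<dots> \<le> (\<integral>y. bump (y :: (real ^ 'n) \<times> real) * w z \<partial>lborel)"
  proof (rule integral_mono)
    show "integrable lborel (\<lambda>y. bump y * w (z + r *\<^sub>R y))" by (rule ibm[OF cw])
    show "bump y * w (z + r *\<^sub>R y) \<le> bump y * w z" for y
    proof (cases "y \<in> cball 0 1")
      case True
      then show ?thesis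
        by (intro mult_left_mono z(2) bump_nonneg scaled_cball_subset[OF RK r(1,2)])
    qed (simp add: bump_eq_0)
  qed (simp add: integrable_bump)
  also have "\<dots> = ?W * w z" by simp
  finally have "\<delta> * r\<^sup>2 * ?J \<le> 0" by simp
  moreover have "\<delta> * r\<^sup>2 * ?J > 0" using d r s3 by simp
  ultimately show False by simp
qed

section \<open>Poisson extensions\<close>

text \<open>The tangent line at \<open>a\<close> supports the convex function \<open>x\<^sup>p\<close>; it is Young's inequality for \<open>x\<close> and
  \<open>a\<^bsup>p-1\<^esup>\<close>.\<close>

lemma powr_tangent_le:
  fixes p x a :: real
  assumes p: "p > 1" and x: "x \<ge> 0" and a: "a \<ge> 0"
  shows "a powr p + p * a powr (p - 1) * (x - a) \<le> x powr p"
proof -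
  have "x * a powr (p - 1) \<le> x powr p / p + (a powr (p - 1)) powr (p / (p - 1)) / (p / (p - 1))"
    using p x by (intro Youngs_inequality) (auto simp: field_simps)
  also have "(a powr (p - 1)) powr (p / (p - 1)) = a powr p"
    using p by (simp add: powr_powr)
  finally have "p * (x * a powr (p - 1)) \<le> p * (x powr p / p + a powr p / (p / (p - 1)))"
    using p by (intro mult_left_mono) auto
  also have "\<dots> = x powr p + (p - 1) * a powr p"
    using p by (simp add: field_simps)
  finally have "p * (x * a powr (p - 1)) \<le> x powr p + (p - 1) * a powr p" .
  moreover have "a powr (p - 1) * a = a powr p"
    using a p powr_add[of a "p - 1" 1] by (cases "a = 0") auto
  ultimately show ?thesis by (simp add: algebra_simps)
qed

lemma abs_le_one_plus_powr:
  fixes x p :: real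
  assumes p: "p > 1"
  shows "\<bar>x\<bar> \<le> 1 + \<bar>x\<bar> powr p"
proof (cases "\<bar>x\<bar> \<le> 1")
  case False
  then show ?thesis using powr_mono[of 1 p "\<bar>x\<bar>"] p by simp
next
  case True
  then show ?thesis using powr_ge_zero[of "\<bar>x\<bar>" p] by linarith
qed

text \<open>Jensen's inequality for the probability density \<open>k\<close>, from the tangent line at the mean of
  \<open>\<bar>g\<bar>\<close>. If the right side is finite, \<open>\<bar>g\<bar> \<le> 1 + \<bar>g\<bar>\<^sup>p\<close> makes \<open>k g\<close> integrable.\<close>

lemma nn_integral_powr_jensen:
  fixes k g :: "'a \<Rightarrow> real"
  assumes p: "p > 1" and [measurable]: "k \<in> borel_measurable M" "g \<in> borel_measurable M"
    and k: "\<And>y. k y \<ge> 0" "(\<integral>\<^sup>+y. ennreal (k y) \<partial>M) = 1"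
  shows "ennreal (\<bar>\<integral>y. k y * g y \<partial>M\<bar> powr p) \<le> (\<integral>\<^sup>+y. ennreal (k y * \<bar>g y\<bar> powr p) \<partial>M)"
proof (cases "(\<integral>\<^sup>+y. ennreal (k y * \<bar>g y\<bar> powr p) \<partial>M) = \<infinity>")
  case False
  have ik: "integrable M k" "integral\<^sup>L M k = 1"
    using has_bochner_integral_nn_integral[of k M 1] k by (auto simp: has_bochner_integral_iff)
  have i2: "integrable M (\<lambda>y. k y * \<bar>g y\<bar> powr p)"
    by (rule integrableI_nonneg) (use False k in \<open>auto simp: less_top\<close>)
  have i1: "integrable M (\<lambda>y. k y * \<bar>g y\<bar>)"
  proof (rule Bochner_Integration.integrable_bound[OF Bochner_Integration.integrable_add[OF ik(1) i2]])
    show "AE y in M. norm (k y * \<bar>g y\<bar>) \<le> norm (k y + k y * \<bar>g y\<bar> powr p)"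
    proof (rule AE_I2)
      fix y
      have "\<bar>g y\<bar> \<le> 1 + \<bar>g y\<bar> powr p" by (rule abs_le_one_plus_powr[OF p])
      then have "k y * \<bar>g y\<bar> \<le> k y * (1 + \<bar>g y\<bar> powr p)" by (intro mult_left_mono k)
      then show "norm (k y * \<bar>g y\<bar>) \<le> norm (k y + k y * \<bar>g y\<bar> powr p)"
        using k by (simp add: distrib_left)
    qed
  qed simp
  define A where "A = (\<integral>y. k y * \<bar>g y\<bar> \<partial>M)"
  have A: "A \<ge> 0" unfolding A_def using k by (intro integral_nonneg_AE) auto
  have "\<bar>\<integral>y. k y * g y \<partial>M\<bar> \<le> A"
    unfolding A_def using integral_norm_bound[of M "\<lambda>y. k y * g y"] k by (simp add: abs_mult)
  then have "\<bar>\<integral>y. k y * g y \<partial>M\<bar> powr p \<le> A powr p" using p by (intro powr_mono2) auto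
  also have "A powr p = (\<integral>y. (A powr p - p * A powr (p - 1) * A) * k y + (p * A powr (p - 1)) * (k y * \<bar>g y\<bar>) \<partial>M)"
    using ik i1 by (simp add: A_def[symmetric])
  also have "\<dots> \<le> (\<integral>y. k y * \<bar>g y\<bar> powr p \<partial>M)"
  proof (rule integral_mono)
    show "(A powr p - p * A powr (p - 1) * A) * k y + (p * A powr (p - 1)) * (k y * \<bar>g y\<bar>) \<le> k y * \<bar>g y\<bar> powr p" for y
    proof -
      have "k y * (A powr p + p * A powr (p - 1) * (\<bar>g y\<bar> - A)) \<le> k y * \<bar>g y\<bar> powr p"
        using p A by (intro mult_left_mono k powr_tangent_le) auto
      then show ?thesis by (simp add: algebra_simps)
    qed
  qed (use ik i1 i2 in auto)
  finally have "ennreal (\<bar>\<integral>y. k y * g y \<partial>M\<bar> powr p) \<le> ennreal (\<integral>y. k y * \<bar>g y\<bar> powr p \<partial>M)"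
    by (rule ennreal_leI)
  also have "\<dots> = (\<integral>\<^sup>+y. ennreal (k y * \<bar>g y\<bar> powr p) \<partial>M)"
    using i2 k by (intro nn_integral_eq_integral[symmetric]) auto
  finally show ?thesis .
qed simp

lemma poisson_extension_borel:
  assumes [measurable]: "g \<in> borel_measurable borel"
  shows "poisson_extension g (x, t) = (\<integral>y. poisson_kernel t (x - y :: real ^ 'n) * g y \<partial>lborel)"
  unfolding poisson_extension_def by (simp add: integral_completion)

lemma poisson_extension_jensen:
  assumes t: "t > 0" and p: "p > 1" and [measurable]: "g \<in> borel_measurable borel"
  shows "ennreal (\<bar>poisson_extension g (x, t)\<bar> powr p)
    \<le> (\<integral>\<^sup>+y. ennreal (poisson_kernel t (x - y :: real ^ 'n) * \<bar>g y\<bar> powr p) \<partial>lborel)"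
  unfolding poisson_extension_borel[OF assms(3)]
  by (rule nn_integral_powr_jensen[OF p])
     (use t in \<open>auto simp: poisson_kernel_nonneg nn_integral_poisson_kernel_diff\<close>)

lemma poisson_extension_scaled:
  assumes t: "t > 0" and [measurable]: "g \<in> borel_measurable borel"
  shows "poisson_extension g (x, t) = (\<integral>y. poisson_kernel 1 (y :: real ^ 'n) * g (x - t *\<^sub>R y) \<partial>lborel)"
proof -
  have "poisson_extension g (x, t) = \<bar>- t\<bar> ^ CARD('n) *
      (\<integral>y. poisson_kernel t (x - (x + (- t) *\<^sub>R y)) * g (x + (- t) *\<^sub>R y) \<partial>lborel)"
    unfolding poisson_extension_borel[OF assms(2)]
    using t lborel_integral_affine[of "\<lambda>y. poisson_kernel t (x - y) * g y" "- t" x] by simp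
  also have "\<dots> = (\<integral>y. (t ^ CARD('n) * poisson_kernel t (t *\<^sub>R y)) * g (x - t *\<^sub>R y) \<partial>lborel)"
    using t by (simp add: mult.assoc)
  finally show ?thesis by (simp add: poisson_kernel_scale[OF t])
qed

text \<open>In the scaled form of the Poisson extension the height enters only through the argument of \<open>g\<close>, so
  dominated convergence gives continuity up to the boundary \<open>t = 0\<close>, where the value is \<open>g\<close>.\<close>

lemma continuous_poisson_average:
  fixes g :: "real ^ 'n \<Rightarrow> real"
  assumes g: "continuous_on UNIV g" and bdd: "\<And>x. \<bar>g x\<bar> \<le> M"
  shows "continuous_on UNIV (\<lambda>z. \<integral>y. poisson_kernel 1 y * g (fst z - snd z *\<^sub>R y) \<partial>lborel)"
  unfolding continuous_on_eq_continuous_within continuous_within_sequentially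
proof (intro ballI allI impI)
  fix z and X :: "nat \<Rightarrow> (real ^ 'n) \<times> real"
  assume "(\<forall>n. X n \<in> UNIV) \<and> X \<longlonglongrightarrow> z"
  then have X: "X \<longlonglongrightarrow> z" by simp
  have M: "M \<ge> 0" using bdd[of 0] by simp
  have [measurable]: "g \<in> borel_measurable borel" using g by (rule borel_measurable_continuous_onI)
  have "(\<lambda>i. \<integral>y. poisson_kernel 1 y * g (fst (X i) - snd (X i) *\<^sub>R y) \<partial>lborel)
    \<longlonglongrightarrow> (\<integral>y. poisson_kernel 1 y * g (fst z - snd z *\<^sub>R y) \<partial>lborel)"
  proof (rule integral_dominated_convergence[where w="\<lambda>y. M * poisson_kernel 1 y"])
    show "integrable lborel (\<lambda>y :: real ^ 'n. M * poisson_kernel 1 y)"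
      using has_bochner_integral_poisson_kernel[of 1, where 'n='n] by (simp add: has_bochner_integral_iff)
    show "AE y in lborel. (\<lambda>i. poisson_kernel 1 y * g (fst (X i) - snd (X i) *\<^sub>R y))
        \<longlonglongrightarrow> poisson_kernel 1 y * g (fst z - snd z *\<^sub>R y)"
      using g by (intro AE_I2 tendsto_mult tendsto_const continuous_on_tendsto_compose[OF g] tendsto_intros X) auto
    show "AE y in lborel. norm (poisson_kernel 1 y * g (fst (X i) - snd (X i) *\<^sub>R y)) \<le> M * poisson_kernel 1 y" for i
      using bdd by (intro AE_I2) (simp add: abs_mult poisson_kernel_nonneg mult.commute[of M] mult_left_mono)
  qed simp_all
  then show "((\<lambda>z. \<integral>y. poisson_kernel 1 y * g (fst z - snd z *\<^sub>R y) \<partial>lborel) \<circ> X)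
    \<longlonglongrightarrow> (\<integral>y. poisson_kernel 1 y * g (fst z - snd z *\<^sub>R y) \<partial>lborel)"
    by (simp add: o_def)
qed

lemma abs_poisson_extension_le:
  assumes t: "t > 0" and [measurable]: "g \<in> borel_measurable borel" and bdd: "\<And>x. \<bar>g x\<bar> \<le> M"
  shows "\<bar>poisson_extension g (x :: real ^ 'n, t)\<bar> \<le> M"
    and "integrable lborel (\<lambda>y. poisson_kernel t (x - y) * g y)"
    and "(\<integral>y. \<bar>poisson_kernel t (x - y) * g y\<bar> \<partial>lborel) \<le> M"
proof -
  have k: "integrable lborel (\<lambda>y. poisson_kernel t (x - y))" "(\<integral>y. poisson_kernel t (x - y) \<partial>lborel) = 1"
    using has_bochner_integral_poisson_kernel_diff[OF t, of x] by (auto simp: has_bochner_integral_iff)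
  have le: "\<bar>poisson_kernel t (x - y) * g y\<bar> \<le> M * poisson_kernel t (x - y)" for y
    using bdd[of y] t by (simp add: abs_mult poisson_kernel_nonneg mult.commute mult_right_mono)
  show i: "integrable lborel (\<lambda>y. poisson_kernel t (x - y) * g y)"
    by (rule Bochner_Integration.integrable_bound[OF integrable_mult_right[OF k(1), of M]])
       (use le in \<open>auto intro!: AE_I2 intro: order_trans[OF _ abs_ge_self]\<close>)
  have "(\<integral>y. \<bar>poisson_kernel t (x - y) * g y\<bar> \<partial>lborel) \<le> (\<integral>y. M * poisson_kernel t (x - y) \<partial>lborel)"
    by (rule integral_mono) (use i k le in auto)
  then show le2: "(\<integral>y. \<bar>poisson_kernel t (x - y) * g y\<bar> \<partial>lborel) \<le> M" using k by simp
  have "\<bar>poisson_extension g (x, t)\<bar> \<le> (\<integral>y. \<bar>poisson_kernel t (x - y) * g y\<bar> \<partial>lborel)"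
    unfolding poisson_extension_borel[OF assms(2)]
    using integral_norm_bound[of lborel "\<lambda>y. poisson_kernel t (x - y) * g y"] by simp
  with le2 show "\<bar>poisson_extension g (x, t)\<bar> \<le> M" by simp
qed

text \<open>By Fubini's theorem the average of the extension is the extension of the averages, and the
  kernel has the mean value property for each fixed \<open>y\<close>.\<close>

lemma mean_value_on_poisson_extension:
  fixes g :: "real ^ 'n \<Rightarrow> real"
  assumes g: "continuous_on UNIV g" and bdd: "\<And>x. \<bar>g x\<bar> \<le> M"
  shows "mean_value_on upper_half_space (poisson_extension g)"
  unfolding mean_value_on_def
proof (intro conjI allI impI)
  have [measurable]: "g \<in> borel_measurable borel" using g by (rule borel_measurable_continuous_onI)
  have M: "M \<ge> 0" using bdd[of 0] by simp
  show "continuous_on upper_half_space (poisson_extension g)"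
    by (rule continuous_on_eq[OF continuous_on_subset[OF continuous_poisson_average[OF g bdd]]])
       (auto simp: upper_half_space_def poisson_extension_scaled)
  fix z :: "(real ^ 'n) \<times> real" and R r :: real
  assume *: "ball z R \<subseteq> upper_half_space" "0 \<le> r" "r < R"
  define K where "K y \<eta> = poisson_kernel (snd (z + r *\<^sub>R y)) (fst (z + r *\<^sub>R y) - \<eta>)"
    for y :: "(real ^ 'n) \<times> real" and \<eta> :: "real ^ 'n"
  have [measurable]: "(\<lambda>p. K (fst p) (snd p)) \<in> borel_measurable (borel \<Otimes>\<^sub>M borel)"
    unfolding K_def borel_prod
    by (intro poisson_kernel_measurable borel_measurable_continuous_onI continuous_intros)
  let ?f = "\<lambda>y \<eta>. bump y * (K y \<eta> * g \<eta>)"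
  have ext: "poisson_extension g (z + r *\<^sub>R y) = (\<integral>\<eta>. K y \<eta> * g \<eta> \<partial>lborel)" for y
  proof -
    have "poisson_extension g (z + r *\<^sub>R y) = poisson_extension g (fst (z + r *\<^sub>R y), snd (z + r *\<^sub>R y))"
      by (simp only: prod.collapse)
    also have "\<dots> = (\<integral>\<eta>. K y \<eta> * g \<eta> \<partial>lborel)"
      unfolding K_def by (rule poisson_extension_borel) simp
    finally show ?thesis .
  qed
  have pos: "snd (z + r *\<^sub>R y) > 0" if "y \<in> cball 0 1" for y
    using scaled_cball_subset[OF * that] by (simp add: upper_half_space_def case_prod_unfold)
  have int2: "integrable lborel (?f y)" for y
  proof (cases "y \<in> cball 0 1")
    case True
    show ?thesis
      unfolding K_def by (intro integrable_mult_right abs_poisson_extension_le(2)[where M=M] pos[OF True] bdd) simp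
  qed (simp add: bump_eq_0)
  have int: "integrable (lborel \<Otimes>\<^sub>M lborel) (case_prod ?f)"
  proof (rule lborel_pair.Fubini_integrable)
    show "case_prod ?f \<in> borel_measurable (lborel \<Otimes>\<^sub>M lborel)" by measurable
    show "AE y in lborel. integrable lborel (\<lambda>\<eta>. case_prod ?f (y, \<eta>))" using int2 by simp
    show "integrable lborel (\<lambda>y. \<integral>\<eta>. norm (case_prod ?f (y, \<eta>)) \<partial>lborel)"
    proof (rule Bochner_Integration.integrable_bound[OF integrable_mult_right[OF integrable_bump, of M]])
      show "(\<lambda>y. \<integral>\<eta>. norm (case_prod ?f (y, \<eta>)) \<partial>lborel) \<in> borel_measurable lborel" by measurable
      show "AE y in lborel. norm (\<integral>\<eta>. norm (case_prod ?f (y, \<eta>)) \<partial>lborel) \<le> norm (M * bump y)"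
      proof (rule AE_I2)
        fix y
        show "norm (\<integral>\<eta>. norm (case_prod ?f (y, \<eta>)) \<partial>lborel) \<le> norm (M * bump y)"
        proof (cases "y \<in> cball 0 1")
          case True
          have "(\<integral>\<eta>. norm (case_prod ?f (y, \<eta>)) \<partial>lborel) = bump y * (\<integral>\<eta>. \<bar>K y \<eta> * g \<eta>\<bar> \<partial>lborel)"
            by (simp add: abs_mult bump_nonneg)
          also have "\<dots> \<le> bump y * M"
            unfolding K_def by (intro mult_left_mono abs_poisson_extension_le(3) pos[OF True] bdd bump_nonneg) simp
          finally show ?thesis using M bump_nonneg[of y] by (simp add: mult.commute)
        qed (simp add: bump_eq_0)
      qed
    qed
  qed
  have "(\<integral>y. bump y * poisson_extension g (z + r *\<^sub>R y) \<partial>lborel) = (\<integral>y. (\<integral>\<eta>. ?f y \<eta> \<partial>lborel) \<partial>lborel)"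
    unfolding ext by simp
  also have "\<dots> = (\<integral>\<eta>. (\<integral>y. ?f y \<eta> \<partial>lborel) \<partial>lborel)"
    by (rule lborel_pair.Fubini_integral[OF int, symmetric])
  also have "\<dots> = (\<integral>\<eta>. integral\<^sup>L lborel (bump :: (real ^ 'n) \<times> real \<Rightarrow> real) * (K 0 \<eta> * g \<eta>) \<partial>lborel)"
  proof (rule Bochner_Integration.integral_cong[OF refl])
    fix \<eta>
    have "(\<integral>y. ?f y \<eta> \<partial>lborel) = (\<integral>y. bump y * K y \<eta> * g \<eta> \<partial>lborel)" by (simp add: mult.assoc)
    also have "\<dots> = (\<integral>y. bump y * K y \<eta> \<partial>lborel) * g \<eta>" by simp
    also have "(\<integral>y. bump y * K y \<eta> \<partial>lborel) = integral\<^sup>L lborel (bump :: (real ^ 'n) \<times> real \<Rightarrow> real) * K 0 \<eta>"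
      using mean_value_onD[OF mean_value_on_poisson_kernel *, of \<eta>] by (simp add: K_def)
    finally show "(\<integral>y. ?f y \<eta> \<partial>lborel) = integral\<^sup>L lborel (bump :: (real ^ 'n) \<times> real \<Rightarrow> real) * (K 0 \<eta> * g \<eta>)"
      by simp
  qed
  also have "\<dots> = integral\<^sup>L lborel (bump :: (real ^ 'n) \<times> real \<Rightarrow> real) * poisson_extension g z"
    using ext[of 0] by simp
  finally show "(\<integral>y. bump y * poisson_extension g (z + r *\<^sub>R y) \<partial>lborel)
     = integral\<^sup>L lborel (bump :: (real ^ 'n) \<times> real \<Rightarrow> real) * poisson_extension g z" .
qed (rule open_upper_half_space)

text \<open>Both sides are bounded, have the mean value property, are continuous up to the boundary and agree
  there. The maximum principle, applied to the difference and to its negative, shows that they are equal.\<close>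

lemma poisson_semigroup_representation:
  fixes u :: "(real ^ 'n) \<times> real \<Rightarrow> real"
  assumes mv: "mean_value_on upper_half_space u" and bdd: "\<And>x t. t \<ge> \<epsilon> \<Longrightarrow> \<bar>u (x, t)\<bar> \<le> M"
    and e: "\<epsilon> > 0" and t: "t > 0"
  shows "u (x, t + \<epsilon>) = poisson_extension (\<lambda>y. u (y, \<epsilon>)) (x, t)"
proof -
  define g where "g y = u (y, \<epsilon>)" for y
  have cu: "continuous_on upper_half_space u" by (rule mean_value_on_continuous[OF mv])
  have cg: "continuous_on UNIV g"
    unfolding g_def by (rule continuous_on_compose2[OF cu])
      (use e in \<open>auto intro!: continuous_intros simp: upper_half_space_def\<close>)
  then have [measurable]: "g \<in> borel_measurable borel" by (rule borel_measurable_continuous_onI)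
  have bg: "\<bar>g x\<bar> \<le> M" for x using bdd[of \<epsilon> x] by (simp add: g_def)
  \<comment> \<open>\<open>W\<close> agrees with the Poisson extension for \<open>t > 0\<close> but has the boundary values \<open>g\<close>.\<close>
  define W where "W z = (\<integral>y. poisson_kernel 1 y * g (fst z - snd z *\<^sub>R y) \<partial>lborel)" for z
  have cW: "continuous_on UNIV W" unfolding W_def by (rule continuous_poisson_average[OF cg bg])
  have W: "W z = poisson_extension g z" if "z \<in> upper_half_space" for z
    using that by (cases z) (simp add: W_def upper_half_space_def poisson_extension_scaled)
  have W0: "W (x, 0) = g x" for x
    using has_bochner_integral_poisson_kernel[of 1, where 'n='n] by (simp add: W_def has_bochner_integral_iff)
  have bW: "\<bar>W z\<bar> \<le> M" if "snd z \<ge> 0" for z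
  proof (cases "snd z = 0")
    case True
    then show ?thesis using W0[of "fst z"] bg by (cases z) simp
  next
    case False
    then have "snd z > 0" using that by simp
    then show ?thesis
      using W[of z] abs_poisson_extension_le(1)[of "snd z" g M "fst z"] bg
      by (cases z) (simp add: upper_half_space_def)
  qed
  have mW: "mean_value_on upper_half_space W"
    by (rule mean_value_on_cong[OF mean_value_on_poisson_extension[OF cg bg] W])
  define U where "U z = u (z + (0, \<epsilon>))" for z
  have mU: "mean_value_on upper_half_space U"
    unfolding U_def by (rule mean_value_on_translate[OF mv])
      (use e in \<open>auto simp: open_upper_half_space, auto simp: upper_half_space_def\<close>)
  have cU: "continuous_on {z. snd z \<ge> 0} U"
    unfolding U_def by (rule continuous_on_compose2[OF cu])
      (use e in \<open>auto intro!: continuous_intros simp: upper_half_space_def\<close>)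
  have bU: "\<bar>U z\<bar> \<le> M" if "snd z \<ge> 0" for z
    using bdd[of "snd z + \<epsilon>" "fst z"] that by (cases z) (simp add: U_def)
  have cW': "continuous_on {z. snd z \<ge> 0} W" using cW by (rule continuous_on_subset) simp
  have U0: "U (x, 0) = g x" for x by (simp add: U_def g_def)
  have "U (x, t) - W (x, t) \<le> 0"
    by (rule half_space_maximum_principle[OF mean_value_on_diff[OF mU mW] _ _ _ t, where M="2 * M"])
       (use bU bW U0 W0 in \<open>auto intro!: continuous_intros cU cW' simp: abs_le_iff, smt\<close>)
  moreover have "W (x, t) - U (x, t) \<le> 0"
    by (rule half_space_maximum_principle[OF mean_value_on_diff[OF mW mU] _ _ _ t, where M="2 * M"])
       (use bU bW U0 W0 in \<open>auto intro!: continuous_intros cU cW' simp: abs_le_iff, smt\<close>)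
  ultimately have "U (x, t) = W (x, t)" by simp
  then show ?thesis using t W[of "(x, t)"] by (simp add: U_def g_def[abs_def] upper_half_space_def)
qed

section \<open>The half-space measure and the weak-type estimate\<close>

lemma borel_measurable_fst_snd [measurable]:
  "(fst :: 'a::euclidean_space \<times> 'b::euclidean_space \<Rightarrow> 'a) \<in> borel_measurable borel"
  "(snd :: 'a::euclidean_space \<times> 'b::euclidean_space \<Rightarrow> 'b) \<in> borel_measurable borel"
  by (intro borel_measurable_continuous_onI continuous_intros)+

lemma borel_measurable_poisson_extension:
  fixes f :: "real ^ 'n \<Rightarrow> real"
  assumes [measurable]: "f \<in> borel_measurable borel"
  shows "poisson_extension f \<in> borel_measurable borel"
proof -
  have "poisson_extension f z = (\<integral>y. poisson_kernel (snd z) (fst z - y) * f y \<partial>lborel)" for z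
    using poisson_extension_borel[of f "fst z" "snd z"] by simp
  moreover have "(\<lambda>z. \<integral>y. poisson_kernel (snd z) (fst z - y) * f y \<partial>lborel) \<in> borel_measurable borel"
    by measurable
  ultimately show ?thesis by presburger
qed

lemma upper_half_space_sets [measurable]: "upper_half_space \<in> sets (borel :: ((real ^ 'n) \<times> real) measure)"
  by (rule borel_open[OF open_upper_half_space])

lemma sets_half_space_measure:
  "sets (half_space_measure s :: ((real ^ 'n) \<times> real) measure) = sets (lebesgue_on upper_half_space)"
  by (simp add: half_space_measure_def)

lemma space_half_space_measure: "space (half_space_measure s) = upper_half_space"
  by (simp add: half_space_measure_def)

lemma borel_measurable_half_space:
  fixes g :: "(real ^ 'n) \<times> real \<Rightarrow> real"
  assumes "g \<in> borel_measurable borel"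
  shows "g \<in> borel_measurable (half_space_measure s)"
proof -
  have "g \<in> borel_measurable lebesgue" using assms by (simp add: measurable_completion)
  then have "g \<in> borel_measurable (lebesgue_on upper_half_space)" by (rule measurable_restrict_space1)
  then show ?thesis using measurable_cong_sets[OF sets_half_space_measure refl] by blast
qed

text \<open>For Borel functions the completion and the restriction in the definition of the half-space measure
  disappear, so that Tonelli's theorem for Borel measures applies.\<close>

lemma nn_integral_half_space_measure:
  fixes F :: "(real ^ 'n) \<times> real \<Rightarrow> ennreal"
  assumes F: "F \<in> borel_measurable borel"
  shows "(\<integral>\<^sup>+z. F z \<partial>half_space_measure s)
    = (\<integral>\<^sup>+z. ennreal (snd z powr (-(s + 1))) * F z * indicator upper_half_space z \<partial>lborel)"
proof -
  have H: "upper_half_space \<inter> space lebesgue \<in> sets (lebesgue :: ((real ^ 'n) \<times> real) measure)"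
    by simp
  have Fm: "F \<in> borel_measurable (lebesgue_on upper_half_space)"
    by (intro measurable_restrict_space1 measurable_completion) (use F in simp)
  have "(\<lambda>z. ennreal (snd z powr (-(s + 1)))) \<in> borel_measurable (lebesgue :: ((real ^ 'n) \<times> real) measure)"
    by (rule measurable_completion) simp
  then have "(\<lambda>(x, t). ennreal (t powr (-(s + 1)))) \<in> borel_measurable (lebesgue_on (upper_half_space :: ((real ^ 'n) \<times> real) set))"
    by (simp add: case_prod_unfold measurable_restrict_space1)
  then have "(\<integral>\<^sup>+z. F z \<partial>half_space_measure s)
    = (\<integral>\<^sup>+z. ennreal (snd z powr (-(s + 1))) * F z \<partial>lebesgue_on upper_half_space)"
    unfolding half_space_measure_def using Fm by (subst nn_integral_density) (auto simp: case_prod_unfold)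
  also have "\<dots> = (\<integral>\<^sup>+z. ennreal (snd z powr (-(s + 1))) * F z * indicator upper_half_space z \<partial>lborel)"
    by (subst nn_integral_restrict_space[OF H]) (simp add: nn_integral_completion)
  finally show ?thesis .
qed

lemma emeasure_half_space_measure:
  fixes A :: "((real ^ 'n) \<times> real) set"
  assumes A: "A \<in> sets borel" "A \<subseteq> upper_half_space"
  shows "emeasure (half_space_measure s) A
    = (\<integral>\<^sup>+z. ennreal (snd z powr (-(s + 1))) * indicator A z \<partial>lborel)"
proof -
  have "A \<in> sets (half_space_measure s)"
    unfolding sets_half_space_measure using A by (auto simp: sets_restrict_space intro!: image_eqI[of _ _ A])
  then have "emeasure (half_space_measure s) A = (\<integral>\<^sup>+z. indicator A z \<partial>half_space_measure s)"
    by simp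
  also have "\<dots> = (\<integral>\<^sup>+z. ennreal (snd z powr (-(s + 1))) * indicator A z * indicator upper_half_space z \<partial>lborel)"
    by (rule nn_integral_half_space_measure) (use A(1) in simp)
  also have "\<dots> = (\<integral>\<^sup>+z. ennreal (snd z powr (-(s + 1))) * indicator A z \<partial>lborel)"
    using A(2) by (intro nn_integral_cong) (auto simp: indicator_def)
  finally show ?thesis .
qed

lemma nn_integral_powr_tail:
  fixes \<tau> \<beta> :: real
  assumes "\<beta> > 0" "\<tau> > 0"
  shows "(\<integral>\<^sup>+t. ennreal (t powr (- \<beta> - 1)) * indicator {\<tau><..} t \<partial>lborel) \<le> ennreal (\<tau> powr (- \<beta>) / \<beta>)"
proof -
  have "(\<integral>\<^sup>+t. ennreal (t powr (- \<beta> - 1)) * indicator {\<tau><..} t \<partial>lborel)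
      \<le> (\<integral>\<^sup>+t. ennreal (t powr (- \<beta> - 1)) * indicator {\<tau>..} t \<partial>lborel)"
    by (intro nn_integral_mono) (auto simp: indicator_def)
  also have "\<dots> = ennreal (0 - (- (\<tau> powr (- \<beta>) / \<beta>)))"
  proof (rule nn_integral_FTC_atLeast)
    show "((\<lambda>t. - (t powr (- \<beta>) / \<beta>)) has_real_derivative t powr (- \<beta> - 1)) (at t)" if "\<tau> \<le> t" for t
      using that assms by (auto intro!: derivative_eq_intros)
    have "((\<lambda>t. - (t powr (- \<beta>) / \<beta>)) \<longlongrightarrow> - (0 / \<beta>)) at_top"
      using assms by (intro tendsto_intros tendsto_neg_powr filterlim_ident) auto
    then show "((\<lambda>t. - (t powr (- \<beta>) / \<beta>)) \<longlongrightarrow> 0) at_top" by simp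
  qed auto
  finally show ?thesis by simp
qed

text \<open>The truncation argument. With \<open>h t = l t\<^bsup>-s/p\<^esup>\<close>, a point \<open>(x, t)\<close> of the superlevel set satisfies
  \<open>\<bar>Pf\<bar> > h t\<close>, and at most \<open>h t / 2\<close> of this comes from the values of \<open>\<bar>f\<bar>\<close> below \<open>h t / 2\<close>. The
  function \<open>\<Psi>\<close> collects the remaining values together with the weight of the measure and the factor
  \<open>2 / h t\<close> from Markov's inequality.\<close>

lemma poisson_extension_weak_bound:
  fixes f :: "real ^ 'n \<Rightarrow> real"
  assumes p: "p > 1" and s: "s > 0" and [measurable]: "f \<in> borel_measurable borel" and l: "l > 0"
  shows "emeasure (half_space_measure s) {z \<in> upper_half_space. l < \<bar>snd z powr (s / p) * poisson_extension f z\<bar>}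
    \<le> ennreal (2 powr p / (s - s / p) / l powr p) * (\<integral>\<^sup>+y. ennreal (\<bar>f y\<bar> powr p) \<partial>lborel)"
proof -
  let ?A = "{z \<in> upper_half_space. l < \<bar>snd z powr (s / p) * poisson_extension f z\<bar>}"
  have pe: "poisson_extension f z = (\<integral>y. poisson_kernel (snd z) (fst z - y) * f y \<partial>lborel)" for z
    using poisson_extension_borel[of f "fst z" "snd z"] by simp
  have [measurable]: "poisson_extension f \<in> borel_measurable borel"
    by (rule borel_measurable_poisson_extension) simp
  have Am: "?A \<in> sets borel" by measurable
  define \<beta> where "\<beta> = s - s / p"
  have b: "\<beta> > 0" using p s by (simp add: \<beta>_def field_simps)
  define h where "h t = l * t powr (- (s / p))" for t :: real
  define \<Psi> where "\<Psi> t y = (if 0 < t \<and> h t / 2 < \<bar>f y\<bar> then ennreal (t powr (-(s + 1)) * (2 / h t) * \<bar>f y\<bar>) else 0)" for t :: real and y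
  have [measurable]: "h \<in> borel_measurable borel" by (simp add: h_def[abs_def])
  have key: "ennreal (snd z powr (-(s + 1))) * indicator ?A z
      \<le> (\<integral>\<^sup>+y. \<Psi> (snd z) y * ennreal (poisson_kernel (snd z) (fst z - y)) \<partial>lborel)" for z
  proof (cases "z \<in> ?A")
    case True
    obtain x t where z: "z = (x, t)" by (cases z)
    have t: "t > 0" using True by (simp add: z upper_half_space_def)
    have ht: "h t > 0" using l t by (simp add: h_def)
    have "h t < \<bar>poisson_extension f z\<bar>"
      using True t by (simp add: z h_def abs_mult powr_minus field_simps)
    then have "ennreal (h t) < ennreal \<bar>poisson_extension f z\<bar>"
      using ht by (simp add: ennreal_less_iff)
    also have "\<dots> \<le> (\<integral>\<^sup>+y. ennreal \<bar>poisson_kernel t (x - y) * f y\<bar> \<partial>lborel)"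
    proof (cases "integrable lborel (\<lambda>y. poisson_kernel t (x - y) * f y)")
      case True
      then show ?thesis using integral_norm_bound_ennreal[OF True] by (simp add: pe z)
    qed (simp add: pe z not_integrable_integral_eq)
    also have "\<dots> \<le> (\<integral>\<^sup>+y. ennreal (h t / 2) * ennreal (poisson_kernel t (x - y)) +
        ennreal (\<bar>f y\<bar> * poisson_kernel t (x - y)) * indicator {y. h t / 2 < \<bar>f y\<bar>} y \<partial>lborel)"
    proof (intro nn_integral_mono)
      fix y
      have k: "poisson_kernel t (x - y) \<ge> 0" using t by (simp add: poisson_kernel_nonneg)
      show "ennreal \<bar>poisson_kernel t (x - y) * f y\<bar> \<le> ennreal (h t / 2) * ennreal (poisson_kernel t (x - y)) +
        ennreal (\<bar>f y\<bar> * poisson_kernel t (x - y)) * indicator {y. h t / 2 < \<bar>f y\<bar>} y"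
      proof (cases "h t / 2 < \<bar>f y\<bar>")
        case True
        then show ?thesis using k by (simp add: abs_mult mult.commute)
      next
        case False
        then have "\<bar>f y\<bar> * poisson_kernel t (x - y) \<le> h t / 2 * poisson_kernel t (x - y)"
          using k by (intro mult_right_mono) auto
        then have "\<bar>poisson_kernel t (x - y) * f y\<bar> \<le> h t / 2 * poisson_kernel t (x - y)"
          using k by (simp add: abs_mult mult.commute)
        then show ?thesis using False k ht by (simp add: ennreal_leI flip: ennreal_mult)
      qed
    qed
    also have "\<dots> = ennreal (h t / 2) + (\<integral>\<^sup>+y. ennreal (\<bar>f y\<bar> * poisson_kernel t (x - y)) * indicator {y. h t / 2 < \<bar>f y\<bar>} y \<partial>lborel)"
      (is "_ = _ + ?B")
      by (subst nn_integral_add) (auto simp: nn_integral_cmult nn_integral_poisson_kernel_diff[OF t])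
    finally have "ennreal (h t) < ennreal (h t / 2) + ?B" .
    then have "ennreal (h t / 2) \<le> ?B"
    proof (rule contrapos_pp)
      assume "\<not> ennreal (h t / 2) \<le> ?B"
      then have "?B \<le> ennreal (h t / 2)" by simp
      then have "ennreal (h t / 2) + ?B \<le> ennreal (h t / 2) + ennreal (h t / 2)" by (rule add_left_mono)
      also have "\<dots> = ennreal (h t)" using ht by (simp flip: ennreal_plus)
      finally show "\<not> ennreal (h t) < ennreal (h t / 2) + ?B" by simp
    qed
    then have "ennreal (2 / h t) * ennreal (h t / 2) \<le> ennreal (2 / h t) * ?B" by (rule mult_left_mono) simp
    also have "ennreal (2 / h t) * ennreal (h t / 2) = 1" using ht by (simp flip: ennreal_mult)
    finally have "ennreal (t powr (-(s + 1))) * 1 \<le> ennreal (t powr (-(s + 1))) * (ennreal (2 / h t) * ?B)"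
      by (rule mult_left_mono) simp
    also have "\<dots> = ennreal (t powr (-(s + 1)) * (2 / h t)) * ?B"
    proof -
      have "ennreal (t powr (-(s + 1)) * (2 / h t)) = ennreal (t powr (-(s + 1))) * ennreal (2 / h t)"
        using ht by (intro ennreal_mult) auto
      then show ?thesis by (simp only: mult.assoc)
    qed
    also have "\<dots> = (\<integral>\<^sup>+y. ennreal (t powr (-(s + 1)) * (2 / h t)) * (ennreal (\<bar>f y\<bar> * poisson_kernel t (x - y)) * indicator {y. h t / 2 < \<bar>f y\<bar>} y) \<partial>lborel)"
      by (rule nn_integral_cmult[symmetric]) simp
    also have "\<dots> = (\<integral>\<^sup>+y. \<Psi> t y * ennreal (poisson_kernel t (x - y)) \<partial>lborel)"
      unfolding \<Psi>_def using t ht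
    proof (intro nn_integral_cong)
      fix y
      have "ennreal (t powr (-(s + 1)) * (2 / h t)) * ennreal (\<bar>f y\<bar> * poisson_kernel t (x - y))
          = ennreal (t powr (-(s + 1)) * (2 / h t) * \<bar>f y\<bar>) * ennreal (poisson_kernel t (x - y))"
        using t ht by (simp only: ennreal_mult[symmetric] mult_nonneg_nonneg powr_ge_zero abs_ge_zero
          divide_nonneg_nonneg poisson_kernel_nonneg less_imp_le zero_le_numeral mult.assoc)
      then show "ennreal (t powr (-(s + 1)) * (2 / h t)) * (ennreal (\<bar>f y\<bar> * poisson_kernel t (x - y)) * indicator {y. h t / 2 < \<bar>f y\<bar>} y)
        = (if 0 < t \<and> h t / 2 < \<bar>f y\<bar> then ennreal (t powr (-(s + 1)) * (2 / h t) * \<bar>f y\<bar>) else 0) * ennreal (poisson_kernel t (x - y))"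
        using t by (simp add: indicator_def)
    qed
    finally show ?thesis using True by (simp add: z)
  qed simp
  have "emeasure (half_space_measure s) ?A
      \<le> (\<integral>\<^sup>+z. (\<integral>\<^sup>+y. \<Psi> (snd z) y * ennreal (poisson_kernel (snd z) (fst z - y)) \<partial>lborel) \<partial>lborel)"
    unfolding emeasure_half_space_measure[OF Am Collect_restrict] by (intro nn_integral_mono key)
  also have "\<dots> = (\<integral>\<^sup>+t. (\<integral>\<^sup>+x. (\<integral>\<^sup>+y. \<Psi> t y * ennreal (poisson_kernel t (x - y)) \<partial>lborel) \<partial>lborel) \<partial>lborel)"
    unfolding lborel_prod[symmetric]
    by (subst lborel_pair.nn_integral_snd[symmetric]) (auto simp: \<Psi>_def)
  also have "\<dots> = (\<integral>\<^sup>+t. (\<integral>\<^sup>+y. (\<integral>\<^sup>+x. \<Psi> t y * ennreal (poisson_kernel t (x - y)) \<partial>lborel) \<partial>lborel) \<partial>lborel)"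
    by (intro nn_integral_cong lborel_pair.Fubini') (auto simp: \<Psi>_def)
  also have "\<dots> = (\<integral>\<^sup>+t. (\<integral>\<^sup>+y. \<Psi> t y \<partial>lborel) \<partial>lborel)"
  proof (intro nn_integral_cong)
    fix t y
    have "(\<integral>\<^sup>+x. \<Psi> t y * ennreal (poisson_kernel t (x - y)) \<partial>lborel) = \<Psi> t y * (\<integral>\<^sup>+x. ennreal (poisson_kernel t (x - y)) \<partial>lborel)"
      by (rule nn_integral_cmult) simp
    also have "\<dots> = \<Psi> t y"
      by (cases "t > 0") (auto simp: \<Psi>_def nn_integral_poisson_kernel_diff)
    finally show "(\<integral>\<^sup>+x. \<Psi> t y * ennreal (poisson_kernel t (x - y)) \<partial>lborel) = \<Psi> t y" .
  qed
  also have "\<dots> = (\<integral>\<^sup>+y. (\<integral>\<^sup>+t. \<Psi> t y \<partial>lborel) \<partial>lborel)"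
    by (rule lborel_pair.Fubini') (simp add: \<Psi>_def)
  also have "\<dots> \<le> (\<integral>\<^sup>+y. ennreal (2 powr p / \<beta> / l powr p) * ennreal (\<bar>f y\<bar> powr p) \<partial>lborel)"
  proof (rule nn_integral_mono)
    fix y
    define a where "a = \<bar>f y\<bar>"
    show "(\<integral>\<^sup>+t. \<Psi> t y \<partial>lborel) \<le> ennreal (2 powr p / \<beta> / l powr p) * ennreal (\<bar>f y\<bar> powr p)"
    proof (cases "a = 0")
      case True
      have "\<Psi> t y = 0" for t
        using True l by (auto simp: \<Psi>_def a_def)
      then show ?thesis by simp
    next
      case False
      then have a: "a > 0" by (simp add: a_def)
      \<comment> \<open>The height above which \<open>a > h t / 2\<close>.\<close>
      define \<tau> where "\<tau> = (l / (2 * a)) powr (p / s)"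
      have \<tau>: "\<tau> > 0" using a l by (simp add: \<tau>_def)
      have "\<Psi> t y \<le> ennreal (2 * a / l) * (ennreal (t powr (- \<beta> - 1)) * indicator {\<tau><..} t)" for t
      proof (cases "0 < t \<and> h t / 2 < a")
        case True
        then have t: "t > 0" and ha: "h t / 2 < a" by auto
        have "l / (2 * a) < t powr (s / p)"
          using ha a t by (simp add: h_def powr_minus field_simps)
        then have "(l / (2 * a)) powr (p / s) < (t powr (s / p)) powr (p / s)"
          using a l p s by (intro powr_less_mono2) auto
        then have "\<tau> < t" using t p s by (simp add: powr_powr \<tau>_def)
        moreover have "t powr (-(s + 1)) * (2 / h t) * a = 2 * a / l * t powr (- \<beta> - 1)"
        proof -
          have "t powr (-(s + 1)) * t powr (s / p) = t powr (- \<beta> - 1)"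
            by (simp add: \<beta>_def algebra_simps flip: powr_add)
          moreover have "2 / h t = 2 / l * t powr (s / p)"
            using t by (simp add: h_def powr_minus field_simps)
          then have "t powr (-(s + 1)) * (2 / h t) * a = 2 * a / l * (t powr (-(s + 1)) * t powr (s / p))"
            by (simp add: ac_simps)
          ultimately show ?thesis by simp
        qed
        ultimately show ?thesis
          using True a l by (simp add: \<Psi>_def a_def[symmetric] flip: ennreal_mult)
      next
        case False
        then show ?thesis by (auto simp: \<Psi>_def a_def)
      qed
      then have "(\<integral>\<^sup>+t. \<Psi> t y \<partial>lborel) \<le> (\<integral>\<^sup>+t. ennreal (2 * a / l) * (ennreal (t powr (- \<beta> - 1)) * indicator {\<tau><..} t) \<partial>lborel)"
        by (rule nn_integral_mono)
      also have "\<dots> = ennreal (2 * a / l) * (\<integral>\<^sup>+t. (ennreal (t powr (- \<beta> - 1)) * indicator {\<tau><..} t) \<partial>lborel)"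
        by (rule nn_integral_cmult) simp
      also have "\<dots> \<le> ennreal (2 * a / l) * ennreal (\<tau> powr (- \<beta>) / \<beta>)"
        by (intro mult_left_mono nn_integral_powr_tail b \<tau>) simp
      also have "\<dots> = ennreal (2 powr p / \<beta> / l powr p * a powr p)"
      proof -
        have "p / s * - \<beta> = 1 - p" using p s by (simp add: \<beta>_def field_simps)
        then have "\<tau> powr (- \<beta>) = (l / (2 * a)) powr (1 - p)"
          by (simp add: \<tau>_def powr_powr)
        also have "\<dots> = (2 * a / l) powr (p - 1)"
          using a l by (simp add: powr_divide powr_diff field_simps)
        finally have "2 * a / l * \<tau> powr (- \<beta>) = (2 * a / l) powr p"
          using a l powr_add[of "2 * a / l" 1 "p - 1"] by simp
        also have "\<dots> = 2 powr p * a powr p / l powr p"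
          using a l by (simp add: powr_divide powr_mult)
        finally have "2 * a / l * (\<tau> powr (- \<beta>) / \<beta>) = 2 powr p / \<beta> / l powr p * a powr p"
          by simp
        moreover have "ennreal (2 * a / l) * ennreal (\<tau> powr (- \<beta>) / \<beta>) = ennreal (2 * a / l * (\<tau> powr (- \<beta>) / \<beta>))"
          using a l b by (intro ennreal_mult[symmetric]) auto
        ultimately show ?thesis by (simp only:)
      qed
      also have "\<dots> = ennreal (2 powr p / \<beta> / l powr p) * ennreal (\<bar>f y\<bar> powr p)"
        unfolding a_def using b by (intro ennreal_mult) auto
      finally show ?thesis .
    qed
  qed
  also have "\<dots> = ennreal (2 powr p / \<beta> / l powr p) * (\<integral>\<^sup>+y. ennreal (\<bar>f y\<bar> powr p) \<partial>lborel)"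
    by (rule nn_integral_cmult) simp
  finally show ?thesis by (simp add: \<beta>_def)
qed

text \<open>Replacing \<open>f\<close> by a Borel function that agrees with it almost everywhere changes neither its
  extension nor its norm.\<close>

lemma poisson_extension_in_weak_Lp:
  fixes f :: "real ^ 'n \<Rightarrow> real"
  assumes p: "p > 1" and s: "s > 0" and f: "f \<in> Lp p lebesgue"
  shows "(\<lambda>(x, t). t powr (s / p) * poisson_extension f (x, t)) \<in> weak_Lp p (half_space_measure s)"
proof -
  have fm: "f \<in> borel_measurable lebesgue" and fi: "integrable lebesgue (\<lambda>x. \<bar>f x\<bar> powr p)"
    using f by (auto simp: Lp_def)
  obtain g where g [measurable]: "g \<in> borel_measurable lborel" and fg: "AE x in lborel. f x = g x"
    using completion_ex_borel_measurable_real[OF fm] by auto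
  have [measurable]: "g \<in> borel_measurable borel" using g by simp
  have gm: "g \<in> borel_measurable lebesgue" by (rule measurable_completion) simp
  have fg': "AE x in lebesgue. f x = g x" using fg by (rule AE_completion)
  have "integrable lebesgue (\<lambda>x. \<bar>g x\<bar> powr p)"
    using fi by (rule integrable_cong_AE_imp) (use gm fg' in auto)
  then have gi: "integrable lborel (\<lambda>x. \<bar>g x\<bar> powr p)"
    by (subst (asm) integrable_completion) auto
  have ext: "poisson_extension f = poisson_extension g"
  proof
    fix z :: "(real ^ 'n) \<times> real"
    obtain x t where z: "z = (x, t)" by (cases z)
    have k: "(\<lambda>y. poisson_kernel t (x - y)) \<in> borel_measurable lebesgue"
      by (rule measurable_completion) simp
    show "poisson_extension f z = poisson_extension g z"
      unfolding z poisson_extension_def prod.case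
      by (rule integral_cong_AE) (use k fm gm fg' in auto)
  qed
  have [measurable]: "poisson_extension g \<in> borel_measurable borel"
    by (rule borel_measurable_poisson_extension) simp
  define N where "N = (\<integral>y. \<bar>g y\<bar> powr p \<partial>lborel)"
  have N: "N \<ge> 0" "(\<integral>\<^sup>+y. ennreal (\<bar>g y\<bar> powr p) \<partial>lborel) = ennreal N"
    using gi by (auto simp: N_def nn_integral_eq_integral)
  define C where "C = (2 powr p / (s - s / p) * N) powr (1 / p)"
  have b: "s - s / p > 0" using p s by (simp add: field_simps)
  have C: "C \<ge> 0" "C powr p = 2 powr p / (s - s / p) * N"
    using p b N by (auto simp: C_def powr_powr)
  show ?thesis
    unfolding weak_Lp_def space_half_space_measure mem_Collect_eq
  proof (intro conjI exI[of _ C] allI impI)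
    show "(\<lambda>(x, t). t powr (s / p) * poisson_extension f (x, t)) \<in> borel_measurable (half_space_measure s)"
      unfolding ext case_prod_unfold prod.collapse by (rule borel_measurable_half_space) measurable
    show "C \<ge> 0" by fact
    fix l :: real assume l: "l > 0"
    have "emeasure (half_space_measure s) {z \<in> upper_half_space. l < \<bar>snd z powr (s / p) * poisson_extension g z\<bar>}
        \<le> ennreal (2 powr p / (s - s / p) / l powr p) * ennreal N"
      using poisson_extension_weak_bound[OF p s _ l, of g] by (simp add: N)
    also have "\<dots> = ennreal (C powr p / l powr p)"
      using b N C by (simp flip: ennreal_mult)
    finally show "emeasure (half_space_measure s)
        {a \<in> upper_half_space. \<bar>case a of (x, t) \<Rightarrow> t powr (s / p) * poisson_extension f (x, t)\<bar> > l}
        \<le> ennreal (C powr p / l powr p)"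
      by (simp add: ext case_prod_unfold)
  qed
qed

section \<open>Growth of harmonic functions in weak Lebesgue spaces\<close>

text \<open>On the slab \<open>a \<le> t \<le> b\<close> the weights \<open>t\<^bsup>s/p\<^esup>\<close> and \<open>t\<^bsup>-(s+1)\<^esup>\<close> are bounded below by their values at
  \<open>a\<close> and \<open>b\<close>, and the weak-type condition becomes a bound for Lebesgue measure.\<close>

lemma emeasure_superlevel_slab_le:
  fixes u :: "(real ^ 'n) \<times> real \<Rightarrow> real"
  assumes p: "p > 1" and s: "s > 0" and [measurable]: "u \<in> borel_measurable borel"
    and weak: "\<And>l. l > 0 \<Longrightarrow> emeasure (half_space_measure s) {z \<in> upper_half_space. l < \<bar>snd z powr (s / p) * u z\<bar>}
      \<le> ennreal (C powr p / l powr p)"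
    and ab: "0 < a" "a \<le> b" and l: "l > 0"
  shows "emeasure lborel {z. a \<le> snd z \<and> snd z \<le> b \<and> l < \<bar>u z\<bar>}
    \<le> ennreal (b powr (s + 1) * C powr p / (a powr s * l powr p))"
proof -
  let ?E = "{z. a \<le> snd z \<and> snd z \<le> b \<and> l < \<bar>u z\<bar>}"
  let ?l = "a powr (s / p) * l"
  let ?A = "{z \<in> upper_half_space. ?l < \<bar>snd z powr (s / p) * u z\<bar>}"
  have lp: "?l > 0" using ab l by simp
  have Am: "?A \<in> sets borel" by measurable
  have "emeasure lborel ?E = (\<integral>\<^sup>+z. indicator ?E z \<partial>lborel)"
    by (subst nn_integral_indicator) simp_all
  also have "\<dots> \<le> (\<integral>\<^sup>+z. ennreal (b powr (s + 1)) * (ennreal (snd z powr (-(s + 1))) * indicator ?A z) \<partial>lborel)"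
  proof (rule nn_integral_mono)
    fix z
    show "indicator ?E z \<le> ennreal (b powr (s + 1)) * (ennreal (snd z powr (-(s + 1))) * indicator ?A z)"
    proof (cases "z \<in> ?E")
      case True
      then have t: "a \<le> snd z" "snd z \<le> b" "snd z > 0" and lz: "l < \<bar>u z\<bar>" using ab by auto
      have "?l \<le> snd z powr (s / p) * l"
        using t ab p s l by (intro mult_right_mono powr_mono2) auto
      also have "\<dots> < snd z powr (s / p) * \<bar>u z\<bar>" using lz t by simp
      finally have "z \<in> ?A" using t by (auto simp: upper_half_space_def case_prod_unfold abs_mult)
      moreover have "1 \<le> b powr (s + 1) * snd z powr (-(s + 1))"
      proof -
        have "snd z powr (s + 1) \<le> b powr (s + 1)" using t s by (intro powr_mono2) auto
        then show ?thesis using t unfolding powr_minus by (simp add: field_simps)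
      qed
      then have "1 \<le> ennreal (b powr (s + 1)) * ennreal (snd z powr (-(s + 1)))"
        by (simp flip: ennreal_mult add: ennreal_ge_1)
      ultimately show ?thesis using True by (simp add: indicator_def)
    qed simp
  qed
  also have "\<dots> = ennreal (b powr (s + 1)) * (\<integral>\<^sup>+z. ennreal (snd z powr (-(s + 1))) * indicator ?A z \<partial>lborel)"
    by (rule nn_integral_cmult) simp
  also have "\<dots> = ennreal (b powr (s + 1)) * emeasure (half_space_measure s) ?A"
    by (simp only: emeasure_half_space_measure[OF Am Collect_restrict])
  also have "\<dots> \<le> ennreal (b powr (s + 1)) * ennreal (C powr p / ?l powr p)"
    by (intro mult_left_mono weak lp) simp
  also have "\<dots> = ennreal (b powr (s + 1) * (C powr p / ?l powr p))"
    by (rule ennreal_mult[symmetric]) auto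
  also have "?l powr p = a powr s * l powr p"
    using ab l p by (simp add: powr_mult powr_powr)
  finally show ?thesis by simp
qed

text \<open>If \<open>\<bar>c\<bar> > 1\<close>, the term with \<open>2\<^sup>k < \<bar>c\<bar> \<le> 2\<^bsup>k+1\<^esup>\<close> alone suffices.\<close>

lemma ennreal_abs_le_dyadic_sum:
  "ennreal \<bar>c\<bar> \<le> 1 + (\<Sum>k. ennreal (2 ^ Suc k) * (if 2 ^ k < \<bar>c\<bar> then 1 else 0))"
proof (cases "\<bar>c\<bar> \<le> 1")
  case True
  then have "ennreal \<bar>c\<bar> \<le> 1" by (simp add: ennreal_le_1)
  then show ?thesis by (rule order_trans) simp
next
  case False
  obtain m :: nat where m: "\<bar>c\<bar> \<le> 2 ^ m" using real_arch_pow[of 2 "\<bar>c\<bar>"] by (auto intro: less_imp_le)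
  define k where "k = (LEAST m. \<bar>c\<bar> \<le> 2 ^ m)"
  have k: "\<bar>c\<bar> \<le> 2 ^ k" unfolding k_def by (rule LeastI[of _ m]) (rule m)
  have "k \<noteq> 0"
  proof
    assume "k = 0"
    with k False show False by simp
  qed
  then obtain j where j: "k = Suc j" by (cases k) auto
  have "\<not> \<bar>c\<bar> \<le> 2 ^ j" unfolding k_def using j k_def by (intro not_less_Least) auto
  then have "ennreal \<bar>c\<bar> \<le> ennreal (2 ^ Suc j) * (if 2 ^ j < \<bar>c\<bar> then 1 else 0)"
    using k j by (simp add: ennreal_leI del: power_Suc)
  also have "\<dots> \<le> (\<Sum>k. ennreal (2 ^ Suc k) * (if 2 ^ k < \<bar>c\<bar> then 1 else 0))"
    using sum_le_suminf[of "\<lambda>k. ennreal (2 ^ Suc k) * (if 2 ^ k < \<bar>c\<bar> then 1 else 0)" "{j}"] by simp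
  finally show ?thesis by (rule order_trans) simp
qed

text \<open>The mean value property bounds \<open>\<bar>u(x, t)\<bar>\<close> by the average of \<open>\<bar>u\<bar>\<close> over the ball of radius
  \<open>t/2\<close>. There the set \<open>{\<bar>u\<bar> > 2\<^sup>k}\<close> has measure at most a multiple of \<open>t 2\<^bsup>-kp\<^esup>\<close>; the dyadic sum
  converges because \<open>p > 1\<close>, and the volume of the ball is comparable to \<open>t\<^bsup>n+1\<^esup>\<close>.\<close>

lemma weak_Lp_harmonic_growth:
  fixes u :: "(real ^ 'n) \<times> real \<Rightarrow> real"
  assumes p: "p > 1" and s: "s > 0" and u [measurable]: "u \<in> borel_measurable borel"
    and mv: "mean_value_on upper_half_space u"
    and weak: "\<And>l. l > 0 \<Longrightarrow> emeasure (half_space_measure s) {z \<in> upper_half_space. l < \<bar>snd z powr (s / p) * u z\<bar>}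
      \<le> ennreal (C powr p / l powr p)"
  obtains K where "K > 0" "\<And>x t. t > 0 \<Longrightarrow> \<bar>u (x, t)\<bar> \<le> K * (1 + t powr (- real CARD('n)))"
proof -
  let ?n = "real CARD('n)"
  let ?W = "integral\<^sup>L lborel (bump :: (real ^ 'n) \<times> real \<Rightarrow> real)"
  have W: "?W > 0" by (rule integral_bump_pos)
  define V where "V = measure lborel (cball (0 :: (real ^ 'n) \<times> real) 1)"
  \<comment> \<open>\<open>B\<close> is the constant of \<open>emeasure_superlevel_slab_le\<close> for the slab \<open>t/2 \<le> snd z \<le> 3t/2\<close> after division by \<open>(t/2)\<^bsup>n+1\<^esup>\<close>, with the powers of \<open>t\<close> and \<open>2\<^sup>k\<close> removed.\<close>
  define B where "B = (3/2) powr (s + 1) * C powr p * 2 powr s * 2 ^ (CARD('n) + 1)"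
  define \<theta> where "\<theta> = (2::real) powr (1 - p)"
  have th: "0 < \<theta>" "\<theta> < 1" using p by (auto simp: \<theta>_def powr_less_one)
  define Q where "Q = 2 * B / (1 - \<theta>)"
  have B: "B \<ge> 0" by (simp add: B_def)
  then have Q: "Q \<ge> 0" using th by (simp add: Q_def)
  have V: "V \<ge> 0" by (simp add: V_def)
  have main: "?W * \<bar>u (x, t)\<bar> \<le> V + Q * t powr (- ?n)" if t: "t > 0" for x t
  proof -
    define r where "r = t / 2"
    have r: "0 \<le> r" "r < t" "r > 0" using t by (auto simp: r_def)
    note sub = ball_subset_upper_half_space[of x t]
    note cu = mean_value_on_continuous[OF mv]
    define E where "E k = {z :: (real ^ 'n) \<times> real. t / 2 \<le> snd z \<and> snd z \<le> 3 * t / 2 \<and> 2 ^ k < \<bar>u z\<bar>}" for k :: nat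
    have Em [measurable]: "E k \<in> sets borel" for k unfolding E_def by measurable
    have aff: "(\<lambda>y. (x, t) + r *\<^sub>R y) \<in> borel_measurable borel"
      by (intro borel_measurable_continuous_onI continuous_intros)
    have im [measurable]: "(\<lambda>y. indicator (E k) ((x, t) + r *\<^sub>R y) :: ennreal) \<in> borel_measurable borel" for k
      by (rule measurable_compose[OF aff borel_measurable_indicator]) (rule Em)
    have sm: "(\<lambda>y. \<Sum>k. ennreal (2 ^ Suc k) * indicator (E k) ((x, t) + r *\<^sub>R y)) \<in> borel_measurable borel"
      by measurable
    have affE: "(\<integral>\<^sup>+y. indicator (E k) ((x, t) + r *\<^sub>R y) \<partial>lborel) \<le> ennreal (B * t powr (- ?n) * 2 powr (- (real k * p)))" for k
    proof -
      have rp: "r ^ (CARD('n) + 1) > 0" using r by simp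
      have Ek: "emeasure lborel (E k) \<le> ennreal ((3 * t / 2) powr (s + 1) * C powr p / ((t / 2) powr s * (2 ^ k) powr p))"
        unfolding E_def by (rule emeasure_superlevel_slab_le[OF p s u weak]) (use t in auto)
      have "emeasure lborel (E k) = (\<integral>\<^sup>+z. indicator (E k) z \<partial>lborel)" by simp
      also have "\<dots> = ennreal (r ^ (CARD('n) + 1)) * (\<integral>\<^sup>+y. indicator (E k) ((x, t) + r *\<^sub>R y) \<partial>lborel)"
        using r nn_integral_lborel_affine[of "indicator (E k)" r "(x, t)"] by simp
      finally have eq: "emeasure lborel (E k) = ennreal (r ^ (CARD('n) + 1)) * (\<integral>\<^sup>+y. indicator (E k) ((x, t) + r *\<^sub>R y) \<partial>lborel)" .
      have "(\<integral>\<^sup>+y. indicator (E k) ((x, t) + r *\<^sub>R y) \<partial>lborel)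
          = ennreal (1 / r ^ (CARD('n) + 1)) * emeasure lborel (E k)"
      proof -
        have "ennreal (1 / r ^ (CARD('n) + 1)) * ennreal (r ^ (CARD('n) + 1)) = ennreal (1 / r ^ (CARD('n) + 1) * r ^ (CARD('n) + 1))"
          by (rule ennreal_mult[symmetric]) (use rp in auto)
        also have "\<dots> = 1" using r by simp
        finally show ?thesis unfolding eq mult.assoc[symmetric] by simp
      qed
      also have "\<dots> \<le> ennreal (1 / r ^ (CARD('n) + 1)) * ennreal ((3 * t / 2) powr (s + 1) * C powr p / ((t / 2) powr s * (2 ^ k) powr p))"
        by (intro mult_left_mono Ek) simp
      also have "\<dots> = ennreal (1 / r ^ (CARD('n) + 1) * ((3 * t / 2) powr (s + 1) * C powr p / ((t / 2) powr s * (2 ^ k) powr p)))"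
        by (rule ennreal_mult[symmetric]) (use rp in auto)
      also have "1 / r ^ (CARD('n) + 1) * ((3 * t / 2) powr (s + 1) * C powr p / ((t / 2) powr s * (2 ^ k) powr p))
          = B * t powr (- ?n) * 2 powr (- (real k * p))"
      proof -
        have 1: "(3 * t / 2) powr (s + 1) = (3/2) powr (s + 1) * (t powr s * t)"
          using t powr_mult[of "3/2" t "s + 1"] by (simp add: powr_add)
        have 2: "(t / 2) powr s = t powr s / 2 powr s" using t by (simp add: powr_divide)
        have 3: "(2 ^ k) powr p = 2 powr (real k * p)" by (simp add: powr_powr flip: powr_realpow)
        have 4: "t powr (- ?n) = 1 / t ^ CARD('n)" using t by (simp add: powr_minus powr_realpow field_simps)
        have 5: "r ^ (CARD('n) + 1) = t ^ CARD('n) * t / 2 ^ (CARD('n) + 1)" by (simp add: r_def power_divide)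
        show ?thesis
          unfolding 1 2 3 4 5 B_def powr_minus[of 2] using t by (simp add: field_simps)
      qed
      finally show ?thesis .
    qed
    have "(\<integral>\<^sup>+y. (\<Sum>k. ennreal (2 ^ Suc k) * indicator (E k) ((x, t) + r *\<^sub>R y)) \<partial>lborel)
        = (\<Sum>k. \<integral>\<^sup>+y. ennreal (2 ^ Suc k) * indicator (E k) ((x, t) + r *\<^sub>R y) \<partial>lborel)"
      by (rule nn_integral_suminf) measurable
    also have "\<dots> \<le> (\<Sum>k. ennreal (2 * B * t powr (- ?n) * \<theta> ^ k))"
    proof (rule suminf_le)
      fix k
      have "(\<integral>\<^sup>+y. ennreal (2 ^ Suc k) * indicator (E k) ((x, t) + r *\<^sub>R y) \<partial>lborel)
          = ennreal (2 ^ Suc k) * (\<integral>\<^sup>+y. indicator (E k) ((x, t) + r *\<^sub>R y) \<partial>lborel)"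
        by (rule nn_integral_cmult) measurable
      also have "\<dots> \<le> ennreal (2 ^ Suc k) * ennreal (B * t powr (- ?n) * 2 powr (- (real k * p)))"
        by (intro mult_left_mono affE) simp
      also have "\<dots> = ennreal (2 ^ Suc k * (B * t powr (- ?n) * 2 powr (- (real k * p))))"
        by (rule ennreal_mult[symmetric]) (use B in auto)
      also have "2 ^ Suc k * (B * t powr (- ?n) * 2 powr (- (real k * p))) = 2 * B * t powr (- ?n) * \<theta> ^ k"
      proof -
        have "\<theta> ^ k = 2 powr ((1 - p) * real k)"
          unfolding \<theta>_def by (simp add: powr_powr powr_power mult.commute)
        also have "\<dots> = 2 ^ k * 2 powr (- (real k * p))"
        proof -
          have "(2::real) ^ k = 2 powr real k" by (simp add: powr_realpow)
          then show ?thesis by (simp add: algebra_simps flip: powr_add)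
        qed
        finally show ?thesis by simp
      qed
      finally show "(\<integral>\<^sup>+y. ennreal (2 ^ Suc k) * indicator (E k) ((x, t) + r *\<^sub>R y) \<partial>lborel)
          \<le> ennreal (2 * B * t powr (- ?n) * \<theta> ^ k)" .
    qed auto
    also have "\<dots> = ennreal (\<Sum>k. 2 * B * t powr (- ?n) * \<theta> ^ k)"
      using B th by (intro suminf_ennreal2 summable_mult) (auto intro!: summable_geometric)
    also have "(\<Sum>k. 2 * B * t powr (- ?n) * \<theta> ^ k) = Q * t powr (- ?n)"
      using th by (simp add: suminf_mult suminf_geometric summable_geometric Q_def)
    finally have sum_le: "(\<integral>\<^sup>+y. (\<Sum>k. ennreal (2 ^ Suc k) * indicator (E k) ((x, t) + r *\<^sub>R y)) \<partial>lborel) \<le> ennreal (Q * t powr (- ?n))" .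
    have "?W * u (x, t) = (\<integral>y. bump y * u ((x, t) + r *\<^sub>R y) \<partial>lborel)"
      by (rule mean_value_onD[OF mv sub r(1,2), symmetric])
    then have "ennreal (?W * \<bar>u (x, t)\<bar>) = ennreal (norm (\<integral>y. bump y * u ((x, t) + r *\<^sub>R y) \<partial>lborel))"
      using W by (metis abs_mult abs_of_pos real_norm_def)
    also have "\<dots> \<le> (\<integral>\<^sup>+y. ennreal (norm (bump y * u ((x, t) + r *\<^sub>R y))) \<partial>lborel)"
      by (rule integral_norm_bound_ennreal)
         (rule integrable_bump_mult[OF open_upper_half_space cu sub r(1,2)])
    also have "\<dots> \<le> (\<integral>\<^sup>+y. indicator (cball 0 1) y +
        (\<Sum>k. ennreal (2 ^ Suc k) * indicator (E k) ((x, t) + r *\<^sub>R y)) \<partial>lborel)"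
    proof (rule nn_integral_mono)
      fix y :: "(real ^ 'n) \<times> real"
      show "ennreal (norm (bump y * u ((x, t) + r *\<^sub>R y))) \<le> indicator (cball 0 1) y +
        (\<Sum>k. ennreal (2 ^ Suc k) * indicator (E k) ((x, t) + r *\<^sub>R y))"
      proof (cases "y \<in> cball 0 1")
        case True
        have "\<bar>snd y\<bar> \<le> 1" using True norm_snd_le[of "snd y" "fst y"] by simp
        then have "\<bar>r * snd y\<bar> \<le> r * 1" unfolding abs_mult using r by (intro mult_mono) auto
        then have tt: "t / 2 \<le> t + r * snd y" "t + r * snd y \<le> 3 * t / 2" by (auto simp: r_def abs_le_iff)
        have ind: "(if 2 ^ k < \<bar>u ((x, t) + r *\<^sub>R y)\<bar> then 1 else 0) = (indicator (E k) ((x, t) + r *\<^sub>R y) :: ennreal)" for k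
          using tt by (auto simp: E_def indicator_def)
        have "norm (bump y * u ((x, t) + r *\<^sub>R y)) \<le> 1 * \<bar>u ((x, t) + r *\<^sub>R y)\<bar>"
          unfolding real_norm_def abs_mult using bump_nonneg[of y] bump_le_1[of y] by (intro mult_right_mono) auto
        then have "ennreal (norm (bump y * u ((x, t) + r *\<^sub>R y))) \<le> ennreal \<bar>u ((x, t) + r *\<^sub>R y)\<bar>"
          by (intro ennreal_leI) simp
        also have "\<dots> \<le> 1 + (\<Sum>k. ennreal (2 ^ Suc k) * indicator (E k) ((x, t) + r *\<^sub>R y))"
          using ennreal_abs_le_dyadic_sum[of "u ((x, t) + r *\<^sub>R y)"] unfolding ind .
        finally show ?thesis using True by simp
      qed (simp add: bump_eq_0)
    qed
    also have "\<dots> = (\<integral>\<^sup>+y. indicator (cball 0 1) (y :: (real ^ 'n) \<times> real) \<partial>lborel)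
        + (\<integral>\<^sup>+y. (\<Sum>k. ennreal (2 ^ Suc k) * indicator (E k) ((x, t) + r *\<^sub>R y)) \<partial>lborel)"
      by (rule nn_integral_add) (use sm in \<open>auto intro!: borel_measurable_indicator\<close>)
    also have "(\<integral>\<^sup>+y. indicator (cball 0 1) (y :: (real ^ 'n) \<times> real) \<partial>lborel) = ennreal V"
      unfolding V_def using emeasure_lborel_cball_finite[of "0 :: (real ^ 'n) \<times> real" 1]
      by (subst nn_integral_indicator) (auto intro!: emeasure_eq_ennreal_measure simp: less_top)
    also have "ennreal V + (\<integral>\<^sup>+y. (\<Sum>k. ennreal (2 ^ Suc k) * indicator (E k) ((x, t) + r *\<^sub>R y)) \<partial>lborel)
        \<le> ennreal V + ennreal (Q * t powr (- ?n))"
      by (rule add_left_mono[OF sum_le])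
    also have "ennreal V + ennreal (Q * t powr (- ?n)) = ennreal (V + Q * t powr (- ?n))"
      using V Q by simp
    finally show ?thesis
      using V Q by (subst (asm) ennreal_le_iff) (auto intro!: add_nonneg_nonneg mult_nonneg_nonneg)
  qed
  define K where "K = (V + Q + 1) / ?W"
  show ?thesis
  proof (rule that[of K])
    show "K > 0" using V Q W by (simp add: K_def)
    fix x :: "real ^ 'n" and t :: real assume t: "t > 0"
    have "V + Q * t powr (- ?n) \<le> (V + Q + 1) * 1 + (V + Q + 1) * t powr (- ?n)"
      using V Q by (intro add_mono mult_right_mono) auto
    then have "?W * \<bar>u (x, t)\<bar> \<le> (V + Q + 1) * (1 + t powr (- ?n))"
      using main[OF t, of x] by (simp add: distrib_left)
    then show "\<bar>u (x, t)\<bar> \<le> K * (1 + t powr (- ?n))"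
      using W by (simp add: K_def field_simps)
  qed
qed

section \<open>Uniform bounds for horizontal slices\<close>

text \<open>Subtracting the constant \<open>c\<close> inside and outside is compatible with Jensen's inequality since the
  kernel has integral \<open>1\<close>. As \<open>ennreal\<close> sends negative numbers to \<open>0\<close>, the integrands are the convex
  functions \<open>max 0 (\<bar>\<cdot>\<bar>\<^sup>p - c)\<close> of the values.\<close>

lemma poisson_extension_truncated_contraction:
  fixes g :: "real ^ 'n \<Rightarrow> real"
  assumes t: "t > 0" and p: "p > 1" and [measurable]: "g \<in> borel_measurable borel" and c: "c \<ge> 0"
  shows "(\<integral>\<^sup>+x. ennreal (\<bar>poisson_extension g (x, t)\<bar> powr p - c) \<partial>lborel)
    \<le> (\<integral>\<^sup>+y. ennreal (\<bar>g y\<bar> powr p - c) \<partial>lborel)"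
proof -
  have "ennreal (\<bar>poisson_extension g (x, t)\<bar> powr p - c)
      \<le> (\<integral>\<^sup>+y. ennreal (poisson_kernel t (x - y)) * ennreal (\<bar>g y\<bar> powr p - c) \<partial>lborel)" (is "_ \<le> ?R") for x
  proof -
    have "ennreal (\<bar>poisson_extension g (x, t)\<bar> powr p)
        \<le> (\<integral>\<^sup>+y. ennreal (poisson_kernel t (x - y) * \<bar>g y\<bar> powr p) \<partial>lborel)"
      by (rule poisson_extension_jensen[OF t p]) simp
    also have "\<dots> \<le> (\<integral>\<^sup>+y. ennreal c * ennreal (poisson_kernel t (x - y)) +
        ennreal (poisson_kernel t (x - y)) * ennreal (\<bar>g y\<bar> powr p - c) \<partial>lborel)"
    proof (rule nn_integral_mono)
      fix y
      have k: "poisson_kernel t (x - y) \<ge> 0" using t by (simp add: poisson_kernel_nonneg)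
      have "ennreal (poisson_kernel t (x - y) * \<bar>g y\<bar> powr p)
          = ennreal (poisson_kernel t (x - y)) * ennreal (c + (\<bar>g y\<bar> powr p - c))"
        using k by (simp add: ennreal_mult)
      also have "\<dots> \<le> ennreal (poisson_kernel t (x - y)) * (ennreal c + ennreal (\<bar>g y\<bar> powr p - c))"
      proof (intro mult_left_mono)
        show "ennreal (c + (\<bar>g y\<bar> powr p - c)) \<le> ennreal c + ennreal (\<bar>g y\<bar> powr p - c)"
        proof (cases "\<bar>g y\<bar> powr p - c \<ge> 0")
          case True
          then show ?thesis by (subst ennreal_plus) (use c in auto)
        next
          case False
          then have "ennreal (c + (\<bar>g y\<bar> powr p - c)) \<le> ennreal c" by (intro ennreal_leI) simp
          then show ?thesis by (rule order_trans) simp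
        qed
      qed simp
      finally show "ennreal (poisson_kernel t (x - y) * \<bar>g y\<bar> powr p) \<le> ennreal c * ennreal (poisson_kernel t (x - y)) +
        ennreal (poisson_kernel t (x - y)) * ennreal (\<bar>g y\<bar> powr p - c)"
        by (simp add: distrib_left mult.commute)
    qed
    also have "\<dots> = ennreal c + ?R"
      by (subst nn_integral_add) (auto simp: nn_integral_cmult nn_integral_poisson_kernel_diff[OF t])
    finally have "ennreal (\<bar>poisson_extension g (x, t)\<bar> powr p) - ennreal c \<le> ?R"
      by (simp add: ennreal_minus_le_iff)
    then show ?thesis using c by (simp add: ennreal_minus)
  qed
  then have "(\<integral>\<^sup>+x. ennreal (\<bar>poisson_extension g (x, t)\<bar> powr p - c) \<partial>lborel)
      \<le> (\<integral>\<^sup>+x. (\<integral>\<^sup>+y. ennreal (poisson_kernel t (x - y)) * ennreal (\<bar>g y\<bar> powr p - c) \<partial>lborel) \<partial>lborel)"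
    by (rule nn_integral_mono)
  also have "\<dots> = (\<integral>\<^sup>+y. (\<integral>\<^sup>+x. ennreal (poisson_kernel t (x - y)) * ennreal (\<bar>g y\<bar> powr p - c) \<partial>lborel) \<partial>lborel)"
    by (rule lborel_pair.Fubini') simp
  also have "\<dots> = (\<integral>\<^sup>+y. ennreal (\<bar>g y\<bar> powr p - c) \<partial>lborel)"
    by (simp add: nn_integral_multc nn_integral_poisson_kernel_diff[OF t])
  finally show ?thesis .
qed

text \<open>A function in weak \<open>L\<^sup>p\<close> fails to be in \<open>L\<^sup>p\<close> only logarithmically: each of the \<open>N + 1\<close> dyadic
  scales between \<open>a\<close> and \<open>2\<^bsup>N+1\<^esup> a\<close> contributes at most \<open>(2 C)\<^sup>p\<close>.\<close>

lemma nn_integral_truncated_weak_Lp: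
  fixes G :: "'a \<Rightarrow> real"
  assumes p: "p > 1" and [measurable]: "G \<in> borel_measurable M" and G: "\<And>x. G x \<ge> 0" and a: "a > 0"
    and weak: "\<And>l. l > 0 \<Longrightarrow> emeasure M {x \<in> space M. l < G x} \<le> ennreal (C powr p / l powr p)"
  shows "(\<integral>\<^sup>+x. ennreal (G x powr p) * indicator {x. a < G x \<and> G x \<le> 2 ^ Suc N * a} x \<partial>M)
    \<le> ennreal (real (Suc N) * (2 powr p * C powr p))"
proof -
  have "(\<integral>\<^sup>+x. ennreal (G x powr p) * indicator {x. a < G x \<and> G x \<le> 2 ^ Suc N * a} x \<partial>M)
    \<le> (\<integral>\<^sup>+x. (\<Sum>j\<le>N. ennreal ((2 ^ Suc j * a) powr p) * indicator {x \<in> space M. 2 ^ j * a < G x} x) \<partial>M)"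
  proof (rule nn_integral_mono)
    fix x assume x: "x \<in> space M"
    show "ennreal (G x powr p) * indicator {x. a < G x \<and> G x \<le> 2 ^ Suc N * a} x
      \<le> (\<Sum>j\<le>N. ennreal ((2 ^ Suc j * a) powr p) * indicator {x \<in> space M. 2 ^ j * a < G x} x)"
    proof (cases "a < G x \<and> G x \<le> 2 ^ Suc N * a")
      case True
      define k where "k = (LEAST m. G x \<le> 2 ^ m * a)"
      have k: "G x \<le> 2 ^ k * a" unfolding k_def by (rule LeastI[of _ "Suc N"]) (use True in auto)
      have kN: "k \<le> Suc N" unfolding k_def by (rule Least_le) (use True in auto)
      have "k \<noteq> 0"
      proof
        assume "k = 0"
        with k True show False by simp
      qed
      then obtain j where j: "k = Suc j" by (cases k) auto
      have "\<not> G x \<le> 2 ^ j * a" unfolding k_def using j k_def by (intro not_less_Least) auto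
      then have jj: "indicator {x \<in> space M. 2 ^ j * a < G x} x = (1 :: ennreal)" using x by (simp add: indicator_def)
      have "ennreal (G x powr p) \<le> ennreal ((2 ^ Suc j * a) powr p)"
        using k j G p by (intro ennreal_leI powr_mono2) auto
      also have "\<dots> = (\<Sum>j\<in>{j}. ennreal ((2 ^ Suc j * a) powr p) * indicator {x \<in> space M. 2 ^ j * a < G x} x)"
        using jj by simp
      also have "\<dots> \<le> (\<Sum>j\<le>N. ennreal ((2 ^ Suc j * a) powr p) * indicator {x \<in> space M. 2 ^ j * a < G x} x)"
        using kN j by (intro sum_mono2) auto
      finally show ?thesis using True by (simp add: indicator_def)
    next
      case False
      then have "indicator {x. a < G x \<and> G x \<le> 2 ^ Suc N * a} x = (0 :: ennreal)"
        by (simp only: indicator_simps mem_Collect_eq not_False_eq_True)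
      then show ?thesis by simp
    qed
  qed
  also have "\<dots> = (\<Sum>j\<le>N. \<integral>\<^sup>+x. ennreal ((2 ^ Suc j * a) powr p) * indicator {x \<in> space M. 2 ^ j * a < G x} x \<partial>M)"
    by (rule nn_integral_sum) measurable
  also have "\<dots> \<le> (\<Sum>j\<le>N. ennreal (2 powr p * C powr p))"
  proof (rule sum_mono)
    fix j
    have "(\<integral>\<^sup>+x. ennreal ((2 ^ Suc j * a) powr p) * indicator {x \<in> space M. 2 ^ j * a < G x} x \<partial>M)
        = ennreal ((2 ^ Suc j * a) powr p) * emeasure M {x \<in> space M. 2 ^ j * a < G x}"
      by (rule nn_integral_cmult_indicator) measurable
    also have "\<dots> \<le> ennreal ((2 ^ Suc j * a) powr p) * ennreal (C powr p / (2 ^ j * a) powr p)"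
      using a by (intro mult_left_mono weak) auto
    also have "\<dots> = ennreal ((2 ^ Suc j * a) powr p * (C powr p / (2 ^ j * a) powr p))"
      by (rule ennreal_mult[symmetric]) auto
    also have "(2 ^ Suc j * a) powr p * (C powr p / (2 ^ j * a) powr p) = 2 powr p * C powr p"
    proof -
      have "(2 ^ Suc j * a) powr p = 2 powr p * (2 ^ j * a) powr p"
        using a powr_mult[of 2 "2 ^ j * a" p] by (simp add: mult.assoc)
      then show ?thesis using a by simp
    qed
    finally show "(\<integral>\<^sup>+x. ennreal ((2 ^ Suc j * a) powr p) * indicator {x \<in> space M. 2 ^ j * a < G x} x \<partial>M)
      \<le> ennreal (2 powr p * C powr p)" .
  qed
  also have "\<dots> = ennreal (real (Suc N) * (2 powr p * C powr p))"
    by (simp add: ennreal_mult ennreal_of_nat_eq_real_of_nat)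
  finally show ?thesis .
qed

text \<open>The truncated slice integral \<open>J\<close> decreases with the height, so \<open>J \<tau> ln (\<tau>/r)\<close> is at most the
  integral of \<open>J t / t\<close> over \<open>r \<le> t \<le> \<tau>\<close>. Since \<open>t\<^bsup>-(s+1)\<^esup> (t\<^bsup>s/p\<^esup> \<bar>u\<bar>)\<^sup>p = \<bar>u\<bar>\<^sup>p / t\<close>, that
  integral is controlled by the part of \<open>t\<^bsup>s/p\<^esup> \<bar>u\<bar>\<close> between the scales \<open>r\<^bsup>s/p\<^esup> h\<close> and
  \<open>2\<^bsup>N+1\<^esup> r\<^bsup>s/p\<^esup> h\<close>.\<close>

lemma weak_Lp_slice_bound:
  fixes u :: "(real ^ 'n) \<times> real \<Rightarrow> real"
  assumes p: "p > 1" and s: "s > 0" and u [measurable]: "u \<in> borel_measurable borel"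
    and weak: "\<And>l. l > 0 \<Longrightarrow> emeasure (half_space_measure s) {z \<in> upper_half_space. l < \<bar>snd z powr (s / p) * u z\<bar>}
      \<le> ennreal (C powr p / l powr p)"
    and rep: "\<And>x t \<epsilon>. \<epsilon> > 0 \<Longrightarrow> t > 0 \<Longrightarrow> u (x, t + \<epsilon>) = poisson_extension (\<lambda>y. u (y, \<epsilon>)) (x, t)"
    and r: "0 < r" "r < \<tau>" and h: "h > 0"
    and N: "\<And>x t. r \<le> t \<Longrightarrow> t \<le> \<tau> \<Longrightarrow> t powr (s / p) * \<bar>u (x, t)\<bar> \<le> 2 ^ Suc N * (r powr (s / p) * h)"
  shows "ennreal (ln (\<tau> / r)) * (\<integral>\<^sup>+x. ennreal (\<bar>u (x, \<tau>)\<bar> powr p - h powr p) \<partial>lborel)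
    \<le> ennreal (real (Suc N) * (2 powr p * C powr p))"
proof -
  define a where "a = r powr (s / p) * h"
  have a: "a > 0" using r h by (simp add: a_def)
  define G where "G z = \<bar>snd z powr (s / p) * u z\<bar>" for z
  have [measurable]: "G \<in> borel_measurable borel" unfolding G_def by measurable
  let ?J = "\<lambda>t. \<integral>\<^sup>+x. ennreal (\<bar>u (x, t)\<bar> powr p - h powr p) \<partial>lborel"
  let ?F = "\<lambda>z. ennreal (G z powr p) * indicator {z. a < G z \<and> G z \<le> 2 ^ Suc N * a} z"
  have J: "?J \<tau> \<le> ?J t" if t: "r \<le> t" "t \<le> \<tau>" for t
  proof (cases "t = \<tau>")
    case False
    then have t': "t > 0" "\<tau> - t > 0" using t r by auto
    have "?J \<tau> = (\<integral>\<^sup>+x. ennreal (\<bar>poisson_extension (\<lambda>y. u (y, t)) (x, \<tau> - t)\<bar> powr p - h powr p) \<partial>lborel)"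
      using rep[OF t'] by simp
    also have "\<dots> \<le> ?J t"
      by (rule poisson_extension_truncated_contraction[OF t'(2) p]) simp_all
    finally show ?thesis .
  qed simp
  have "(\<integral>\<^sup>+t. ennreal (1 / t) * indicator {r..\<tau>} t \<partial>lborel) = ennreal (ln \<tau> - ln r)"
    by (rule nn_integral_FTC_Icc) (use r in \<open>auto intro!: derivative_eq_intros\<close>)
  then have "ennreal (ln (\<tau> / r)) * ?J \<tau> = (\<integral>\<^sup>+t. ennreal (1 / t) * indicator {r..\<tau>} t \<partial>lborel) * ?J \<tau>"
    using r by (simp add: ln_div)
  also have "\<dots> = (\<integral>\<^sup>+t. ennreal (1 / t) * indicator {r..\<tau>} t * ?J \<tau> \<partial>lborel)"
    by (rule nn_integral_multc[symmetric]) simp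
  also have "\<dots> \<le> (\<integral>\<^sup>+t. ennreal (1 / t) * indicator {r..\<tau>} t * ?J t \<partial>lborel)"
    by (rule nn_integral_mono) (auto simp: indicator_def intro!: mult_left_mono J)
  also have "\<dots> = (\<integral>\<^sup>+t. (\<integral>\<^sup>+x. ennreal (1 / t) * indicator {r..\<tau>} t * ennreal (\<bar>u (x, t)\<bar> powr p - h powr p) \<partial>lborel) \<partial>lborel)"
    by (intro nn_integral_cong nn_integral_cmult[symmetric]) simp
  also have "\<dots> = (\<integral>\<^sup>+z. ennreal (1 / snd z) * indicator {r..\<tau>} (snd z) * ennreal (\<bar>u z\<bar> powr p - h powr p) \<partial>(lborel \<Otimes>\<^sub>M lborel))"
  proof -
    have "(\<lambda>z. ennreal (1 / snd z) * indicator {r..\<tau>} (snd z) * ennreal (\<bar>u z\<bar> powr p - h powr p))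
        \<in> borel_measurable (lborel \<Otimes>\<^sub>M lborel)"
      unfolding lborel_prod by measurable
    from lborel_pair.nn_integral_snd[OF this] show ?thesis by simp
  qed
  also have "\<dots> = (\<integral>\<^sup>+z. ennreal (1 / snd z) * indicator {r..\<tau>} (snd z) * ennreal (\<bar>u z\<bar> powr p - h powr p) \<partial>lborel)"
    by (simp only: lborel_prod)
  also have "\<dots> \<le> (\<integral>\<^sup>+z. ennreal (snd z powr (-(s + 1))) * ?F z * indicator upper_half_space z \<partial>lborel)"
  proof (rule nn_integral_mono)
    fix z
    show "ennreal (1 / snd z) * indicator {r..\<tau>} (snd z) * ennreal (\<bar>u z\<bar> powr p - h powr p)
      \<le> ennreal (snd z powr (-(s + 1))) * ?F z * indicator upper_half_space z"
    proof (cases "snd z \<in> {r..\<tau>} \<and> \<bar>u z\<bar> > h")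
      case True
      obtain x t where z: "z = (x, t)" by (cases z)
      have t: "r \<le> t" "t \<le> \<tau>" "t > 0" and uh: "\<bar>u z\<bar> > h" using True r by (auto simp: z)
      have Gz: "G z = t powr (s / p) * \<bar>u z\<bar>" using t by (simp add: G_def z abs_mult)
      have "a \<le> t powr (s / p) * h"
        unfolding a_def using t r h s p by (intro mult_right_mono powr_mono2) auto
      also have "\<dots> < G z" unfolding Gz using uh t by simp
      finally have 1: "a < G z" .
      have 2: "G z \<le> 2 ^ Suc N * a" unfolding a_def Gz unfolding z by (rule N[OF t(1,2)])
      have "G z powr p = t powr s * \<bar>u z\<bar> powr p" using t p by (simp add: Gz powr_mult powr_powr)
      moreover have "t powr (-(s + 1)) * t powr s = 1 / t"
        using t by (simp add: powr_neg_one flip: powr_add)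
      ultimately have "t powr (-(s + 1)) * G z powr p = 1 / t * \<bar>u z\<bar> powr p"
        by (metis mult.assoc)
      then have "ennreal (t powr (-(s + 1))) * ennreal (G z powr p) = ennreal (1 / t) * ennreal (\<bar>u z\<bar> powr p)"
        using t by (simp flip: ennreal_mult)
      moreover have "ennreal (1 / t) * ennreal (\<bar>u z\<bar> powr p - h powr p) \<le> ennreal (1 / t) * ennreal (\<bar>u z\<bar> powr p)"
        by (intro mult_left_mono ennreal_leI) auto
      ultimately show ?thesis using 1 2 t by (simp add: z upper_half_space_def)
    next
      case False
      then consider "snd z \<notin> {r..\<tau>}" | "\<not> \<bar>u z\<bar> > h" by blast
      then show ?thesis
      proof cases
        case 2
        then have "\<bar>u z\<bar> powr p \<le> h powr p" using p h by (intro powr_mono2) auto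
        then show ?thesis by (simp add: ennreal_neg)
      qed simp
    qed
  qed
  also have "\<dots> = (\<integral>\<^sup>+z. ?F z \<partial>half_space_measure s)"
    by (rule nn_integral_half_space_measure[symmetric]) measurable
  also have "\<dots> \<le> ennreal (real (Suc N) * (2 powr p * C powr p))"
  proof (rule nn_integral_truncated_weak_Lp[OF p _ _ a])
    show "G \<in> borel_measurable (half_space_measure s)" by (rule borel_measurable_half_space) measurable
    show "emeasure (half_space_measure s) {x \<in> space (half_space_measure s). l < G x} \<le> ennreal (C powr p / l powr p)"
      if "l > 0" for l
      using weak[OF that] by (simp only: space_half_space_measure G_def)
  qed (simp add: G_def)
  finally show ?thesis .
qed

text \<open>Take \<open>r = \<tau> 2\<^bsup>-k\<^esup>\<close> and \<open>h = 2\<^bsup>-k\<^esup>\<close>. The growth estimate then allows a number of scales \<open>N\<close> that is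
  affine in \<open>k\<close> with slope \<open>d\<close> depending on \<open>n\<close>, \<open>s\<close> and \<open>p\<close> only, while \<open>ln (\<tau>/r) = k ln 2\<close>.
  Dividing and letting \<open>k\<close> tend to infinity removes the intercept \<open>q\<close>, which depends on \<open>\<tau>\<close>, and the
  truncation.\<close>

lemma weak_Lp_harmonic_slice_bound:
  fixes u :: "(real ^ 'n) \<times> real \<Rightarrow> real"
  assumes p: "p > 1" and s: "s > 0" and u [measurable]: "u \<in> borel_measurable borel"
    and weak: "\<And>l. l > 0 \<Longrightarrow> emeasure (half_space_measure s) {z \<in> upper_half_space. l < \<bar>snd z powr (s / p) * u z\<bar>}
      \<le> ennreal (C powr p / l powr p)"
    and rep: "\<And>x t \<epsilon>. \<epsilon> > 0 \<Longrightarrow> t > 0 \<Longrightarrow> u (x, t + \<epsilon>) = poisson_extension (\<lambda>y. u (y, \<epsilon>)) (x, t)"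
    and K: "K > 0" "\<And>x t. t > 0 \<Longrightarrow> \<bar>u (x, t)\<bar> \<le> K * (1 + t powr (- real CARD('n)))"
  obtains L where "L \<ge> 0" "\<And>\<tau>. 0 < \<tau> \<Longrightarrow> \<tau> \<le> 1 \<Longrightarrow> (\<integral>\<^sup>+x. ennreal (\<bar>u (x, \<tau>)\<bar> powr p) \<partial>lborel) \<le> ennreal L"
proof -
  let ?n = "real CARD('n)"
  \<comment> \<open>The three summands account for the growth of \<open>u\<close>, the factor \<open>r\<^bsup>s/p\<^esup>\<close> and the truncation level \<open>h\<close>.\<close>
  obtain d :: nat where d: "?n + s / p + 1 \<le> real d" using real_arch_simple by blast
  define M where "M = 2 powr p * C powr p / ln 2"
  have M: "M \<ge> 0" by (simp add: M_def)
  show ?thesis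
  proof (rule that[of "real d * M"])
    show "real d * M \<ge> 0" using M by simp
    fix \<tau> :: real assume tau: "0 < \<tau>" "\<tau> \<le> 1"
    obtain q :: nat where q: "2 * K * \<tau> powr (- ?n - s / p) \<le> 2 ^ q"
      using real_arch_pow[of 2 "2 * K * \<tau> powr (- ?n - s / p)"] by (auto intro: less_imp_le)
    define h where "h k = (1/2 :: real) ^ k" for k :: nat
    define J where "J k = (\<integral>\<^sup>+x. ennreal (\<bar>u (x, \<tau>)\<bar> powr p - h k powr p) \<partial>lborel)" for k
    have J: "J k \<le> ennreal ((real d + (real q + 1) / real k) * M)" if k: "k \<ge> 1" for k
    proof -
      define r where "r = \<tau> / 2 ^ k"
      have "(1::real) < 2 ^ k" using k by (intro one_less_power) auto
      then have r: "0 < r" "r < \<tau>" using tau by (auto simp: r_def field_simps)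
      define N where "N = q + d * k"
      have "ennreal (ln (\<tau> / r)) * J k \<le> ennreal (real (Suc N) * (2 powr p * C powr p))"
        unfolding J_def
      proof (rule weak_Lp_slice_bound[OF p s u weak rep r])
        show "h k > 0" by (simp add: h_def)
        fix x t assume t: "r \<le> t" "t \<le> \<tau>"
        then have t0: "t > 0" using r by simp
        have "t powr (s / p) * \<bar>u (x, t)\<bar> \<le> 1 * (K * (1 + t powr (- ?n)))"
          using t t0 tau s p K by (intro mult_mono powr_le1) auto
        also have "\<dots> \<le> 1 * (K * (r powr (- ?n) + r powr (- ?n)))"
        proof (intro mult_left_mono add_mono)
          show "t powr (- ?n) \<le> r powr (- ?n)" using t r by (intro powr_mono2') auto
          have "1 powr (- ?n) \<le> r powr (- ?n)" using r tau by (intro powr_mono2') auto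
          then show "1 \<le> r powr (- ?n)" by simp
        qed (use K in auto)
        also have "\<dots> = 2 * K * r powr (- ?n)" by simp
        also have "\<dots> \<le> 2 ^ N * (r powr (s / p) * h k)"
        proof -
          have e: "r powr (- ?n) = r powr (s / p) * r powr (- ?n - s / p)"
            using r by (simp flip: powr_add)
          have "r powr (- ?n - s / p) = \<tau> powr (- ?n - s / p) / (2 ^ k) powr (- ?n - s / p)"
            using tau by (simp add: r_def powr_divide)
          also have "(2 ^ k) powr (- ?n - s / p) = 1 / 2 powr (real k * (?n + s / p))"
          proof -
            have "(2::real) ^ k = 2 powr real k" by (simp add: powr_realpow)
            then have "(2 ^ k) powr (- ?n - s / p) = 2 powr (real k * (- ?n - s / p))" by (simp only: powr_powr)
            also have "real k * (- ?n - s / p) = - (real k * (?n + s / p))" by (simp add: algebra_simps)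
            finally show ?thesis by (simp only: powr_minus_divide)
          qed
          finally have "2 * K * r powr (- ?n - s / p) = 2 * K * \<tau> powr (- ?n - s / p) * 2 powr (real k * (?n + s / p))"
            by simp
          also have "\<dots> \<le> 2 ^ q * 2 powr (real k * (real d - 1))"
            using d q by (intro mult_mono powr_mono mult_left_mono) auto
          also have "2 powr (real k * (real d - 1)) = 2 ^ (d * k) * h k"
          proof -
            have "2 powr (real k * (real d - 1)) = 2 powr (real (d * k)) * 2 powr (- real k)"
              by (simp add: algebra_simps flip: powr_add)
            also have "2 powr (- real k) = h k"
              by (simp add: h_def powr_minus powr_realpow power_one_over inverse_eq_divide)
            finally show ?thesis by (simp only: powr_realpow zero_less_numeral)
          qed
          finally have "2 * K * r powr (- ?n - s / p) \<le> 2 ^ N * h k" by (simp add: N_def power_add mult.assoc)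
          then have "r powr (s / p) * (2 * K * r powr (- ?n - s / p)) \<le> r powr (s / p) * (2 ^ N * h k)"
            by (intro mult_left_mono) auto
          then show ?thesis unfolding e by (simp add: ac_simps)
        qed
        also have "\<dots> \<le> 2 ^ Suc N * (r powr (s / p) * h k)"
          by (intro mult_right_mono power_increasing) (auto simp: h_def)
        finally show "t powr (s / p) * \<bar>u (x, t)\<bar> \<le> 2 ^ Suc N * (r powr (s / p) * h k)" .
      qed auto
      also have "ln (\<tau> / r) = real k * ln 2"
        using tau by (simp add: r_def ln_realpow)
      finally have *: "ennreal (real k * ln 2) * J k \<le> ennreal (real (Suc N) * (2 powr p * C powr p))" .
      have kl: "real k * ln 2 > 0" using k by simp
      have "J k = ennreal (1 / (real k * ln 2)) * (ennreal (real k * ln 2) * J k)"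
      proof -
        have "ennreal (1 / (real k * ln 2)) * ennreal (real k * ln 2) = ennreal (1 / (real k * ln 2) * (real k * ln 2))"
          by (rule ennreal_mult[symmetric]) (use kl in auto)
        also have "\<dots> = 1" using k by simp
        finally show ?thesis by (simp only: mult.assoc[symmetric] mult_1_left)
      qed
      also have "\<dots> \<le> ennreal (1 / (real k * ln 2)) * ennreal (real (Suc N) * (2 powr p * C powr p))"
        by (rule mult_left_mono[OF *]) simp
      also have "\<dots> = ennreal (1 / (real k * ln 2) * (real (Suc N) * (2 powr p * C powr p)))"
        by (rule ennreal_mult[symmetric]) (use kl in auto)
      also have "1 / (real k * ln 2) * (real (Suc N) * (2 powr p * C powr p)) = (real d + (real q + 1) / real k) * M"
        using k by (simp add: N_def M_def field_simps)
      finally show ?thesis .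
    qed
    have hlim: "(\<lambda>k. h k powr p) \<longlonglongrightarrow> 0"
    proof -
      have "(\<lambda>k. h k) \<longlonglongrightarrow> 0" unfolding h_def by (rule LIMSEQ_realpow_zero) auto
      then have "(\<lambda>k. h k powr p) \<longlonglongrightarrow> 0 powr p"
        using p by (intro tendsto_powr2) (auto simp: h_def)
      then show ?thesis using p by simp
    qed
    have "(\<integral>\<^sup>+x. ennreal (\<bar>u (x, \<tau>)\<bar> powr p) \<partial>lborel)
        = (\<integral>\<^sup>+x. liminf (\<lambda>k. ennreal (\<bar>u (x, \<tau>)\<bar> powr p - h k powr p)) \<partial>lborel)"
    proof (rule nn_integral_cong)
      fix x
      have "(\<lambda>k. ennreal (\<bar>u (x, \<tau>)\<bar> powr p - h k powr p)) \<longlonglongrightarrow> ennreal (\<bar>u (x, \<tau>)\<bar> powr p - 0)"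
        by (intro tendsto_intros hlim)
      then show "ennreal (\<bar>u (x, \<tau>)\<bar> powr p) = liminf (\<lambda>k. ennreal (\<bar>u (x, \<tau>)\<bar> powr p - h k powr p))"
        by (simp add: lim_imp_Liminf)
    qed
    also have "\<dots> \<le> liminf (\<lambda>k. J k)"
      unfolding J_def by (rule nn_integral_liminf) measurable
    also have "\<dots> \<le> liminf (\<lambda>k. ennreal ((real d + (real q + 1) / real k) * M))"
      by (rule Liminf_mono) (use J in \<open>auto simp: eventually_sequentially\<close>)
    also have "\<dots> = ennreal ((real d + 0) * M)"
      by (intro lim_imp_Liminf tendsto_intros lim_const_over_n) simp
    finally show "(\<integral>\<^sup>+x. ennreal (\<bar>u (x, \<tau>)\<bar> powr p) \<partial>lborel) \<le> ennreal (real d * M)" by simp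
  qed
qed

section \<open>Uniform convexity and completeness\<close>

text \<open>The mean value theorem on the two halves of the interval, since the derivative
  \<open>p z\<^bsup>p-1\<^esup>\<close> is strictly increasing.\<close>

lemma powr_midpoint_less:
  fixes x y p :: real
  assumes p: "p > 1" and xy: "0 \<le> x" "x < y"
  shows "((x + y) / 2) powr p < (x powr p + y powr p) / 2"
proof -
  let ?m = "(x + y) / 2"
  have cont: "continuous_on {a..b} (\<lambda>x. x powr p)" if "0 \<le> a" for a b :: real
    using that p by (intro continuous_on_powr') (auto intro!: continuous_intros)
  have der: "((\<lambda>x. x powr p) has_real_derivative p * z powr (p - 1)) (at z)" if "z > 0" for z :: real
    using has_real_derivative_powr[OF that] .
  have mvt: "\<exists>z. a < z \<and> z < b \<and> b powr p - a powr p = (b - a) * (p * z powr (p - 1))" if ab: "0 \<le> a" "a < b" for a b :: real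
  proof -
    obtain l z where z: "a < z" "z < b" "((\<lambda>x. x powr p) has_real_derivative l) (at z)"
      "b powr p - a powr p = (b - a) * l"
      using MVT[OF ab(2) cont[OF ab(1)]] der ab(1) real_differentiable_def by (metis le_less_trans)
    moreover have "l = p * z powr (p - 1)"
      by (rule DERIV_unique[OF z(3) der]) (use z ab in auto)
    ultimately show ?thesis by blast
  qed
  obtain z1 where z1: "x < z1" "z1 < ?m" "?m powr p - x powr p = (?m - x) * (p * z1 powr (p - 1))"
    using mvt[of x ?m] xy by auto
  obtain z2 where z2: "?m < z2" "z2 < y" "y powr p - ?m powr p = (y - ?m) * (p * z2 powr (p - 1))"
    using mvt[of ?m y] xy by auto
  have "z1 powr (p - 1) < z2 powr (p - 1)" using z1 z2 p xy by (intro powr_less_mono2) auto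
  then have "(?m - x) * (p * z1 powr (p - 1)) < (?m - x) * (p * z2 powr (p - 1))"
    using p xy by (intro mult_strict_left_mono) auto
  then have "?m powr p - x powr p < (?m - x) * (p * z2 powr (p - 1))" unfolding z1(3) .
  moreover have "?m - x = y - ?m" by (simp add: field_simps)
  then have "(?m - x) * (p * z2 powr (p - 1)) = y powr p - ?m powr p" by (simp only: z2(3))
  ultimately have "?m powr p - x powr p < y powr p - ?m powr p" by (simp only:)
  then show ?thesis by simp
qed

lemma abs_powr_midpoint_less:
  fixes a b p :: real
  assumes p: "p > 1" and ab: "a \<noteq> b"
  shows "\<bar>(a + b) / 2\<bar> powr p < (\<bar>a\<bar> powr p + \<bar>b\<bar> powr p) / 2"
proof (cases "\<bar>a\<bar> = \<bar>b\<bar>")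
  case True
  then have "a + b = 0" "b \<noteq> 0" using ab by auto
  then show ?thesis using True p by simp
next
  case False
  have "\<bar>(a + b) / 2\<bar> powr p \<le> ((\<bar>a\<bar> + \<bar>b\<bar>) / 2) powr p"
    using p by (intro powr_mono2) auto
  also have "\<dots> < (\<bar>a\<bar> powr p + \<bar>b\<bar> powr p) / 2"
    using False powr_midpoint_less[OF p, of "\<bar>a\<bar>" "\<bar>b\<bar>"] powr_midpoint_less[OF p, of "\<bar>b\<bar>" "\<bar>a\<bar>"]
    by (cases "\<bar>a\<bar> < \<bar>b\<bar>") (auto simp: add.commute)
  finally show ?thesis .
qed

text \<open>A pointwise form of uniform convexity for all \<open>p > 1\<close>: either \<open>a\<close> and \<open>b\<close> are close relative to their
  size, or the midpoint defect is comparable to that size. By homogeneity it suffices to consider pairs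
  with \<open>max \<bar>a\<bar> \<bar>b\<bar> = 1\<close>; those that are not close form a compact set on which the defect is
  continuous and positive.\<close>

lemma abs_powr_uniform_convexity:
  fixes p \<delta> :: real
  assumes p: "p > 1" and \<delta>: "\<delta> > 0"
  obtains c where "c > 0" "\<And>a b. \<bar>a - b\<bar> powr p \<le> \<delta> * (\<bar>a\<bar> powr p + \<bar>b\<bar> powr p)
      + c * ((\<bar>a\<bar> powr p + \<bar>b\<bar> powr p) / 2 - \<bar>(a + b) / 2\<bar> powr p)"
proof -
  define D where "D z = (\<bar>fst z\<bar> powr p + \<bar>snd z\<bar> powr p) / 2 - \<bar>(fst z + snd z) / 2\<bar> powr p" for z :: "real \<times> real"
  have cpow: "continuous_on S (\<lambda>z. \<bar>f z\<bar> powr p)" if "continuous_on S f" for S and f :: "real \<times> real \<Rightarrow> real"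
    using that p by (intro continuous_on_powr') (auto intro!: continuous_intros)
  have cD: "continuous_on S D" for S
    unfolding D_def by (intro continuous_intros cpow) auto
  have D0: "D z \<ge> 0" for z
    using abs_powr_midpoint_less[OF p, of "fst z" "snd z"] by (cases "fst z = snd z") (auto simp: D_def)
  define K where "K = ({-1..1} \<times> {-1..1}) \<inter> {z :: real \<times> real. max \<bar>fst z\<bar> \<bar>snd z\<bar> = 1} \<inter> {z. \<delta> \<le> \<bar>fst z - snd z\<bar> powr p}"
  have "compact K"
    unfolding K_def
    by (intro compact_Int_closed compact_Times closed_Collect_eq closed_Collect_le continuous_intros cpow) auto
  obtain c0 where c0: "c0 > 0" "\<And>z. z \<in> K \<Longrightarrow> c0 \<le> D z"
  proof (cases "K = {}")
    case True
    then show ?thesis using that[of 1] by auto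
  next
    case False
    then obtain z where z: "z \<in> K" "\<And>y. y \<in> K \<Longrightarrow> D z \<le> D y"
      using continuous_attains_inf[OF \<open>compact K\<close> False cD] by blast
    have "fst z \<noteq> snd z" using z(1) \<delta> p by (auto simp: K_def)
    then have "D z > 0" using abs_powr_midpoint_less[OF p] by (simp add: D_def)
    then show ?thesis using that z(2) by blast
  qed
  show ?thesis
  proof (rule that[of "2 powr p / c0"])
    show "2 powr p / c0 > 0" using c0 by simp
    fix a b :: real
    have Dab: "(\<bar>a\<bar> powr p + \<bar>b\<bar> powr p) / 2 - \<bar>(a + b) / 2\<bar> powr p = D (a, b)" by (simp add: D_def)
    define m where "m = max \<bar>a\<bar> \<bar>b\<bar>"
    have m: "\<bar>a\<bar> \<le> m" "\<bar>b\<bar> \<le> m" "m \<ge> 0" by (auto simp: m_def)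
    have mp: "m powr p \<le> \<bar>a\<bar> powr p + \<bar>b\<bar> powr p"
      by (cases "\<bar>a\<bar> \<le> \<bar>b\<bar>") (auto simp: m_def max_def)
    show "\<bar>a - b\<bar> powr p \<le> \<delta> * (\<bar>a\<bar> powr p + \<bar>b\<bar> powr p)
      + 2 powr p / c0 * ((\<bar>a\<bar> powr p + \<bar>b\<bar> powr p) / 2 - \<bar>(a + b) / 2\<bar> powr p)"
      unfolding Dab
    proof (cases "\<bar>a - b\<bar> powr p \<le> \<delta> * m powr p")
      case True
      have "\<bar>a - b\<bar> powr p \<le> \<delta> * m powr p" by fact
      also have "\<dots> \<le> \<delta> * (\<bar>a\<bar> powr p + \<bar>b\<bar> powr p)" using mp \<delta> by simp
      finally show "\<bar>a - b\<bar> powr p \<le> \<delta> * (\<bar>a\<bar> powr p + \<bar>b\<bar> powr p) + 2 powr p / c0 * D (a, b)"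
        using D0[of "(a, b)"] c0 by (auto intro: order_trans)
    next
      case False
      have m0: "m > 0"
      proof (rule ccontr)
        assume "\<not> m > 0"
        then have "a = 0" "b = 0" using m by auto
        then show False using False p by (simp add: m_def)
      qed
      have "(a / m, b / m) \<in> K"
      proof -
        have "max \<bar>a / m\<bar> \<bar>b / m\<bar> = 1"
          using m0 unfolding m_def by (auto simp: max_def abs_divide)
        moreover have "a / m \<in> {-1..1}" "b / m \<in> {-1..1}" using m m0 by (auto simp: field_simps)
        moreover have "\<delta> \<le> \<bar>a / m - b / m\<bar> powr p"
        proof -
          have "\<bar>a / m - b / m\<bar> powr p = \<bar>a - b\<bar> powr p / m powr p"
            using m0 by (simp add: diff_divide_distrib[symmetric] abs_divide powr_divide)
          moreover have "\<delta> \<le> \<bar>a - b\<bar> powr p / m powr p" using False m0 by (simp add: pos_le_divide_eq)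
          ultimately show ?thesis by (simp only:)
        qed
        ultimately show ?thesis by (simp add: K_def del: atLeastAtMost_iff)
      qed
      then have "c0 \<le> D (a / m, b / m)" by (rule c0(2))
      also have "D (a / m, b / m) = D (a, b) / m powr p"
      proof -
        have "\<bar>(a / m + b / m) / 2\<bar> powr p = \<bar>(a + b) / 2\<bar> powr p / m powr p"
        proof -
          have "(a / m + b / m) / 2 = (a + b) / 2 / m" by (simp add: add_divide_distrib)
          then have "\<bar>(a / m + b / m) / 2\<bar> powr p = \<bar>(a + b) / 2 / m\<bar> powr p" by (simp only:)
          also have "\<bar>(a + b) / 2 / m\<bar> = \<bar>(a + b) / 2\<bar> / m" using m0 by (simp only: abs_divide abs_of_pos)
          also have "(\<bar>(a + b) / 2\<bar> / m) powr p = \<bar>(a + b) / 2\<bar> powr p / m powr p"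
            by (rule powr_divide)
          finally show ?thesis .
        qed
        moreover have "\<bar>a / m\<bar> powr p = \<bar>a\<bar> powr p / m powr p" "\<bar>b / m\<bar> powr p = \<bar>b\<bar> powr p / m powr p"
          using m0 by (auto simp: abs_divide powr_divide)
        ultimately show ?thesis unfolding D_def fst_conv snd_conv
          by (simp add: diff_divide_distrib add_divide_distrib)
      qed
      finally have c: "m powr p \<le> D (a, b) / c0" using m0 c0(1) by (simp add: field_simps)
      have "\<bar>a - b\<bar> powr p \<le> (2 * m) powr p" using m p by (intro powr_mono2) auto
      also have "\<dots> = 2 powr p * m powr p" using m0 by (simp add: powr_mult)
      also have "\<dots> \<le> 2 powr p * (D (a, b) / c0)" using c by (intro mult_left_mono) auto
      finally show "\<bar>a - b\<bar> powr p \<le> \<delta> * (\<bar>a\<bar> powr p + \<bar>b\<bar> powr p) + 2 powr p / c0 * D (a, b)"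
        using \<delta> by (simp add: add_increasing)
    qed
  qed
qed

text \<open>The argument of Riesz and Fischer. Along a subsequence the increments are so small that
  \<open>\<Sum>i. 2\<^bsup>ip\<^esup> \<bar>d i x\<bar>\<^sup>p\<close> is finite almost everywhere; then \<open>\<bar>d i x\<bar>\<close> is dominated by a geometric
  series and the subsequence converges. Fatou's lemma transfers the Cauchy estimate to the limit.\<close>

lemma Lp_complete:
  fixes g :: "nat \<Rightarrow> 'a \<Rightarrow> real"
  assumes p: "p > 1" and [measurable]: "\<And>k. g k \<in> borel_measurable M"
    and cauchy: "\<And>\<eta>. \<eta> > 0 \<Longrightarrow> \<exists>N. \<forall>j\<ge>N. \<forall>k\<ge>N. (\<integral>\<^sup>+x. ennreal (\<bar>g j x - g k x\<bar> powr p) \<partial>M) \<le> ennreal \<eta>"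
  obtains f where "f \<in> borel_measurable M" "(\<lambda>k. \<integral>\<^sup>+x. ennreal (\<bar>g k x - f x\<bar> powr p) \<partial>M) \<longlonglongrightarrow> 0"
proof -
  \<comment> \<open>The factor \<open>2\<^bsup>ip\<^esup>\<close> is what the weighted series below needs.\<close>
  define c where "c i = (1/2 :: real) ^ i / (2 ^ i) powr p" for i :: nat
  have "c i > 0" for i by (simp add: c_def)
  then have "\<forall>i. \<exists>N. \<forall>j\<ge>N. \<forall>k\<ge>N. (\<integral>\<^sup>+x. ennreal (\<bar>g j x - g k x\<bar> powr p) \<partial>M) \<le> ennreal (c i)"
    using cauchy by blast
  then obtain N where N: "\<And>i j k. N i \<le> j \<Longrightarrow> N i \<le> k \<Longrightarrow> (\<integral>\<^sup>+x. ennreal (\<bar>g j x - g k x\<bar> powr p) \<partial>M) \<le> ennreal (c i)"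
    by metis
  \<comment> \<open>An increasing sequence of indices with \<open>\<phi> i \<ge> N i\<close>.\<close>
  define \<phi> where "\<phi> i = (\<Sum>j\<le>i. N j) + i" for i
  have phiN: "N i \<le> \<phi> i" for i
    unfolding \<phi>_def using member_le_sum[of i "{..i}" N] by simp
  have phiS: "\<phi> i \<le> \<phi> (Suc i)" for i by (simp add: \<phi>_def)
  have phi_ge: "i \<le> \<phi> i" for i by (simp add: \<phi>_def)
  define d where "d i x = g (\<phi> (Suc i)) x - g (\<phi> i) x" for i x
  have [measurable]: "d i \<in> borel_measurable M" for i unfolding d_def by measurable
  have "(\<integral>\<^sup>+x. (\<Sum>i. ennreal ((2 ^ i) powr p * \<bar>d i x\<bar> powr p)) \<partial>M)
      = (\<Sum>i. \<integral>\<^sup>+x. ennreal ((2 ^ i) powr p * \<bar>d i x\<bar> powr p) \<partial>M)"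
    by (rule nn_integral_suminf) measurable
  also have "\<dots> \<le> (\<Sum>i. ennreal ((1/2) ^ i))"
  proof (rule suminf_le)
    fix i
    have "(\<integral>\<^sup>+x. ennreal ((2 ^ i) powr p * \<bar>d i x\<bar> powr p) \<partial>M)
        = (\<integral>\<^sup>+x. ennreal ((2 ^ i) powr p) * ennreal (\<bar>d i x\<bar> powr p) \<partial>M)"
      by (intro nn_integral_cong ennreal_mult) auto
    also have "\<dots> = ennreal ((2 ^ i) powr p) * (\<integral>\<^sup>+x. ennreal (\<bar>d i x\<bar> powr p) \<partial>M)"
      by (rule nn_integral_cmult) measurable
    also have "\<dots> \<le> ennreal ((2 ^ i) powr p) * ennreal (c i)"
      unfolding d_def using phiN[of i] phiS[of i] by (intro mult_left_mono N) auto
    also have "\<dots> = ennreal ((2 ^ i) powr p * c i)"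
      by (rule ennreal_mult[symmetric]) (auto simp: c_def)
    also have "(2 ^ i) powr p * c i = (1/2) ^ i" by (simp add: c_def)
    finally show "(\<integral>\<^sup>+x. ennreal ((2 ^ i) powr p * \<bar>d i x\<bar> powr p) \<partial>M) \<le> ennreal ((1/2) ^ i)" .
  qed auto
  also have "\<dots> = ennreal (\<Sum>i. (1/2) ^ i)"
    by (intro suminf_ennreal2 summable_geometric) auto
  finally have le: "(\<integral>\<^sup>+x. (\<Sum>i. ennreal ((2 ^ i) powr p * \<bar>d i x\<bar> powr p)) \<partial>M) \<le> ennreal (\<Sum>i. (1/2) ^ i)" .
  have "(\<integral>\<^sup>+x. (\<Sum>i. ennreal ((2 ^ i) powr p * \<bar>d i x\<bar> powr p)) \<partial>M) \<noteq> \<infinity>"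
    using le_less_trans[OF le ennreal_less_top] by (simp only: infinity_ennreal_def less_irrefl less_top)
  then have "AE x in M. (\<Sum>i. ennreal ((2 ^ i) powr p * \<bar>d i x\<bar> powr p)) \<noteq> \<infinity>"
    by (intro nn_integral_noteq_infinite borel_measurable_suminf_order) measurable
  then have conv: "AE x in M. convergent (\<lambda>i. g (\<phi> i) x)"
  proof eventually_elim
    case (elim x)
    define B where "B = enn2real (\<Sum>i. ennreal ((2 ^ i) powr p * \<bar>d i x\<bar> powr p))"
    have B: "(2 ^ i) powr p * \<bar>d i x\<bar> powr p \<le> B" for i
    proof -
      have "ennreal ((2 ^ i) powr p * \<bar>d i x\<bar> powr p) \<le> (\<Sum>i. ennreal ((2 ^ i) powr p * \<bar>d i x\<bar> powr p))"
        using sum_le_suminf[OF summableI, of "{i}" "\<lambda>i. ennreal ((2 ^ i) powr p * \<bar>d i x\<bar> powr p)"]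
        by (simp only: finite.intros sum.insert sum.empty empty_iff not_False_eq_True add_0_right simp_thms zero_le)
      also have "\<dots> = ennreal B" unfolding B_def using elim by (intro ennreal_enn2real[symmetric]) (simp only: less_top infinity_ennreal_def)
      finally show ?thesis by (subst (asm) ennreal_le_iff) (simp_all only: B_def enn2real_nonneg)
    qed
    have "summable (\<lambda>i. d i x)"
    proof (rule summable_comparison_test')
      show "summable (\<lambda>i. B powr (1 / p) * (1/2) ^ i)" by (intro summable_mult summable_geometric) auto
      show "norm (d i x) \<le> B powr (1 / p) * (1/2) ^ i" if "i \<ge> 0" for i
      proof -
        have "(2 ^ i * \<bar>d i x\<bar>) powr p \<le> B" using B[of i] by (simp add: powr_mult)
        then have "((2 ^ i * \<bar>d i x\<bar>) powr p) powr (1 / p) \<le> B powr (1 / p)" using p by (intro powr_mono2) auto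
        then have "2 ^ i * \<bar>d i x\<bar> \<le> B powr (1 / p)" using p by (simp add: powr_powr)
        then show ?thesis by (simp add: power_one_over field_simps)
      qed
    qed
    then have "convergent (\<lambda>n. \<Sum>i<n. d i x)" by (simp add: summable_iff_convergent)
    then have "convergent (\<lambda>n. (\<Sum>i<n. d i x) + g (\<phi> 0) x)" by (rule convergent_add) (rule convergent_const)
    moreover have "(\<Sum>i<n. d i x) + g (\<phi> 0) x = g (\<phi> n) x" for n
      unfolding d_def by (subst sum_lessThan_telescope) simp
    ultimately show ?case by simp
  qed
  define f where "f x = lim (\<lambda>i. g (\<phi> i) x)" for x
  have f [measurable]: "f \<in> borel_measurable M" unfolding f_def by measurable
  have lim: "AE x in M. (\<lambda>i. g (\<phi> i) x) \<longlonglongrightarrow> f x"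
    using conv by eventually_elim (simp add: f_def convergent_LIMSEQ_iff)
  have fatou: "(\<integral>\<^sup>+x. ennreal (\<bar>g k x - f x\<bar> powr p) \<partial>M) \<le> ennreal \<eta>"
    if k: "\<And>j. j \<ge> m \<Longrightarrow> (\<integral>\<^sup>+x. ennreal (\<bar>g k x - g j x\<bar> powr p) \<partial>M) \<le> ennreal \<eta>" for k m \<eta>
  proof -
    have "(\<integral>\<^sup>+x. ennreal (\<bar>g k x - f x\<bar> powr p) \<partial>M)
        = (\<integral>\<^sup>+x. liminf (\<lambda>i. ennreal (\<bar>g k x - g (\<phi> i) x\<bar> powr p)) \<partial>M)"
    proof (rule nn_integral_cong_AE)
      show "AE x in M. ennreal (\<bar>g k x - f x\<bar> powr p) = liminf (\<lambda>i. ennreal (\<bar>g k x - g (\<phi> i) x\<bar> powr p))"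
        using lim
      proof eventually_elim
        case (elim x)
        have "(\<lambda>i. \<bar>g k x - g (\<phi> i) x\<bar> powr p) \<longlonglongrightarrow> \<bar>g k x - f x\<bar> powr p"
          using p by (intro tendsto_powr2 tendsto_intros elim) auto
        then have "(\<lambda>i. ennreal (\<bar>g k x - g (\<phi> i) x\<bar> powr p)) \<longlonglongrightarrow> ennreal (\<bar>g k x - f x\<bar> powr p)"
          by (rule tendsto_ennrealI)
        then show ?case by (rule lim_imp_Liminf[OF sequentially_bot, symmetric])
      qed
    qed
    also have "\<dots> \<le> liminf (\<lambda>i. \<integral>\<^sup>+x. ennreal (\<bar>g k x - g (\<phi> i) x\<bar> powr p) \<partial>M)"
      by (rule nn_integral_liminf) measurable
    also have "\<dots> \<le> liminf (\<lambda>i::nat. ennreal \<eta>)"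
    proof (rule Liminf_mono)
      show "\<forall>\<^sub>F i in sequentially. (\<integral>\<^sup>+x. ennreal (\<bar>g k x - g (\<phi> i) x\<bar> powr p) \<partial>M) \<le> ennreal \<eta>"
        using eventually_ge_at_top[of m] by eventually_elim (use k phi_ge order_trans in blast)
    qed
    also have "\<dots> = ennreal \<eta>" by (simp add: Liminf_const)
    finally show ?thesis .
  qed
  have "(\<lambda>k. \<integral>\<^sup>+x. ennreal (\<bar>g k x - f x\<bar> powr p) \<partial>M) \<longlonglongrightarrow> 0"
  proof (rule tendsto_zero_ennreal)
    fix r :: real assume r: "0 < r"
    then obtain m where m: "\<forall>j\<ge>m. \<forall>k\<ge>m. (\<integral>\<^sup>+x. ennreal (\<bar>g j x - g k x\<bar> powr p) \<partial>M) \<le> ennreal (r / 2)"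
      using cauchy[of "r / 2"] by auto
    show "\<forall>\<^sub>F k in sequentially. (\<integral>\<^sup>+x. ennreal (\<bar>g k x - f x\<bar> powr p) \<partial>M) < ennreal r"
      using eventually_ge_at_top[of m]
    proof eventually_elim
      case (elim k)
      have "(\<integral>\<^sup>+x. ennreal (\<bar>g k x - f x\<bar> powr p) \<partial>M) \<le> ennreal (r / 2)"
        by (rule fatou[of m]) (use m elim in blast)
      also have "\<dots> < ennreal r" using r by (simp add: ennreal_less_iff)
      finally show ?case .
    qed
  qed
  with f show ?thesis by (rule that)
qed

section \<open>Boundary values\<close>

lemma poisson_extension_borel_add_cmult:
  fixes g h :: "real ^ 'n \<Rightarrow> real"
  assumes [measurable]: "g \<in> borel_measurable borel" "h \<in> borel_measurable borel"
    and "integrable lborel (\<lambda>y. poisson_kernel t (x - y) * g y)"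
    and "integrable lborel (\<lambda>y. poisson_kernel t (x - y) * h y)"
  shows "poisson_extension (\<lambda>y. a * g y + b * h y) (x, t) = a * poisson_extension g (x, t) + b * poisson_extension h (x, t)"
proof -
  have "poisson_extension (\<lambda>y. a * g y + b * h y) (x, t)
      = (\<integral>y. a * (poisson_kernel t (x - y) * g y) + b * (poisson_kernel t (x - y) * h y) \<partial>lborel)"
    by (subst poisson_extension_borel) (auto simp: algebra_simps)
  also have "\<dots> = a * poisson_extension g (x, t) + b * poisson_extension h (x, t)"
    using assms by (simp add: poisson_extension_borel)
  finally show ?thesis .
qed

lemma integrable_poisson_kernel_mult_Lp:
  fixes f :: "real ^ 'n \<Rightarrow> real"
  assumes t: "t > 0" and p: "p > 1" and [measurable]: "f \<in> borel_measurable borel"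
    and fi: "(\<integral>\<^sup>+y. ennreal (\<bar>f y\<bar> powr p) \<partial>lborel) < \<infinity>"
  shows "integrable lborel (\<lambda>y. poisson_kernel t (x - y) * f y)"
proof -
  let ?c = "poisson_const TYPE('n) * t powr (- real CARD('n))"
  have k: "integrable lborel (\<lambda>y. poisson_kernel t (x - y))"
    using has_bochner_integral_poisson_kernel_diff[OF t, of x] by (auto simp: has_bochner_integral_iff)
  have "integrable lborel (\<lambda>y. \<bar>f y\<bar> powr p)"
    by (rule integrableI_nonneg) (use fi in auto)
  then have i: "integrable lborel (\<lambda>y. poisson_kernel t (x - y) + ?c * \<bar>f y\<bar> powr p)"
    by (intro Bochner_Integration.integrable_add k integrable_mult_right)
  show ?thesis
  proof (rule Bochner_Integration.integrable_bound[OF i])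
    show "AE y in lborel. norm (poisson_kernel t (x - y) * f y) \<le> norm (poisson_kernel t (x - y) + ?c * \<bar>f y\<bar> powr p)"
    proof (rule AE_I2)
      fix y
      have k0: "poisson_kernel t (x - y) \<ge> 0" using t by (simp add: poisson_kernel_nonneg)
      have "\<bar>f y\<bar> \<le> 1 + \<bar>f y\<bar> powr p" by (rule abs_le_one_plus_powr[OF p])
      then have "poisson_kernel t (x - y) * \<bar>f y\<bar> \<le> poisson_kernel t (x - y) * (1 + \<bar>f y\<bar> powr p)"
        using k0 by (intro mult_left_mono)
      also have "\<dots> \<le> poisson_kernel t (x - y) + ?c * \<bar>f y\<bar> powr p"
        using poisson_kernel_le[OF t, of "x - y"] by (simp add: distrib_left mult_right_mono)
      finally show "norm (poisson_kernel t (x - y) * f y) \<le> norm (poisson_kernel t (x - y) + ?c * \<bar>f y\<bar> powr p)"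
        using k0 by (simp add: abs_mult)
    qed
  qed simp
qed

text \<open>Jensen's inequality and the bound of the kernel by a constant depending on \<open>t\<close> make the extension at a
  fixed point continuous with respect to convergence in \<open>L\<^sup>p\<close>.\<close>

lemma Lp_tendsto_imp_poisson_extension_tendsto:
  fixes g :: "nat \<Rightarrow> real ^ 'n \<Rightarrow> real"
  assumes t: "t > 0" and p: "p > 1"
    and [measurable]: "\<And>k. g k \<in> borel_measurable borel" "f \<in> borel_measurable borel"
    and lim: "(\<lambda>k. \<integral>\<^sup>+y. ennreal (\<bar>g k y - f y\<bar> powr p) \<partial>lborel) \<longlonglongrightarrow> 0"
    and gi: "\<And>k. integrable lborel (\<lambda>y. poisson_kernel t (x - y) * g k y)"
    and fi: "integrable lborel (\<lambda>y. poisson_kernel t (x - y) * f y)"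
  shows "(\<lambda>k. poisson_extension (g k) (x, t)) \<longlonglongrightarrow> poisson_extension f (x, t)"
proof -
  let ?c = "poisson_const TYPE('n) * t powr (- real CARD('n))"
  have c: "?c \<ge> 0" using poisson_const_pos[where 'n='n] by simp
  have le: "ennreal (\<bar>poisson_extension (g k) (x, t) - poisson_extension f (x, t)\<bar> powr p)
      \<le> ennreal ?c * (\<integral>\<^sup>+y. ennreal (\<bar>g k y - f y\<bar> powr p) \<partial>lborel)" for k
  proof -
    have "poisson_extension (g k) (x, t) - poisson_extension f (x, t) = poisson_extension (\<lambda>y. g k y - f y) (x, t)"
      using poisson_extension_borel_add_cmult[of "g k" f t x 1 "-1"] gi fi by simp
    then have "ennreal (\<bar>poisson_extension (g k) (x, t) - poisson_extension f (x, t)\<bar> powr p)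
        \<le> (\<integral>\<^sup>+y. ennreal (poisson_kernel t (x - y) * \<bar>g k y - f y\<bar> powr p) \<partial>lborel)"
      using poisson_extension_jensen[OF t p, of "\<lambda>y. g k y - f y" x] by simp
    also have "\<dots> \<le> (\<integral>\<^sup>+y. ennreal ?c * ennreal (\<bar>g k y - f y\<bar> powr p) \<partial>lborel)"
    proof (rule nn_integral_mono)
      fix y
      have "ennreal (poisson_kernel t (x - y) * \<bar>g k y - f y\<bar> powr p) \<le> ennreal (?c * \<bar>g k y - f y\<bar> powr p)"
        by (intro ennreal_leI mult_right_mono poisson_kernel_le t) simp
      also have "\<dots> = ennreal ?c * ennreal (\<bar>g k y - f y\<bar> powr p)" by (rule ennreal_mult[OF c]) simp
      finally show "ennreal (poisson_kernel t (x - y) * \<bar>g k y - f y\<bar> powr p) \<le> ennreal ?c * ennreal (\<bar>g k y - f y\<bar> powr p)" .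
    qed
    also have "\<dots> = ennreal ?c * (\<integral>\<^sup>+y. ennreal (\<bar>g k y - f y\<bar> powr p) \<partial>lborel)"
      by (rule nn_integral_cmult) simp
    finally show ?thesis .
  qed
  have "(\<lambda>k. ennreal ?c * (\<integral>\<^sup>+y. ennreal (\<bar>g k y - f y\<bar> powr p) \<partial>lborel)) \<longlonglongrightarrow> ennreal ?c * 0"
    by (intro ennreal_tendsto_cmult lim) simp
  then have lim': "(\<lambda>k. ennreal ?c * (\<integral>\<^sup>+y. ennreal (\<bar>g k y - f y\<bar> powr p) \<partial>lborel)) \<longlonglongrightarrow> 0"
    by simp
  have "(\<lambda>k. ennreal (\<bar>poisson_extension (g k) (x, t) - poisson_extension f (x, t)\<bar> powr p)) \<longlonglongrightarrow> 0"
    by (rule tendsto_sandwich[OF _ _ tendsto_const lim']) (simp_all add: le)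
  then have 1: "(\<lambda>k. \<bar>poisson_extension (g k) (x, t) - poisson_extension f (x, t)\<bar> powr p) \<longlonglongrightarrow> 0"
    by (subst (asm) ennreal_tendsto_0_iff) auto
  have "(\<lambda>k. (\<bar>poisson_extension (g k) (x, t) - poisson_extension f (x, t)\<bar> powr p) powr (1 / p)) \<longlonglongrightarrow> 0 powr (1 / p)"
    using p by (intro tendsto_powr2 1 tendsto_const) auto
  then have "(\<lambda>k. \<bar>poisson_extension (g k) (x, t) - poisson_extension f (x, t)\<bar>) \<longlonglongrightarrow> 0"
    using p by (simp add: powr_powr)
  then have "(\<lambda>k. poisson_extension (g k) (x, t) - poisson_extension f (x, t)) \<longlonglongrightarrow> 0"
    by (simp add: tendsto_rabs_zero_iff)
  then show ?thesis by (simp add: LIM_zero_iff)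
qed

text \<open>Let \<open>\<Lambda>\<close> be the supremum of the integrals of \<open>\<bar>u(\<cdot>, t)\<bar>\<^sup>p\<close> for \<open>0 < t \<le> 1\<close>. Extending the midpoint of
  the slices at \<open>a i\<close> and \<open>b i\<close> by a height \<open>r\<close> gives the midpoint of the slices at \<open>r + a i\<close> and
  \<open>r + b i\<close>, which converges pointwise to the slice at \<open>r\<close>; so by contraction and Fatou's lemma the
  midpoints have integrals \<open>Y i\<close> with \<open>liminf Y \<ge> \<Lambda>\<close>. As neither slice exceeds \<open>\<Lambda>\<close>, the midpoint defect
  tends to \<open>0\<close>, and uniform convexity applies.\<close>

lemma poisson_slices_Lp_close:
  fixes u :: "(real ^ 'n) \<times> real \<Rightarrow> real" and a b :: "nat \<Rightarrow> real"
  assumes p: "p > 1" and u [measurable]: "u \<in> borel_measurable borel"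
    and cont: "continuous_on upper_half_space u"
    and rep: "\<And>x t \<epsilon>. \<epsilon> > 0 \<Longrightarrow> t > 0 \<Longrightarrow> u (x, t + \<epsilon>) = poisson_extension (\<lambda>y. u (y, \<epsilon>)) (x, t)"
    and L: "\<And>\<tau>. 0 < \<tau> \<Longrightarrow> \<tau> \<le> 1 \<Longrightarrow> (\<integral>\<^sup>+x. ennreal (\<bar>u (x, \<tau>)\<bar> powr p) \<partial>lborel) \<le> ennreal L"
    and a: "\<And>i. 0 < a i" "\<And>i. a i \<le> 1" "a \<longlonglongrightarrow> 0"
    and b: "\<And>i. 0 < b i" "\<And>i. b i \<le> 1" "b \<longlonglongrightarrow> 0"
  shows "(\<lambda>i. \<integral>\<^sup>+x. ennreal (\<bar>u (x, a i) - u (x, b i)\<bar> powr p) \<partial>lborel) \<longlonglongrightarrow> 0"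
proof -
  define I where "I t = (\<integral>\<^sup>+x. ennreal (\<bar>u (x, t)\<bar> powr p) \<partial>lborel)" for t
  define Y where "Y i = (\<integral>\<^sup>+x. ennreal (\<bar>(u (x, a i) + u (x, b i)) / 2\<bar> powr p) \<partial>lborel)" for i
  define X where "X i = (\<integral>\<^sup>+x. ennreal (\<bar>u (x, a i) - u (x, b i)\<bar> powr p) \<partial>lborel)" for i
  define \<Lambda> where "\<Lambda> = (SUP t\<in>{0<..1}. I t)"
  have "\<Lambda> \<le> ennreal L" unfolding \<Lambda>_def I_def by (intro SUP_least L) auto
  then have Lam: "\<Lambda> < \<infinity>" using le_less_trans ennreal_less_top by (metis infinity_ennreal_def)
  have ILam: "I t \<le> \<Lambda>" if "0 < t" "t \<le> 1" for t unfolding \<Lambda>_def by (rule SUP_upper) (use that in auto)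
  define S where "S = enn2real \<Lambda>"
  have lam: "S \<ge> 0" "\<Lambda> = ennreal S" using Lam by (auto simp: S_def)
  have slice_int: "integrable lborel (\<lambda>y. poisson_kernel t (x - y) * u (y, \<tau>))" if "0 < \<tau>" "\<tau> \<le> 1" "t > 0" for \<tau> t x
    by (rule integrable_poisson_kernel_mult_Lp[OF that(3) p])
      (use ILam[OF that(1,2)] Lam in \<open>auto simp: I_def intro: le_less_trans\<close>)
  have liminfY: "I r \<le> liminf Y" if r: "0 < r" for r
  proof -
    have "I r = (\<integral>\<^sup>+x. liminf (\<lambda>i. ennreal (\<bar>(u (x, r + a i) + u (x, r + b i)) / 2\<bar> powr p)) \<partial>lborel)"
      unfolding I_def
    proof (rule nn_integral_cong)
      fix x
      have ct: "isCont u (x, r)"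
      proof -
        have "(x, r) \<in> upper_half_space" using r by (simp add: upper_half_space_def)
        then show ?thesis using cont continuous_on_eq_continuous_at[OF open_upper_half_space, of u] by blast
      qed
      have "(\<lambda>i. (x, r + a i)) \<longlonglongrightarrow> (x, r + 0)" "(\<lambda>i. (x, r + b i)) \<longlonglongrightarrow> (x, r + 0)"
        by (intro tendsto_intros a b)+
      then have "(\<lambda>i. u (x, r + a i)) \<longlonglongrightarrow> u (x, r)" "(\<lambda>i. u (x, r + b i)) \<longlonglongrightarrow> u (x, r)"
        using isCont_tendsto_compose[OF ct] by auto
      then have "(\<lambda>i. \<bar>(u (x, r + a i) + u (x, r + b i)) / 2\<bar> powr p) \<longlonglongrightarrow> \<bar>(u (x, r) + u (x, r)) / 2\<bar> powr p"
        using p by (intro tendsto_powr2 tendsto_intros) auto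
      then have "(\<lambda>i. ennreal (\<bar>(u (x, r + a i) + u (x, r + b i)) / 2\<bar> powr p)) \<longlonglongrightarrow> ennreal (\<bar>u (x, r)\<bar> powr p)"
        by (intro tendsto_ennrealI) simp
      then show "ennreal (\<bar>u (x, r)\<bar> powr p) = liminf (\<lambda>i. ennreal (\<bar>(u (x, r + a i) + u (x, r + b i)) / 2\<bar> powr p))"
        by (rule lim_imp_Liminf[OF sequentially_bot, symmetric])
    qed
    also have "\<dots> \<le> liminf (\<lambda>i. \<integral>\<^sup>+x. ennreal (\<bar>(u (x, r + a i) + u (x, r + b i)) / 2\<bar> powr p) \<partial>lborel)"
      by (rule nn_integral_liminf) measurable
    also have "\<dots> \<le> liminf Y"
    proof (rule Liminf_mono, rule always_eventually, rule allI)
      fix i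
      have "(u (x, r + a i) + u (x, r + b i)) / 2 = poisson_extension (\<lambda>y. 1/2 * u (y, a i) + 1/2 * u (y, b i)) (x, r)" for x
        using poisson_extension_borel_add_cmult[of "\<lambda>y. u (y, a i)" "\<lambda>y. u (y, b i)" r x "1/2" "1/2"]
          slice_int[OF a(1,2) r] slice_int[OF b(1,2) r] rep[OF a(1) r] rep[OF b(1) r]
        by (simp add: add_divide_distrib)
      then have "(\<integral>\<^sup>+x. ennreal (\<bar>(u (x, r + a i) + u (x, r + b i)) / 2\<bar> powr p) \<partial>lborel)
          \<le> (\<integral>\<^sup>+y. ennreal (\<bar>1/2 * u (y, a i) + 1/2 * u (y, b i)\<bar> powr p - 0) \<partial>lborel)"
        using poisson_extension_truncated_contraction[OF r p, of "\<lambda>y. 1/2 * u (y, a i) + 1/2 * u (y, b i)" 0] by simp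
      also have "\<dots> = Y i" by (simp add: Y_def add_divide_distrib)
      finally show "(\<integral>\<^sup>+x. ennreal (\<bar>(u (x, r + a i) + u (x, r + b i)) / 2\<bar> powr p) \<partial>lborel) \<le> Y i" .
    qed
    finally show ?thesis .
  qed
  then have LY: "\<Lambda> \<le> liminf Y" unfolding \<Lambda>_def by (intro SUP_least) auto
  have "X \<longlonglongrightarrow> 0"
  proof (rule tendsto_zero_ennreal)
    fix \<eta> :: real assume eta: "0 < \<eta>"
    \<comment> \<open>Together with \<open>\<zeta>\<close> below this gives \<open>X i \<le> 3 \<eta> / 4\<close>: the terms with \<open>\<delta>\<close> contribute at most \<open>\<eta> / 2\<close> and the deficit of \<open>Y i\<close> at most \<open>\<eta> / 4\<close>.\<close>
    define \<delta> where "\<delta> = \<eta> / (4 * (S + 1))"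
    have d: "\<delta> > 0" "2 * \<delta> * S \<le> \<eta> / 2" using eta lam(1) by (auto simp: \<delta>_def field_simps)
    obtain c where c: "c > 0" and uc: "\<And>a b. \<bar>a - b\<bar> powr p \<le> \<delta> * (\<bar>a\<bar> powr p + \<bar>b\<bar> powr p)
      + c * ((\<bar>a\<bar> powr p + \<bar>b\<bar> powr p) / 2 - \<bar>(a + b) / 2\<bar> powr p)"
      using abs_powr_uniform_convexity[OF p d(1)] by blast
    have XY: "X i + ennreal c * Y i \<le> ennreal ((2 * \<delta> + c) * S)" for i
    proof -
      have "X i + ennreal c * Y i = (\<integral>\<^sup>+x. ennreal (\<bar>u (x, a i) - u (x, b i)\<bar> powr p)
          + ennreal c * ennreal (\<bar>(u (x, a i) + u (x, b i)) / 2\<bar> powr p) \<partial>lborel)"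
        unfolding X_def Y_def by (subst nn_integral_add) (auto simp: nn_integral_cmult)
      also have "\<dots> \<le> (\<integral>\<^sup>+x. ennreal (\<delta> + c / 2) * (ennreal (\<bar>u (x, a i)\<bar> powr p) + ennreal (\<bar>u (x, b i)\<bar> powr p)) \<partial>lborel)"
      proof (rule nn_integral_mono)
        fix x
        let ?a = "u (x, a i)" and ?b = "u (x, b i)"
        have "\<bar>?a - ?b\<bar> powr p + c * \<bar>(?a + ?b) / 2\<bar> powr p \<le> (\<delta> + c / 2) * (\<bar>?a\<bar> powr p + \<bar>?b\<bar> powr p)"
          using uc[of ?a ?b] by (simp add: algebra_simps add_divide_distrib)
        then have "ennreal (\<bar>?a - ?b\<bar> powr p + c * \<bar>(?a + ?b) / 2\<bar> powr p) \<le> ennreal ((\<delta> + c / 2) * (\<bar>?a\<bar> powr p + \<bar>?b\<bar> powr p))"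
          by (rule ennreal_leI)
        also have "ennreal ((\<delta> + c / 2) * (\<bar>?a\<bar> powr p + \<bar>?b\<bar> powr p))
            = ennreal (\<delta> + c / 2) * (ennreal (\<bar>?a\<bar> powr p) + ennreal (\<bar>?b\<bar> powr p))"
          using d c by (subst ennreal_mult) auto
        also have "ennreal (\<bar>?a - ?b\<bar> powr p + c * \<bar>(?a + ?b) / 2\<bar> powr p)
            = ennreal (\<bar>?a - ?b\<bar> powr p) + ennreal c * ennreal (\<bar>(?a + ?b) / 2\<bar> powr p)"
          using c by (subst ennreal_plus) (auto simp: ennreal_mult)
        finally show "ennreal (\<bar>?a - ?b\<bar> powr p) + ennreal c * ennreal (\<bar>(?a + ?b) / 2\<bar> powr p)
          \<le> ennreal (\<delta> + c / 2) * (ennreal (\<bar>?a\<bar> powr p) + ennreal (\<bar>?b\<bar> powr p))" .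
      qed
      also have "\<dots> = ennreal (\<delta> + c / 2) * (I (a i) + I (b i))"
        unfolding I_def by (subst nn_integral_cmult) (auto simp: nn_integral_add)
      also have "\<dots> \<le> ennreal (\<delta> + c / 2) * (ennreal S + ennreal S)"
        unfolding lam(2)[symmetric] by (intro mult_left_mono add_mono ILam a b) simp
      also have "\<dots> = ennreal ((\<delta> + c / 2) * (S + S))"
        unfolding ennreal_plus[OF lam(1) lam(1), symmetric]
        by (rule ennreal_mult[symmetric]) (use d c lam(1) in auto)
      also have "(\<delta> + c / 2) * (S + S) = (2 * \<delta> + c) * S" by (simp add: algebra_simps)
      finally show ?thesis .
    qed
    define \<zeta> where "\<zeta> = \<eta> / (4 * c)"
    have z: "\<zeta> > 0" "c * \<zeta> = \<eta> / 4" using eta c by (auto simp: \<zeta>_def)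
    have evY: "\<forall>\<^sub>F i in sequentially. ennreal S \<le> Y i + ennreal \<zeta>"
    proof (cases "S \<le> \<zeta>")
      case True
      have "ennreal S \<le> Y i + ennreal \<zeta>" for i
        using True by (intro add_increasing) (auto intro: ennreal_leI)
      then show ?thesis by simp
    next
      case False
      have "ennreal (S - \<zeta>) < ennreal S" using z False lam by (simp add: ennreal_less_iff)
      also have "\<dots> \<le> liminf Y" using LY by (simp only: lam(2))
      finally have "\<forall>\<^sub>F i in sequentially. ennreal (S - \<zeta>) < Y i" by (rule less_LiminfD)
      then show ?thesis
      proof eventually_elim
        case (elim i)
        have "ennreal S = ennreal (S - \<zeta>) + ennreal \<zeta>" using False z by (simp flip: ennreal_plus)
        also have "\<dots> \<le> Y i + ennreal \<zeta>" using elim by (intro add_right_mono) simp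
        finally show ?case .
      qed
    qed
    then show "\<forall>\<^sub>F i in sequentially. X i < ennreal \<eta>"
    proof eventually_elim
      case (elim i)
      have "ennreal (c * S) \<le> ennreal c * (Y i + ennreal \<zeta>)"
        using elim c lam(1) by (simp add: ennreal_mult mult_left_mono)
      also have "\<dots> = ennreal c * Y i + ennreal (\<eta> / 4)"
      proof -
        have "ennreal c * ennreal \<zeta> = ennreal (\<eta> / 4)"
          unfolding z(2)[symmetric] by (rule ennreal_mult[symmetric]) (use c z(1) in auto)
        then show ?thesis by (simp only: distrib_left)
      qed
      finally have "X i + ennreal (c * S) \<le> (X i + ennreal c * Y i) + ennreal (\<eta> / 4)"
        by (simp add: add.assoc add_left_mono)
      also have "\<dots> \<le> ennreal ((2 * \<delta> + c) * S) + ennreal (\<eta> / 4)" by (intro add_right_mono XY)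
      also have "\<dots> = ennreal (2 * \<delta> * S + \<eta> / 4 + c * S)"
        using d c lam(1) eta by (subst ennreal_plus[symmetric]) (auto simp: algebra_simps)
      also have "\<dots> \<le> ennreal (3 * \<eta> / 4 + c * S)" using d(2) by (intro ennreal_leI) (simp add: mult.commute mult.left_commute)
      also have "\<dots> = ennreal (3 * \<eta> / 4) + ennreal (c * S)"
        using eta c lam(1) by (intro ennreal_plus) auto
      finally have "X i \<le> ennreal (3 * \<eta> / 4)" by (simp add: ennreal_add_left_cancel_le add.commute[of _ "ennreal (c * S)"])
      also have "\<dots> < ennreal \<eta>" using eta by (simp add: ennreal_less_iff)
      finally show ?case .
    qed
  qed
  then show ?thesis unfolding X_def .
qed

lemma weak_Lp_harmonic_is_poisson_extension:
  fixes u :: "(real ^ 'n) \<times> real \<Rightarrow> real"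
  assumes p: "p > 1" and s: "s > 0" and u [measurable]: "u \<in> borel_measurable borel"
    and mv: "mean_value_on upper_half_space u"
    and weak: "\<And>l. l > 0 \<Longrightarrow> emeasure (half_space_measure s) {z \<in> upper_half_space. l < \<bar>snd z powr (s / p) * u z\<bar>}
      \<le> ennreal (C powr p / l powr p)"
  obtains f :: "real ^ 'n \<Rightarrow> real" where "f \<in> Lp p lebesgue" "\<And>z. z \<in> upper_half_space \<Longrightarrow> u z = poisson_extension f z"
proof -
  have cont: "continuous_on upper_half_space u" by (rule mean_value_on_continuous[OF mv])
  obtain K where K: "K > 0" "\<And>x t. t > 0 \<Longrightarrow> \<bar>u (x, t)\<bar> \<le> K * (1 + t powr (- real CARD('n)))"
    using weak_Lp_harmonic_growth[OF p s u mv weak] by blast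
  have rep: "u (x, t + \<epsilon>) = poisson_extension (\<lambda>y. u (y, \<epsilon>)) (x, t)" if e: "\<epsilon> > 0" and t: "t > 0" for x t \<epsilon>
  proof (rule poisson_semigroup_representation[OF mv _ e t])
    fix x and t :: real assume "\<epsilon> \<le> t"
    then have "t powr (- real CARD('n)) \<le> \<epsilon> powr (- real CARD('n))" using e by (intro powr_mono2') auto
    then have "K * (1 + t powr (- real CARD('n))) \<le> K * (1 + \<epsilon> powr (- real CARD('n)))"
      using K(1) by simp
    moreover have "\<bar>u (x, t)\<bar> \<le> K * (1 + t powr (- real CARD('n)))" using K(2) e \<open>\<epsilon> \<le> t\<close> by simp
    ultimately show "\<bar>u (x, t)\<bar> \<le> K * (1 + \<epsilon> powr (- real CARD('n)))" by simp
  qed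
  obtain L where L: "\<And>\<tau>. 0 < \<tau> \<Longrightarrow> \<tau> \<le> 1 \<Longrightarrow> (\<integral>\<^sup>+x. ennreal (\<bar>u (x, \<tau>)\<bar> powr p) \<partial>lborel) \<le> ennreal L"
    using weak_Lp_harmonic_slice_bound[OF p s u weak rep K] by blast
  define \<epsilon> where "\<epsilon> k = 1 / (real k + 1)" for k :: nat
  have eps: "0 < \<epsilon> k" "\<epsilon> k \<le> 1" for k by (auto simp: \<epsilon>_def)
  have eps_lim: "\<epsilon> \<longlonglongrightarrow> 0"
    unfolding \<epsilon>_def using LIMSEQ_inverse_real_of_nat by (simp add: inverse_eq_divide add.commute)
  define g where "g k y = u (y, \<epsilon> k)" for k y
  have [measurable]: "g k \<in> borel_measurable borel" for k unfolding g_def by measurable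
  have cauchy: "\<exists>N. \<forall>j\<ge>N. \<forall>k\<ge>N. (\<integral>\<^sup>+x. ennreal (\<bar>g j x - g k x\<bar> powr p) \<partial>lborel) \<le> ennreal \<eta>"
    if eta: "\<eta> > 0" for \<eta>
  proof (rule ccontr)
    assume "\<not> ?thesis"
    then have "\<forall>N. \<exists>jk. fst jk \<ge> N \<and> snd jk \<ge> N \<and> \<not> (\<integral>\<^sup>+x. ennreal (\<bar>g (fst jk) x - g (snd jk) x\<bar> powr p) \<partial>lborel) \<le> ennreal \<eta>"
      by (metis fst_conv snd_conv)
    then obtain jk where jk: "\<And>N. fst (jk N) \<ge> N" "\<And>N. snd (jk N) \<ge> N"
      "\<And>N. \<not> (\<integral>\<^sup>+x. ennreal (\<bar>g (fst (jk N)) x - g (snd (jk N)) x\<bar> powr p) \<partial>lborel) \<le> ennreal \<eta>"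
      by metis
    have sub: "(\<lambda>N. \<epsilon> (h N)) \<longlonglongrightarrow> 0" if "\<And>N. h N \<ge> N" for h :: "nat \<Rightarrow> nat"
    proof (rule filterlim_compose[OF eps_lim])
      show "filterlim h at_top sequentially"
        by (rule filterlim_at_top_mono[OF filterlim_ident]) (use that in auto)
    qed
    have "(\<lambda>N. \<integral>\<^sup>+x. ennreal (\<bar>u (x, \<epsilon> (fst (jk N))) - u (x, \<epsilon> (snd (jk N)))\<bar> powr p) \<partial>lborel) \<longlonglongrightarrow> 0"
      by (rule poisson_slices_Lp_close[OF p u cont rep L]) (auto simp: eps intro!: sub jk)
    then have "\<forall>\<^sub>F N in sequentially. (\<integral>\<^sup>+x. ennreal (\<bar>u (x, \<epsilon> (fst (jk N))) - u (x, \<epsilon> (snd (jk N)))\<bar> powr p) \<partial>lborel) < ennreal \<eta>"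
      by (rule order_tendstoD) (use eta in simp)
    then obtain N where "(\<integral>\<^sup>+x. ennreal (\<bar>u (x, \<epsilon> (fst (jk N))) - u (x, \<epsilon> (snd (jk N)))\<bar> powr p) \<partial>lborel) < ennreal \<eta>"
      by (auto simp: eventually_sequentially)
    then show False using jk(3)[of N] by (simp add: g_def)
  qed
  obtain f where f: "f \<in> borel_measurable lborel" and lim: "(\<lambda>k. \<integral>\<^sup>+x. ennreal (\<bar>g k x - f x\<bar> powr p) \<partial>lborel) \<longlonglongrightarrow> 0"
    by (rule Lp_complete[OF p _ cauchy]) auto
  have [measurable]: "f \<in> borel_measurable borel" using f by simp
  have "\<forall>\<^sub>F k in sequentially. (\<integral>\<^sup>+x. ennreal (\<bar>g k x - f x\<bar> powr p) \<partial>lborel) < 1"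
    using lim by (rule order_tendstoD) simp
  then obtain k where k: "(\<integral>\<^sup>+x. ennreal (\<bar>g k x - f x\<bar> powr p) \<partial>lborel) < 1"
    by (auto simp: eventually_sequentially)
  have "(\<integral>\<^sup>+x. ennreal (\<bar>f x\<bar> powr p) \<partial>lborel)
      \<le> (\<integral>\<^sup>+x. ennreal (2 powr p) * (ennreal (\<bar>g k x - f x\<bar> powr p) + ennreal (\<bar>g k x\<bar> powr p)) \<partial>lborel)"
  proof (rule nn_integral_mono)
    fix x
    let ?m = "max \<bar>g k x - f x\<bar> \<bar>g k x\<bar>"
    have "\<bar>f x\<bar> \<le> \<bar>g k x - f x\<bar> + \<bar>g k x\<bar>" by linarith
    also have "\<dots> \<le> ?m + ?m" by (intro add_mono) auto
    finally have "\<bar>f x\<bar> \<le> 2 * ?m" by simp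
    then have "\<bar>f x\<bar> powr p \<le> (2 * ?m) powr p" using p by (intro powr_mono2) auto
    also have "\<dots> = 2 powr p * ?m powr p" by (simp add: powr_mult)
    also have "\<dots> \<le> 2 powr p * (\<bar>g k x - f x\<bar> powr p + \<bar>g k x\<bar> powr p)"
      by (intro mult_left_mono) (auto simp: max_def)
    finally have "ennreal (\<bar>f x\<bar> powr p) \<le> ennreal (2 powr p * (\<bar>g k x - f x\<bar> powr p + \<bar>g k x\<bar> powr p))"
      by (rule ennreal_leI)
    then show "ennreal (\<bar>f x\<bar> powr p) \<le> ennreal (2 powr p) * (ennreal (\<bar>g k x - f x\<bar> powr p) + ennreal (\<bar>g k x\<bar> powr p))"
      by (simp add: ennreal_mult)
  qed
  also have "\<dots> = ennreal (2 powr p) * ((\<integral>\<^sup>+x. ennreal (\<bar>g k x - f x\<bar> powr p) \<partial>lborel) + (\<integral>\<^sup>+x. ennreal (\<bar>g k x\<bar> powr p) \<partial>lborel))"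
    by (subst nn_integral_cmult) (auto simp: nn_integral_add)
  also have "\<dots> \<le> ennreal (2 powr p) * (1 + ennreal L)"
    unfolding g_def by (intro mult_left_mono add_mono L eps) (use k in \<open>auto simp: g_def\<close>)
  also have "\<dots> < \<infinity>" by (simp add: ennreal_mult_less_top)
  finally have fi: "(\<integral>\<^sup>+x. ennreal (\<bar>f x\<bar> powr p) \<partial>lborel) < \<infinity>" .
  show ?thesis
  proof (rule that)
    have "integrable lborel (\<lambda>x. \<bar>f x\<bar> powr p)" by (rule integrableI_nonneg) (use fi in auto)
    then have "integrable lebesgue (\<lambda>x. \<bar>f x\<bar> powr p)" by (subst integrable_completion) auto
    moreover have "f \<in> borel_measurable lebesgue" by (rule measurable_completion) simp
    ultimately show "f \<in> Lp p lebesgue" by (simp add: Lp_def)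
    fix z :: "(real ^ 'n) \<times> real" assume z: "z \<in> upper_half_space"
    obtain x t where zx: "z = (x, t)" by (cases z)
    have t: "t > 0" using z by (simp add: zx upper_half_space_def)
    have "(\<lambda>k. poisson_extension (g k) (x, t)) \<longlonglongrightarrow> poisson_extension f (x, t)"
    proof (rule Lp_tendsto_imp_poisson_extension_tendsto[OF t p _ _ lim])
      show "integrable lborel (\<lambda>y. poisson_kernel t (x - y) * f y)"
        by (rule integrable_poisson_kernel_mult_Lp[OF t p _ fi]) simp
      show "integrable lborel (\<lambda>y. poisson_kernel t (x - y) * g k y)" for k
        by (rule integrable_poisson_kernel_mult_Lp[OF t p])
          (use L[OF eps, of k] in \<open>auto simp: g_def intro: le_less_trans\<close>)
    qed auto
    moreover have "(\<lambda>k. poisson_extension (g k) (x, t)) \<longlonglongrightarrow> u (x, t)"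
    proof -
      have ct: "isCont u (x, t)"
        using cont continuous_on_eq_continuous_at[OF open_upper_half_space, of u] z by (simp add: zx)
      have "(\<lambda>k. (x, t + \<epsilon> k)) \<longlonglongrightarrow> (x, t + 0)" by (intro tendsto_intros eps_lim)
      then have "(\<lambda>k. u (x, t + \<epsilon> k)) \<longlonglongrightarrow> u (x, t)"
        using isCont_tendsto_compose[OF ct] by auto
      then show ?thesis using rep[OF eps(1) t] by (simp add: g_def[abs_def])
    qed
    ultimately show "u z = poisson_extension f z" unfolding zx by (rule LIMSEQ_unique[symmetric])
  qed
qed

theorem proposition6p1:
  fixes p s :: real
  assumes "p > 1" and "s > 0"
  shows "(\<forall>f :: real ^ 'n \<Rightarrow> real. f \<in> Lp p lebesgue \<longrightarrow>
            (\<lambda>(x, t). t powr (s / p) * poisson_extension f (x, t)) \<in> weak_Lp p (half_space_measure s))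
       \<and> (\<forall>u :: (real ^ 'n) \<times> real \<Rightarrow> real.
            harmonic_on upper_half_space u \<longrightarrow>
            (\<lambda>(x, t). t powr (s / p) * u (x, t)) \<in> weak_Lp p (half_space_measure s) \<longrightarrow>
            (\<exists>f :: real ^ 'n \<Rightarrow> real. f \<in> Lp p lebesgue \<and>
               (\<forall>z \<in> upper_half_space. u z = poisson_extension f z)))"
proof (intro conjI allI impI)
  show "(\<lambda>(x, t). t powr (s / p) * poisson_extension f (x, t)) \<in> weak_Lp p (half_space_measure s)"
    if "f \<in> Lp p lebesgue" for f :: "real ^ 'n \<Rightarrow> real"
    by (rule poisson_extension_in_weak_Lp[OF assms that])
  fix u :: "(real ^ 'n) \<times> real \<Rightarrow> real"
  assume h: "harmonic_on upper_half_space u"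
    and "(\<lambda>(x, t). t powr (s / p) * u (x, t)) \<in> weak_Lp p (half_space_measure s)"
  then obtain C where C: "\<And>l. l > 0 \<Longrightarrow> emeasure (half_space_measure s)
      {z \<in> upper_half_space. l < \<bar>snd z powr (s / p) * u z\<bar>} \<le> ennreal (C powr p / l powr p)"
    unfolding weak_Lp_def space_half_space_measure by (auto simp: case_prod_unfold)
  \<comment> \<open>The values of \<open>u\<close> outside the half space are arbitrary; setting them to \<open>0\<close> gives a Borel function.\<close>
  define v where "v z = indicator upper_half_space z *\<^sub>R u z" for z
  have v: "v z = u z" if "z \<in> upper_half_space" for z using that by (simp add: v_def)
  have mu: "mean_value_on upper_half_space u" by (rule mean_value_on_harmonic[OF h])
  have mv: "mean_value_on upper_half_space v" by (rule mean_value_on_cong[OF mu v])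
  have vm: "v \<in> borel_measurable borel"
    unfolding v_def
    by (rule borel_measurable_continuous_on_indicator[OF upper_half_space_sets mean_value_on_continuous[OF mu]])
  have "{z \<in> upper_half_space. l < \<bar>snd z powr (s / p) * v z\<bar>} = {z \<in> upper_half_space. l < \<bar>snd z powr (s / p) * u z\<bar>}" for l
    using v by auto
  with C have "emeasure (half_space_measure s) {z \<in> upper_half_space. l < \<bar>snd z powr (s / p) * v z\<bar>}
      \<le> ennreal (C powr p / l powr p)" if "l > 0" for l
    using that by simp
  then obtain f :: "real ^ 'n \<Rightarrow> real" where "f \<in> Lp p lebesgue" "\<And>z. z \<in> upper_half_space \<Longrightarrow> v z = poisson_extension f z"
    using weak_Lp_harmonic_is_poisson_extension[OF assms vm mv] by blast
  then show "\<exists>f :: real ^ 'n \<Rightarrow> real. f \<in> Lp p lebesgue \<and> (\<forall>z \<in> upper_half_space. u z = poisson_extension f z)"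
    using v by (intro exI[of _ f]) auto
qed

end
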